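(* Let $\mathbf P$ be a cyclic CFSM protocol with communication graph $(N,E)$ and let $\beta\in E$. For each $j\in N$ let $V_j\subseteq K_j$ be a set of states such that $h_j\in V_j$ and such that whenever $p_j\xrightarrow{-b}q_j$ in $F_j$ (for some $b$), $q_j\in V_j$. Then there is an algorithm to decide whether any given family of regular sets $Q(S)\subseteq M_\beta^*$ indexed by $S\in\prod_{j\in N}V_j$ can be extended to a family of sets $Q(S)$ indexed by $S\in\prod_{j\in N}K_j$ that is consistent with respect to $\mathbf P$ and $\beta$. Moreover, if the family can be extended, then the smallest such sets $Q(S)$ are regular and can be automatically constructed.
   Context: A CFSM protocol $\mathbf P$ has a finite directed communication graph $G=(N,E)$ (edge $\xi$ has tail $-\xi$, head $+\xi$), pairwise disjoint finite message sets $M_\xi$, and for each $j\in N$ a finite state machine $F_j=(K_j,\Sigma_j,T_j,h_j)$: finite state set $K_j$, initial state $h_j$, alphabet $\Sigma_j=\{+b: b\in M_\xi,\ j=+\xi\}\cup\{-b: b\in M_\xi,\ j=-\xi\}$, transitions $T_j\subseteq K_j\times\Sigma_j\times K_j$ written $p\xrightarrow{e}q$ ($+b$ = receive, $-b$ = send). A composite state is $S=(p_j:j\in N)$; a channel content is $C=(x_\xi:\xi\in E)$, $x_\xi\in M_\xi^*$; global states are pairs $(S,C)$. A step: some machine $F_i$ takes $p_i\xrightarrow{-b}q_i$ with $b\in M_\beta$, $i=-\beta$, appending $b$ to the end of $x_\beta$; or takes $p_i\xrightarrow{+b}q_i$ with $b\in M_\beta$, $i=+\beta$, provided $x_\beta$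 begins with $b$, removing it; all else unchanged. $\vdash^*$ means reachability by finitely many steps. $\mathbf P$ is cyclic if $G$ is a directed cycle. A family $Q(S)\subseteq M_\beta^*$ indexed by all composite states is consistent with respect to $\mathbf P$ and $\beta$ if whenever $(S,(x_\xi))\vdash^*(S',(x'_\xi))$ with $x_\xi=x'_\xi=\lambda$ for all $\xi\neq\beta$ and $x_\beta\in Q(S)$, then $x'_\beta\in Q(S')$. An extension agrees with the given sets on $\prod_j V_j$; "smallest" is with respect to componentwise inclusion. *)

theory Defs
  imports Main "HOL-Library.FuncSet" "HOL-Library.Nat_Bijection"
begin

section \<open>Communicating finite state machines (CFSM protocols)\<close>

text \<open>Actions: Snd b is the send action -b, Rcv b is the receive action +b.\<close>
datatype 'm act = Snd 'm | Rcv 'm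

text \<open>A protocol: communication graph (nodes, edges with tail/head), message sets per edge,
  and for every node a finite state machine (state set, initial state, transitions).\<close>
record ('n, 'e, 'm, 's) protocol =
  pnodes :: "'n set"
  pedges :: "'e set"
  ptail  :: "'e \<Rightarrow> 'n"
  phead  :: "'e \<Rightarrow> 'n"
  pmsgs  :: "'e \<Rightarrow> 'm set"
  pstates :: "'n \<Rightarrow> 's set"
  pinit  :: "'n \<Rightarrow> 's"
  ptrans :: "'n \<Rightarrow> ('s \<times> 'm act \<times> 's) set"

definition alphabet :: "('n, 'e, 'm, 's) protocol \<Rightarrow> 'n \<Rightarrow> 'm act set" where
  "alphabet P j =
     {Rcv b | b \<xi>. \<xi> \<in> pedges P \<and> b \<in> pmsgs P \<xi> \<and> phead P \<xi> = j}
   \<union> {Snd b | b \<xi>. \<xi> \<in> pedges P \<and> b \<in> pmsgs P \<xi> \<and> ptail P \<xi> = j}"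

definition wf_protocol :: "('n, 'e, 'm, 's) protocol \<Rightarrow> bool" where
  "wf_protocol P \<longleftrightarrow>
     finite (pnodes P) \<and> finite (pedges P)
   \<and> (\<forall>\<xi>\<in>pedges P. ptail P \<xi> \<in> pnodes P \<and> phead P \<xi> \<in> pnodes P \<and> finite (pmsgs P \<xi>))
   \<and> (\<forall>\<xi>\<in>pedges P. \<forall>\<xi>'\<in>pedges P. \<xi> \<noteq> \<xi>' \<longrightarrow> pmsgs P \<xi> \<inter> pmsgs P \<xi>' = {})
   \<and> (\<forall>j\<in>pnodes P. finite (pstates P j) \<and> pinit P j \<in> pstates P j
        \<and> ptrans P j \<subseteq> pstates P j \<times> alphabet P j \<times> pstates P j)"

text \<open>The communication graph is a directed cycle: every node has exactly one outgoing and
  exactly one incoming edge, and the graph is strongly connected.\<close>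
definition cyclic :: "('n, 'e, 'm, 's) protocol \<Rightarrow> bool" where
  "cyclic P \<longleftrightarrow>
     pnodes P \<noteq> {}
   \<and> bij_betw (ptail P) (pedges P) (pnodes P)
   \<and> bij_betw (phead P) (pedges P) (pnodes P)
   \<and> (\<forall>j\<in>pnodes P. \<forall>k\<in>pnodes P.
        (j, k) \<in> {(ptail P \<xi>, phead P \<xi>) | \<xi>. \<xi> \<in> pedges P}\<^sup>*)"

text \<open>Composite states: extensional functions on the node set.\<close>
definition comp_states :: "('n, 'e, 'm, 's) protocol \<Rightarrow> ('n \<Rightarrow> 's) set" where
  "comp_states P = Pi\<^sub>E (pnodes P) (pstates P)"

text \<open>One step on global states (S, C).\<close>
inductive step :: "('n, 'e, 'm, 's) protocol
    \<Rightarrow> ('n \<Rightarrow> 's) \<times> ('e \<Rightarrow> 'm list) \<Rightarrow> ('n \<Rightarrow> 's) \<times> ('e \<Rightarrow> 'm list) \<Rightarrow> bool"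
  for P where
  send: "\<lbrakk> \<xi> \<in> pedges P; i = ptail P \<xi>; b \<in> pmsgs P \<xi>; (S i, Snd b, q) \<in> ptrans P i \<rbrakk>
         \<Longrightarrow> step P (S, C) (S(i := q), C(\<xi> := C \<xi> @ [b]))"
| recv: "\<lbrakk> \<xi> \<in> pedges P; i = phead P \<xi>; b \<in> pmsgs P \<xi>; (S i, Rcv b, q) \<in> ptrans P i;
           C \<xi> = b # w \<rbrakk>
         \<Longrightarrow> step P (S, C) (S(i := q), C(\<xi> := w))"

definition consistent ::
  "('n, 'e, 'm, 's) protocol \<Rightarrow> 'e \<Rightarrow> (('n \<Rightarrow> 's) \<Rightarrow> 'm list set) \<Rightarrow> bool" where
  "consistent P \<beta> Q \<longleftrightarrow>
     (\<forall>S C S' C'. S \<in> comp_states P \<longrightarrow> (\<forall>\<xi>. \<xi> \<noteq> \<beta> \<longrightarrow> C \<xi> = []) \<longrightarrow> C \<beta> \<in> Q S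
        \<longrightarrow> (step P)\<^sup>*\<^sup>* (S, C) (S', C') \<longrightarrow> (\<forall>\<xi>. \<xi> \<noteq> \<beta> \<longrightarrow> C' \<xi> = []) \<longrightarrow> C' \<beta> \<in> Q S')"

text \<open>Q is an extension (to all composite states) of the family Q0 given on prod_j V_j,
  consisting of subsets of M_beta^*, that is consistent w.r.t. P and beta.\<close>
definition is_extension ::
  "('n, 'e, 'm, 's) protocol \<Rightarrow> 'e \<Rightarrow> ('n \<Rightarrow> 's set) \<Rightarrow> (('n \<Rightarrow> 's) \<Rightarrow> 'm list set)
     \<Rightarrow> (('n \<Rightarrow> 's) \<Rightarrow> 'm list set) \<Rightarrow> bool" where
  "is_extension P \<beta> V Q0 Q \<longleftrightarrow>
     (\<forall>S\<in>comp_states P. Q S \<subseteq> lists (pmsgs P \<beta>))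
   \<and> (\<forall>S\<in>Pi\<^sub>E (pnodes P) V. Q S = Q0 S)
   \<and> consistent P \<beta> Q"

definition smallest_extension ::
  "('n, 'e, 'm, 's) protocol \<Rightarrow> 'e \<Rightarrow> ('n \<Rightarrow> 's set) \<Rightarrow> (('n \<Rightarrow> 's) \<Rightarrow> 'm list set)
     \<Rightarrow> (('n \<Rightarrow> 's) \<Rightarrow> 'm list set) \<Rightarrow> bool" where
  "smallest_extension P \<beta> V Q0 Q \<longleftrightarrow>
     is_extension P \<beta> V Q0 Q
   \<and> (\<forall>Q'. is_extension P \<beta> V Q0 Q' \<longrightarrow> (\<forall>S\<in>comp_states P. Q S \<subseteq> Q' S))"

text \<open>Hypotheses on the sets V_j.\<close>
definition good_V :: "('n, 'e, 'm, 's) protocol \<Rightarrow> ('n \<Rightarrow> 's set) \<Rightarrow> bool" where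
  "good_V P V \<longleftrightarrow>
     (\<forall>j\<in>pnodes P. V j \<subseteq> pstates P j \<and> pinit P j \<in> V j
        \<and> (\<forall>p b q. (p, Snd b, q) \<in> ptrans P j \<longrightarrow> q \<in> V j))"

section \<open>Finite automata and regular languages\<close>

text \<open>A nondeterministic finite automaton: (initial state, final states, transitions).\<close>
type_synonym 'a nfa = "nat \<times> nat list \<times> (nat \<times> 'a \<times> nat) list"

inductive nfa_path :: "(nat \<times> 'a \<times> nat) list \<Rightarrow> nat \<Rightarrow> 'a list \<Rightarrow> nat \<Rightarrow> bool" for \<delta> where
  nil: "nfa_path \<delta> p [] p"
| cons: "(p, a, q) \<in> set \<delta> \<Longrightarrow> nfa_path \<delta> q w r \<Longrightarrow> nfa_path \<delta> p (a # w) r"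

definition nfa_lang :: "'a nfa \<Rightarrow> 'a list set" where
  "nfa_lang A = (case A of (q0, F, \<delta>) \<Rightarrow> {w. \<exists>f\<in>set F. nfa_path \<delta> q0 w f})"

definition regular :: "'a list set \<Rightarrow> bool" where
  "regular L \<longleftrightarrow> (\<exists>A :: 'a nfa. nfa_lang A = L)"

section \<open>Computability: partial recursive functions\<close>

datatype recf = Zf | Sf | Proj nat | Cn recf "recf list" | Pr recf recf | Mn recf

inductive reval :: "recf \<Rightarrow> nat list \<Rightarrow> nat \<Rightarrow> bool"
  and reval_list :: "recf list \<Rightarrow> nat list \<Rightarrow> nat list \<Rightarrow> bool" where
  zero: "reval Zf xs 0"
| succ: "reval Sf (x # xs) (Suc x)"
| proj: "i < length xs \<Longrightarrow> reval (Proj i) xs (xs ! i)"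
| comp: "reval_list gs xs ys \<Longrightarrow> reval f ys y \<Longrightarrow> reval (Cn f gs) xs y"
| pr0: "reval f xs y \<Longrightarrow> reval (Pr f g) (0 # xs) y"
| prS: "reval (Pr f g) (n # xs) y \<Longrightarrow> reval g (n # y # xs) z \<Longrightarrow> reval (Pr f g) (Suc n # xs) z"
| mu: "reval f (n # xs) 0 \<Longrightarrow> (\<forall>m<n. \<exists>y>0. reval f (m # xs) y) \<Longrightarrow> reval (Mn f) xs n"
| lnil: "reval_list [] xs []"
| lcons: "reval f xs y \<Longrightarrow> reval_list gs xs ys \<Longrightarrow> reval_list (f # gs) xs (y # ys)"

section \<open>Finite codes of problem instances (all names are natural numbers)\<close>

text \<open>Protocol code: node list; edges (id, tail, head, messages); machines
  (node, states, initial state, transitions (p, is_send, b, q)).\<close>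
type_synonym proto_code =
  "nat list \<times> (nat \<times> nat \<times> nat \<times> nat list) list
     \<times> (nat \<times> nat list \<times> nat \<times> (nat \<times> bool \<times> nat \<times> nat) list) list"

text \<open>Family code: list of (composite state as (node, state) pairs, automaton).\<close>
type_synonym family_code = "((nat \<times> nat) list \<times> nat nfa) list"

definition decode_protocol :: "proto_code \<Rightarrow> (nat, nat, nat, nat) protocol" where
  "decode_protocol c = (case c of (ns, es, ms) \<Rightarrow>
     \<lparr> pnodes = set ns,
       pedges = set (map fst es),
       ptail = (\<lambda>e. case map_of es e of Some (t, h, m) \<Rightarrow> t | None \<Rightarrow> 0),
       phead = (\<lambda>e. case map_of es e of Some (t, h, m) \<Rightarrow> h | None \<Rightarrow> 0),
       pmsgs = (\<lambda>e. case map_of es e of Some (t, h, m) \<Rightarrow> set m | None \<Rightarrow> {}),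
       pstates = (\<lambda>j. case map_of ms j of Some (ks, h, ts) \<Rightarrow> set ks | None \<Rightarrow> {}),
       pinit = (\<lambda>j. case map_of ms j of Some (ks, h, ts) \<Rightarrow> h | None \<Rightarrow> 0),
       ptrans = (\<lambda>j. case map_of ms j of
                    Some (ks, h, ts) \<Rightarrow>
                      (\<lambda>(p, s, b, q). (p, if s then Snd b else Rcv b, q)) ` set ts
                  | None \<Rightarrow> {}) \<rparr>)"

definition decode_V :: "(nat \<times> nat list) list \<Rightarrow> nat \<Rightarrow> nat set" where
  "decode_V vs j = (case map_of vs j of Some l \<Rightarrow> set l | None \<Rightarrow> {})"

definition decode_state :: "nat set \<Rightarrow> (nat \<times> nat) list \<Rightarrow> nat \<Rightarrow> nat" where
  "decode_state N kvs j =
     (if j \<in> N then (case map_of kvs j of Some s \<Rightarrow> s | None \<Rightarrow> undefined) else undefined)"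

definition decode_family :: "nat set \<Rightarrow> family_code \<Rightarrow> (nat \<Rightarrow> nat) \<Rightarrow> nat list set" where
  "decode_family N fc S =
     (case find (\<lambda>e. decode_state N (fst e) = S) fc of Some e \<Rightarrow> nfa_lang (snd e) | None \<Rightarrow> {})"

definition covers :: "nat set \<Rightarrow> family_code \<Rightarrow> (nat \<Rightarrow> nat) set \<Rightarrow> bool" where
  "covers N fc D \<longleftrightarrow> (\<forall>S\<in>D. \<exists>e\<in>set fc. decode_state N (fst e) = S)"

subsection \<open>Explicit encoding of codes as natural numbers\<close>

definition enc_nfa :: "nat nfa \<Rightarrow> nat" where
  "enc_nfa A = (case A of (q0, F, \<delta>) \<Rightarrow>
     prod_encode (q0, prod_encode (list_encode F,
       list_encode (map (\<lambda>(p, a, q). prod_encode (p, prod_encode (a, q))) \<delta>))))"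

definition enc_protocol :: "proto_code \<Rightarrow> nat" where
  "enc_protocol c = (case c of (ns, es, ms) \<Rightarrow>
     prod_encode (list_encode ns, prod_encode (
       list_encode (map (\<lambda>(e, t, h, m). prod_encode (e, prod_encode (t, prod_encode (h, list_encode m)))) es),
       list_encode (map (\<lambda>(j, ks, h, ts). prod_encode (j, prod_encode (list_encode ks, prod_encode (h,
          list_encode (map (\<lambda>(p, s, b, q). prod_encode (p, prod_encode (of_bool s, prod_encode (b, q)))) ts)))))
         ms))))"

definition enc_V :: "(nat \<times> nat list) list \<Rightarrow> nat" where
  "enc_V vs = list_encode (map (\<lambda>(j, l). prod_encode (j, list_encode l)) vs)"

definition enc_family :: "family_code \<Rightarrow> nat" where
  "enc_family fc = list_encode (map (\<lambda>(kvs, A). prod_encode (list_encode (map prod_encode kvs), enc_nfa A)) fc)"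

definition enc_input :: "proto_code \<Rightarrow> nat \<Rightarrow> (nat \<times> nat list) list \<Rightarrow> family_code \<Rightarrow> nat" where
  "enc_input pc \<beta> vs fc = prod_encode (enc_protocol pc, prod_encode (\<beta>, prod_encode (enc_V vs, enc_family fc)))"

subsection \<open>Valid instances of the problem\<close>

definition valid_instance :: "proto_code \<Rightarrow> nat \<Rightarrow> (nat \<times> nat list) list \<Rightarrow> family_code \<Rightarrow> bool" where
  "valid_instance pc \<beta> vs fc \<longleftrightarrow>
     (let P = decode_protocol pc; V = decode_V vs; Q0 = decode_family (pnodes P) fc in
       wf_protocol P \<and> cyclic P \<and> \<beta> \<in> pedges P \<and> good_V P V
     \<and> covers (pnodes P) fc (Pi\<^sub>E (pnodes P) V)
     \<and> (\<forall>S\<in>Pi\<^sub>E (pnodes P) V. Q0 S \<subseteq> lists (pmsgs P \<beta>)))"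

end

theory Submission
  imports Defs "HOL-Library.Sublist"
begin

text \<open>
  Cut the cycle at \<open>\<beta>\<close>. On the remaining chain every computation that starts and ends with
  empty channels can be rearranged so that messages are handed over by rendezvous, executing only
  what is demanded by the next output on \<open>\<beta>\<close>. Right after such an output the last action of
  every machine that has moved is a send, so the composite state lies in \<open>\<Prod>V\<^sub>j\<close>. Hence, if an
  extension exists, the smallest one is obtained from the given sets by rendezvous and by
  receptions from \<open>\<beta>\<close> alone: it consists of the sets \<open>{x. \<exists>u \<in> L(S\<^sub>0, S). u x \<in> Q(S\<^sub>0)}\<close>, and an
  extension exists iff this family agrees with the given one and is closed under outputs on \<open>\<beta>\<close>.

  A finite monoid recognising all given sets recognises these quotients as well, because left
  multiplication acts on it. So a table of left and right multiplication by letters, together with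
  the accepting elements for each composite state, is a finite certificate from which both the
  answer and the automata can be read off. Such a certificate always exists and is checkable
  by bounded quantification, so it is found by unbounded search.
\<close>

section \<open>Recursive functions\<close>

text \<open>Receptions shorten the word on \<open>\<beta>\<close> at the front and outputs lengthen
  it at the back, so an automaton reading in one direction does not suffice: both multiplications
  are needed. One monoid must serve all given sets at once, so that words of the same value behave
  alike in every composite state.

  Each output on \<open>\<beta>\<close> can be arranged to end where the sets are prescribed and an
  extension has no freedom. This is why outputs do not generate new words and reappear as a
  condition to be checked.

  No closure or monoid is ever programmed as a recursive function. A certificate exists for every
  valid instance, extendable or not, so one search ends in both cases and only the checker has to be
  computable. The price is that the checker must reject solutions that are too large, since a closed
  set of accepting pairs need not be the least one; ranks turn leastness into a condition with
  bounded quantifiers. The certificate found is arbitrary, hence correctness is proved for all of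
  them.\<close>

definition recn :: "nat \<Rightarrow> (nat list \<Rightarrow> nat) \<Rightarrow> bool" where
  "recn k f \<longleftrightarrow> (\<exists>r. \<forall>xs. length xs = k \<longrightarrow> reval r xs (f xs))"

lemma recn_zero: "recn k (\<lambda>xs. 0)"
  unfolding recn_def by (intro exI[of _ Zf]) (simp add: reval_reval_list.zero)

lemma recn_proj: "i < k \<Longrightarrow> recn k (\<lambda>xs. xs ! i)"
  unfolding recn_def by (intro exI[of _ "Proj i"]) (simp add: reval_reval_list.proj)

lemma recn_Suc:
  assumes "recn k f" shows "recn k (\<lambda>xs. Suc (f xs))"
proof -
  obtain r where "\<forall>xs. length xs = k \<longrightarrow> reval r xs (f xs)"
    using assms unfolding recn_def by blast
  then have "\<forall>xs. length xs = k \<longrightarrow> reval (Cn Sf [r]) xs (Suc (f xs))"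
    by (metis reval_reval_list.comp reval_reval_list.lcons reval_reval_list.lnil reval_reval_list.succ)
  then show ?thesis unfolding recn_def by blast
qed

lemma recn_const: "recn k (\<lambda>xs. c)"
  by (induction c) (simp_all add: recn_zero recn_Suc)

lemma recn_comp:
  assumes f: "recn (length gs) f" and gs: "\<forall>g\<in>set gs. recn k g"
  shows "recn k (\<lambda>xs. f (map (\<lambda>g. g xs) gs))"
proof -
  obtain r where r: "\<forall>xs. length xs = length gs \<longrightarrow> reval r xs (f xs)"
    using f unfolding recn_def by blast
  have "\<exists>rs. \<forall>xs. length xs = k \<longrightarrow> reval_list rs xs (map (\<lambda>g. g xs) gs)"
    using gs
  proof (induction gs)
    case Nil
    then show ?case by (intro exI[of _ "[]"]) (simp add: reval_reval_list.lnil)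
  next
    case (Cons g gs)
    then obtain rs where rs: "\<forall>xs. length xs = k \<longrightarrow> reval_list rs xs (map (\<lambda>g. g xs) gs)"
      by auto
    from Cons.prems obtain s where s: "\<forall>xs. length xs = k \<longrightarrow> reval s xs (g xs)"
      unfolding recn_def by auto
    show ?case
      by (intro exI[of _ "s # rs"]) (use rs s in \<open>simp add: reval_reval_list.lcons\<close>)
  qed
  then obtain rs where "\<forall>xs. length xs = k \<longrightarrow> reval_list rs xs (map (\<lambda>g. g xs) gs)" by blast
  with r have "\<forall>xs. length xs = k \<longrightarrow> reval (Cn r rs) xs (f (map (\<lambda>g. g xs) gs))"
    by (metis length_map reval_reval_list.comp)
  then show ?thesis unfolding recn_def by blast
qed

text \<open>Here the inner function is curried, with \<open>xs ! i\<close> in the role of a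
  variable; claims about ordinary HOL terms can then be decomposed by \<open>intro\<close>.\<close>

lemma recn_comp1:
  assumes "recn 1 (\<lambda>xs. f (xs ! 0))" "recn k g"
  shows "recn k (\<lambda>xs. f (g xs))"
  using recn_comp[of "[g]" "\<lambda>xs. f (xs ! 0)" k] assms by simp

lemma recn_comp2:
  assumes "recn 2 (\<lambda>xs. f (xs ! 0) (xs ! 1))" "recn k g" "recn k h"
  shows "recn k (\<lambda>xs. f (g xs) (h xs))"
  using recn_comp[of "[g, h]" "\<lambda>xs. f (xs ! 0) (xs ! 1)" k] assms by (simp add: numeral_2_eq_2)

lemma recn_comp3:
  assumes "recn 3 (\<lambda>xs. f (xs ! 0) (xs ! 1) (xs ! 2))" "recn k g" "recn k h" "recn k i"
  shows "recn k (\<lambda>xs. f (g xs) (h xs) (i xs))"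
  using recn_comp[of "[g, h, i]" "\<lambda>xs. f (xs ! 0) (xs ! 1) (xs ! 2)" k] assms
  by (simp add: numeral_3_eq_3 numeral_2_eq_2)

lemma recn_prim_rec:
  assumes f: "recn k f" and g: "recn (Suc (Suc k)) g"
  shows "recn (Suc k) (\<lambda>xs. rec_nat (f (tl xs)) (\<lambda>n y. g (n # y # tl xs)) (hd xs))"
proof -
  obtain r where r: "\<forall>xs. length xs = k \<longrightarrow> reval r xs (f xs)" using f unfolding recn_def by blast
  obtain s where s: "\<forall>xs. length xs = Suc (Suc k) \<longrightarrow> reval s xs (g xs)"
    using g unfolding recn_def by blast
  have "reval (Pr r s) (n # xs) (rec_nat (f xs) (\<lambda>n y. g (n # y # xs)) n)"
    if "length xs = k" for n xs
  proof (induction n)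
    case 0
    then show ?case using r that by (simp add: reval_reval_list.pr0)
  next
    case (Suc n)
    from reval_reval_list.prS[OF this, of "g (n # _ # xs)"] s that show ?case by simp
  qed
  then show ?thesis unfolding recn_def
    by (intro exI[of _ "Pr r s"]) (metis length_Suc_conv list.sel(1) list.sel(3))
qed

text \<open>\<open>mu\<close> asks for a positive value at every argument below the result, which is
  minimality. Termination is paid for by the hypothesis that a zero exists for every argument
  list.\<close>

lemma recn_LEAST:
  assumes f: "recn (Suc k) f" and ex: "\<And>xs. length xs = k \<Longrightarrow> \<exists>n. f (n # xs) = 0"
  shows "recn k (\<lambda>xs. LEAST n. f (n # xs) = 0)"
proof -
  obtain r where r: "\<forall>xs. length xs = Suc k \<longrightarrow> reval r xs (f xs)" using f unfolding recn_def by blast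
  have "reval (Mn r) xs (LEAST n. f (n # xs) = 0)" if l: "length xs = k" for xs
  proof (rule reval_reval_list.mu)
    have "f ((LEAST n. f (n # xs) = 0) # xs) = 0" using ex[OF l] by (rule LeastI_ex)
    then show "reval r ((LEAST n. f (n # xs) = 0) # xs) 0"
      using r l by (metis length_Cons)
    show "\<forall>m<LEAST n. f (n # xs) = 0. \<exists>y>0. reval r (m # xs) y"
    proof (intro allI impI)
      fix m assume "m < (LEAST n. f (n # xs) = 0)"
      then have "f (m # xs) > 0" using not_less_Least by blast
      then show "\<exists>y>0. reval r (m # xs) y" using r l by (intro exI[of _ "f (m # xs)"]) simp
    qed
  qed
  then show ?thesis unfolding recn_def by blast
qed

lemma recn_cong:
  assumes "recn k f" "\<And>xs. length xs = k' \<Longrightarrow> f xs = g xs" "k = k'"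
  shows "recn k' g"
  using assms unfolding recn_def by metis

section \<open>Arithmetic and case distinction\<close>

lemma recn_add:
  assumes "recn k f" "recn k g" shows "recn k (\<lambda>xs. f xs + g xs)"
proof -
  have "recn (Suc 1) (\<lambda>xs. rec_nat (tl xs ! 0) (\<lambda>n y. Suc ((n # y # tl xs) ! 1)) (hd xs))"
    by (rule recn_prim_rec) (intro recn_Suc recn_proj, simp)+
  then have "recn 2 (\<lambda>xs. xs ! 0 + xs ! 1)"
  proof (rule recn_cong)
    fix xs :: "nat list" assume "length xs = 2"
    then obtain a b where "xs = [a, b]" by (auto simp: numeral_2_eq_2 length_Suc_conv)
    moreover have "rec_nat b (\<lambda>n y. Suc y) a = a + b" by (induction a) auto
    ultimately show "rec_nat (tl xs ! 0) (\<lambda>n y. Suc ((n # y # tl xs) ! 1)) (hd xs) = xs ! 0 + xs ! 1"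
      by simp
  qed simp
  from recn_comp2[OF this assms] show ?thesis .
qed

lemma recn_pred:
  assumes "recn k f" shows "recn k (\<lambda>xs. f xs - 1)"
proof -
  have "recn (Suc 0) (\<lambda>xs. rec_nat ((\<lambda>xs. 0) (tl xs)) (\<lambda>n y. (n # y # tl xs) ! 0) (hd xs))"
    by (rule recn_prim_rec[OF recn_zero recn_proj]) simp
  then have "recn 1 (\<lambda>xs. xs ! 0 - 1)"
  proof (rule recn_cong)
    fix xs :: "nat list" assume "length xs = 1"
    then obtain a where "xs = [a]" by (auto simp: length_Suc_conv)
    then show "rec_nat 0 (\<lambda>n y. (n # y # tl xs) ! 0) (hd xs) = xs ! 0 - 1"
      by (cases a) auto
  qed simp
  from recn_comp1[OF this assms] show ?thesis .
qed

lemma recn_diff: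
  assumes "recn k f" "recn k g" shows "recn k (\<lambda>xs. f xs - g xs)"
proof -
  \<comment> \<open>The recursion runs over the subtrahend, which therefore comes first; the final
    composition swaps the arguments back.\<close>
  have "recn (Suc 1) (\<lambda>xs. rec_nat (tl xs ! 0) (\<lambda>n y. (n # y # tl xs) ! 1 - 1) (hd xs))"
    by (rule recn_prim_rec) (intro recn_pred recn_proj, simp)+
  then have "recn 2 (\<lambda>xs. xs ! 1 - xs ! 0)"
  proof (rule recn_cong)
    fix xs :: "nat list" assume "length xs = 2"
    then obtain a b where "xs = [a, b]" by (auto simp: numeral_2_eq_2 length_Suc_conv)
    moreover have "rec_nat b (\<lambda>n y. y - 1) a = b - a" by (induction a) auto
    ultimately show "rec_nat (tl xs ! 0) (\<lambda>n y. (n # y # tl xs) ! 1 - 1) (hd xs) = xs ! 1 - xs ! 0"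
      by simp
  qed simp
  from recn_comp2[where f="\<lambda>x y. y - x", OF this assms(2,1)] show ?thesis .
qed

lemma recn_if_zero:
  assumes "recn k c" "recn k f" "recn k g" shows "recn k (\<lambda>xs. if c xs = 0 then f xs else g xs)"
proof -
  \<comment> \<open>A recursion whose step ignores the previous value is a case distinction:
    position 3 of \<open>n # y # tl xs\<close> is the third argument, the value of the else
    branch.\<close>
  have "recn (Suc 2) (\<lambda>xs. rec_nat (tl xs ! 0) (\<lambda>n y. (n # y # tl xs) ! 3) (hd xs))"
    by (rule recn_prim_rec) (intro recn_proj, simp)+
  then have "recn 3 (\<lambda>xs. if xs ! 0 = 0 then xs ! 1 else xs ! 2)"
  proof (rule recn_cong)
    fix xs :: "nat list" assume "length xs = 3"
    then obtain a b c where "xs = [a, b, c]" by (auto simp: numeral_3_eq_3 length_Suc_conv)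
    then show "rec_nat (tl xs ! 0) (\<lambda>n y. (n # y # tl xs) ! 3) (hd xs) =
        (if xs ! 0 = 0 then xs ! 1 else xs ! 2)"
      by (cases a) (auto simp: numeral_3_eq_3 numeral_2_eq_2)
  qed simp
  from recn_comp3[where f="\<lambda>x y z. if x = 0 then y else z", OF this assms] show ?thesis .
qed

section \<open>Inverting the Cantor pairing\<close>

lemma recn_triangle:
  assumes "recn k f" shows "recn k (\<lambda>xs. triangle (f xs))"
proof -
  have "recn (Suc 0) (\<lambda>xs. rec_nat ((\<lambda>xs. 0) (tl xs)) (\<lambda>n y. (n # y # tl xs) ! 1 + Suc ((n # y # tl xs) ! 0)) (hd xs))"
    by (rule recn_prim_rec[OF recn_zero]) (intro recn_add recn_Suc recn_proj; simp)
  then have "recn 1 (\<lambda>xs. triangle (xs ! 0))"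
  proof (rule recn_cong)
    fix xs :: "nat list" assume "length xs = 1"
    then obtain a where "xs = [a]" by (auto simp: length_Suc_conv)
    moreover have "rec_nat 0 (\<lambda>n y. y + Suc n) a = triangle a" by (induction a) auto
    ultimately show "rec_nat 0 (\<lambda>n y. (n # y # tl xs) ! 1 + Suc ((n # y # tl xs) ! 0)) (hd xs)
        = triangle (xs ! 0)" by simp
  qed simp
  from recn_comp1[OF this assms] show ?thesis .
qed

lemma recn_prod_encode:
  assumes "recn k f" "recn k g" shows "recn k (\<lambda>xs. prod_encode (f xs, g xs))"
  unfolding prod_encode_def by (simp add: recn_add recn_triangle assms)

lemma triangle_less_iff: "triangle a < triangle (Suc b) \<Longrightarrow> a \<le> b"
proof (rule ccontr)
  assume "triangle a < triangle (Suc b)" "\<not> a \<le> b"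
  moreover have "triangle (Suc b) \<le> triangle a" if "Suc b \<le> a"
    using that by (induction a rule: dec_induct) auto
  ultimately show False by simp
qed

text \<open>For \<open>prod_encode (m, n) = triangle (m + n) + m\<close> this is the number
  \<open>m + n\<close> of the diagonal, the least \<open>k\<close> with
  \<open>z < triangle (Suc k)\<close>. Truncated subtraction gives the condition the form
  \<open>... = 0\<close> that \<open>recn_LEAST\<close> searches for.\<close>

definition diagonal :: "nat \<Rightarrow> nat" where
  "diagonal z = (LEAST k. Suc z - triangle (Suc k) = 0)"

lemma diagonal_prod_encode: "diagonal (prod_encode (m, n)) = m + n"
  unfolding diagonal_def
proof (rule Least_equality)
  show "Suc (prod_encode (m, n)) - triangle (Suc (m + n)) = 0"
    by (simp add: prod_encode_def)
  fix k assume "Suc (prod_encode (m, n)) - triangle (Suc k) = 0"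
  then have "triangle (m + n) < triangle (Suc k)" by (simp add: prod_encode_def)
  then show "m + n \<le> k" by (rule triangle_less_iff)
qed

lemma prod_decode_diagonal:
  "prod_decode z = (z - triangle (diagonal z), diagonal z - (z - triangle (diagonal z)))"
proof -
  obtain m n where z: "z = prod_encode (m, n)" by (metis prod_decode_inverse surj_pair)
  show ?thesis unfolding z diagonal_prod_encode by simp (simp add: prod_encode_def)
qed

lemma recn_diagonal:
  assumes "recn k f" shows "recn k (\<lambda>xs. diagonal (f xs))"
proof -
  have "recn 1 (\<lambda>xs. LEAST n. (\<lambda>xs. Suc (xs ! 1) - triangle (Suc (xs ! 0))) (n # xs) = 0)"
  proof (rule recn_LEAST)
    show "recn (Suc 1) (\<lambda>xs. Suc (xs ! 1) - triangle (Suc (xs ! 0)))"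
      by (intro recn_diff recn_Suc recn_triangle recn_proj) auto
    fix xs :: "nat list" assume "length xs = 1"
    have "a \<le> triangle a" for a by (induction a) auto
    from this[of "Suc (xs ! 0)"] show "\<exists>n. Suc ((n # xs) ! 1) - triangle (Suc ((n # xs) ! 0)) = 0"
      by (intro exI[of _ "xs ! 0"]) simp
  qed
  then have "recn 1 (\<lambda>xs. diagonal (xs ! 0))" unfolding diagonal_def by simp
  from recn_comp1[OF this assms] show ?thesis .
qed

lemma recn_fst_decode:
  assumes "recn k f" shows "recn k (\<lambda>xs. fst (prod_decode (f xs)))"
  by (subst prod_decode_diagonal) (simp add: recn_diff recn_triangle recn_diagonal assms)

lemma recn_snd_decode:
  assumes "recn k f" shows "recn k (\<lambda>xs. snd (prod_decode (f xs)))"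
  by (subst prod_decode_diagonal) (simp add: recn_diff recn_triangle recn_diagonal assms)

text \<open>Iteration with a computed exponent later walks along a coded list by repeated
  tails.\<close>

lemma recn_funpow:
  assumes f: "recn 1 (\<lambda>xs. f (xs ! 0))" and "recn k g" "recn k h"
  shows "recn k (\<lambda>xs. (f ^^ g xs) (h xs))"
proof -
  have "recn (Suc 1) (\<lambda>xs. rec_nat (tl xs ! 0) (\<lambda>n y. f ((n # y # tl xs) ! 1)) (hd xs))"
    by (rule recn_prim_rec) (intro recn_comp1[OF f] recn_proj, simp)+
  then have "recn 2 (\<lambda>xs. (f ^^ (xs ! 0)) (xs ! 1))"
  proof (rule recn_cong)
    fix xs :: "nat list" assume "length xs = 2"
    then obtain a b where "xs = [a, b]" by (auto simp: numeral_2_eq_2 length_Suc_conv)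
    moreover have "rec_nat b (\<lambda>n y. f y) a = (f ^^ a) b" by (induction a) auto
    ultimately show "rec_nat (tl xs ! 0) (\<lambda>n y. f ((n # y # tl xs) ! 1)) (hd xs)
        = (f ^^ (xs ! 0)) (xs ! 1)" by simp
  qed simp
  from recn_comp2[where f="\<lambda>n. f ^^ n", OF this assms(2,3)] show ?thesis .
qed

section \<open>Computable functions on encoded data types\<close>

class codable =
  fixes encd :: "'a \<Rightarrow> nat"
  assumes encd_eq_iff: "encd x = encd y \<longleftrightarrow> x = y"

text \<open>Unbounded search passes through all numbers. At a number that codes nothing the value of
  the checker would be unknown, so the type that is searched must use up every number as a
  code.\<close>

class bicodable = codable +
  assumes surj_encd: "\<exists>x. encd x = n"

instantiation nat :: bicodable
begin
definition encd_nat :: "nat \<Rightarrow> nat" where "encd_nat n = n"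
instance by standard (auto simp: encd_nat_def)
end

instantiation bool :: codable
begin
definition encd_bool :: "bool \<Rightarrow> nat" where "encd_bool b = of_bool b"
instance by standard (auto simp: encd_bool_def)
end

instantiation prod :: (codable, codable) codable
begin
definition encd_prod :: "'a \<times> 'b \<Rightarrow> nat" where
  "encd_prod p = prod_encode (encd (fst p), encd (snd p))"
instance by standard (auto simp: encd_prod_def encd_eq_iff prod_eq_iff)
end

instance prod :: (bicodable, bicodable) bicodable
proof
  fix n
  obtain a b where "prod_decode n = (a, b)" by fastforce
  moreover obtain x :: 'a and y :: 'b where "encd x = a" "encd y = b" using surj_encd by metis
  ultimately have "encd (x, y) = n" unfolding encd_prod_def by (metis fst_conv prod_decode_inverse snd_conv)
  then show "\<exists>p :: 'a \<times> 'b. encd p = n" ..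
qed

instantiation list :: (codable) codable
begin
definition encd_list :: "'a list \<Rightarrow> nat" where "encd_list l = list_encode (map encd l)"
instance by standard (simp add: encd_list_def list_encode_eq encd_eq_iff inj_map_eq_map inj_def)
end

instance list :: (bicodable) bicodable
proof
  fix n
  have "\<exists>l :: 'a list. map encd l = ns" for ns
    using surj_encd by (metis ex_map_conv)
  then obtain l :: "'a list" where "map encd l = list_decode n" by blast
  then have "encd l = n" by (simp add: encd_list_def)
  then show "\<exists>l :: 'a list. encd l = n" ..
qed

instantiation option :: (codable) codable
begin
definition encd_option :: "'a option \<Rightarrow> nat" where
  "encd_option x = (case x of None \<Rightarrow> 0 | Some y \<Rightarrow> Suc (encd y))"
instance by standard (auto simp: encd_option_def encd_eq_iff split: option.splits)
end

section \<open>Computability through codes\<close>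

definition rec1 :: "(nat \<Rightarrow> nat) \<Rightarrow> bool" where
  "rec1 g \<longleftrightarrow> recn 1 (\<lambda>xs. g (xs ! 0))"

text \<open>\<open>rec1\<close> makes \<open>g\<close> total, yet the equation speaks about codes
  alone; elsewhere \<open>g\<close> may take any value.\<close>

definition comput :: "('a::codable \<Rightarrow> 'b::codable) \<Rightarrow> bool" where
  "comput f \<longleftrightarrow> (\<exists>g. rec1 g \<and> (\<forall>x. g (encd x) = encd (f x)))"

lemma computI: "rec1 g \<Longrightarrow> (\<And>x. g (encd x) = encd (f x)) \<Longrightarrow> comput f"
  unfolding comput_def by blast

lemma recn_rec1: "rec1 g \<Longrightarrow> recn k f \<Longrightarrow> recn k (\<lambda>xs. g (f xs))"
  unfolding rec1_def by (rule recn_comp1)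

lemma comput_id: "comput (\<lambda>x. x)"
  by (rule computI[of "\<lambda>n. n"]) (simp_all add: rec1_def recn_proj)

lemma comput_const: "comput (\<lambda>x. c)"
  by (rule computI[of "\<lambda>n. encd c"]) (simp_all add: rec1_def recn_const)

lemma comput_compose:
  assumes "comput f" "comput g" shows "comput (\<lambda>x. f (g x))"
proof -
  obtain f' g' where f': "rec1 f'" and g': "rec1 g'" and "\<And>x. f' (encd x) = encd (f x)"
      "\<And>x. g' (encd x) = encd (g x)"
    using assms unfolding comput_def by blast
  moreover have "rec1 (\<lambda>n. f' (g' n))"
    using recn_rec1[OF f' g'[unfolded rec1_def]] by (simp add: rec1_def)
  ultimately show ?thesis by (intro computI[of "\<lambda>n. f' (g' n)"]) simp_all
qed

lemma comput_Pair:
  assumes "comput f" "comput g" shows "comput (\<lambda>x. (f x, g x))"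
proof -
  obtain f' g' where "rec1 f'" "rec1 g'" "\<And>x. f' (encd x) = encd (f x)" "\<And>x. g' (encd x) = encd (g x)"
    using assms unfolding comput_def by blast
  then show ?thesis
    by (intro computI[of "\<lambda>n. prod_encode (f' n, g' n)"])
      (auto simp: rec1_def recn_prod_encode encd_prod_def)
qed

lemma comput_fst: "comput f \<Longrightarrow> comput (\<lambda>x. fst (f x))"
  by (rule comput_compose[of fst], rule computI[of "\<lambda>n. fst (prod_decode n)"])
    (auto simp: rec1_def encd_prod_def intro: recn_fst_decode recn_proj)

lemma comput_snd: "comput f \<Longrightarrow> comput (\<lambda>x. snd (f x))"
  by (rule comput_compose[of snd], rule computI[of "\<lambda>n. snd (prod_decode n)"])
    (auto simp: rec1_def encd_prod_def intro: recn_snd_decode recn_proj)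

lemma comput_if:
  assumes "comput c" "comput f" "comput g" shows "comput (\<lambda>x. if c x then f x else g x)"
proof -
  obtain c' f' g' where "rec1 c'" "rec1 f'" "rec1 g'" "\<And>x. c' (encd x) = encd (c x)"
      "\<And>x. f' (encd x) = encd (f x)" "\<And>x. g' (encd x) = encd (g x)"
    using assms unfolding comput_def by metis
  then show ?thesis
    by (intro computI[of "\<lambda>n. if c' n = 0 then g' n else f' n"])
      (auto simp: rec1_def encd_bool_def recn_if_zero)
qed

lemma comput_not: assumes "comput P" shows "comput (\<lambda>x. \<not> P x)"
proof -
  have "comput (\<lambda>x. if P x then False else True)" by (intro comput_if assms comput_const)
  moreover have "(\<lambda>x. if P x then False else True) = (\<lambda>x. \<not> P x)" by auto
  ultimately show ?thesis by simp
qed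

lemma comput_conj: assumes "comput P" "comput Q" shows "comput (\<lambda>x. P x \<and> Q x)"
proof -
  have "comput (\<lambda>x. if P x then Q x else False)" by (intro comput_if assms comput_const)
  moreover have "(\<lambda>x. if P x then Q x else False) = (\<lambda>x. P x \<and> Q x)" by auto
  ultimately show ?thesis by simp
qed

lemma comput_disj: assumes "comput P" "comput Q" shows "comput (\<lambda>x. P x \<or> Q x)"
proof -
  have "comput (\<lambda>x. if P x then True else Q x)" by (intro comput_if assms comput_const)
  moreover have "(\<lambda>x. if P x then True else Q x) = (\<lambda>x. P x \<or> Q x)" by auto
  ultimately show ?thesis by simp
qed

lemma comput_imp: assumes "comput P" "comput Q" shows "comput (\<lambda>x. P x \<longrightarrow> Q x)"
  unfolding imp_conv_disj by (intro comput_disj comput_not assms)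

lemma comput_eq:
  assumes "comput f" "comput g" shows "comput (\<lambda>x. f x = g x)"
proof -
  obtain f' g' where "rec1 f'" "rec1 g'" "\<And>x. f' (encd x) = encd (f x)" "\<And>x. g' (encd x) = encd (g x)"
    using assms unfolding comput_def by blast
  moreover from this have "rec1 (\<lambda>n. 1 - ((f' n - g' n) + (g' n - f' n)))"
    unfolding rec1_def by (intro recn_diff recn_add recn_const)
  moreover have "1 - ((a - b) + (b - a)) = of_bool (a = b)" for a b :: nat by auto
  ultimately show ?thesis
    by (intro computI[of "\<lambda>n. 1 - ((f' n - g' n) + (g' n - f' n))"])
      (simp_all add: encd_bool_def encd_eq_iff)
qed

lemma comput_less:
  fixes f g :: "'a::codable \<Rightarrow> nat"
  assumes "comput f" "comput g" shows "comput (\<lambda>x. f x < g x)"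
proof -
  obtain f' g' where "rec1 f'" "rec1 g'" "\<And>x. f' (encd x) = encd (f x)" "\<And>x. g' (encd x) = encd (g x)"
    using assms unfolding comput_def by blast
  then show ?thesis
    by (intro computI[of "\<lambda>n. 1 - (Suc (f' n) - g' n)"])
      (auto simp: rec1_def encd_bool_def encd_nat_def intro!: recn_diff recn_Suc recn_const)
qed

text \<open>The branch for \<open>Some y\<close> becomes a function of the pair formed by the
  environment \<open>x\<close> and \<open>y\<close>. The same device takes the rules below under
  bounded quantifiers.\<close>

lemma comput_case_option:
  assumes "comput f" "comput g" "comput (\<lambda>p. h (fst p) (snd p))"
  shows "comput (\<lambda>x. case f x of None \<Rightarrow> g x | Some y \<Rightarrow> h x y)"
proof -
  obtain f' where f': "rec1 f'" "\<And>x. f' (encd x) = encd (f x)"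
    using assms(1) unfolding comput_def by blast
  obtain g' where g': "rec1 g'" "\<And>x. g' (encd x) = encd (g x)"
    using assms(2) unfolding comput_def by blast
  obtain h' where h': "rec1 h'" "\<And>p. h' (encd p) = encd (h (fst p) (snd p))"
    using assms(3) unfolding comput_def by blast
  have "rec1 (\<lambda>n. if f' n = 0 then g' n else h' (prod_encode (n, f' n - 1)))"
    by (subst rec1_def, intro recn_if_zero recn_rec1[OF h'(1)] recn_rec1[OF f'(1)] recn_rec1[OF g'(1)]
        recn_prod_encode recn_pred recn_proj) auto
  moreover have "h' (prod_encode (encd x, encd y)) = encd (h x y)" for x y
    using h'(2)[of "(x, y)"] by (simp add: encd_prod_def)
  ultimately show ?thesis
    by (intro computI) (auto simp: f'(2) g'(2) encd_option_def split: option.split)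
qed

text \<open>A list code is 0 or the successor of a pair, so iterated tails visit the suffixes.
  Minimisation finds the first index at which the suffix is empty or begins with a hit.\<close>

lemma comput_find:
  assumes l: "comput l" and P: "comput (\<lambda>p. P (fst p) (snd p))"
  shows "comput (\<lambda>x. find (P x) (l x))"
proof -
  obtain l' where l': "rec1 l'" "\<And>x. l' (encd x) = encd (l x)"
    using l unfolding comput_def by blast
  obtain P' where P': "rec1 P'" "\<And>p. P' (encd p) = encd (P (fst p) (snd p))"
    using P unfolding comput_def by blast
  define tl' where "tl' n = (if n = 0 then 0 else snd (prod_decode (n - 1)))" for n
  define hd' where "hd' n = fst (prod_decode (n - 1))" for n
  define test where "test i n = (if (tl' ^^ i) (l' n) = 0 then 0
      else 1 - P' (prod_encode (n, hd' ((tl' ^^ i) (l' n)))))" for i n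
  have tl': "tl' (encd ys) = encd (tl ys)" for ys :: "'b list"
    by (cases ys) (simp_all add: tl'_def encd_list_def)
  have tl'_pow: "(tl' ^^ i) (encd ys) = encd (drop i ys)" for i and ys :: "'b list"
    by (induction i) (simp_all add: tl' drop_Suc tl_drop)
  have hd': "hd' (encd (y # ys)) = encd y" for y :: 'b and ys by (simp add: hd'_def encd_list_def)
  have P'': "P' (prod_encode (encd x, encd y)) = of_bool (P x y)" for x y
    using P'(2)[of "(x, y)"] by (simp add: encd_prod_def encd_bool_def)
  have tl1: "recn 1 (\<lambda>xs. tl' (xs ! 0))" unfolding tl'_def
    by (intro recn_if_zero recn_zero recn_snd_decode recn_pred recn_proj) auto
  have pow: "recn k (\<lambda>xs. (tl' ^^ f xs) (l' (g xs)))" if "recn k f" "recn k g" for k f g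
    by (intro recn_funpow tl1 recn_rec1[OF l'(1)] that)
  have rtest: "recn 2 (\<lambda>xs. test (xs ! 0) (xs ! 1))" unfolding test_def hd'_def
    by (intro recn_if_zero pow recn_zero recn_diff recn_const recn_rec1[OF P'(1)]
        recn_prod_encode recn_fst_decode recn_pred recn_proj) auto
  \<comment> \<open>Minimisation must stop on every number, also where the input codes nothing. It
    does, since the tail of a nonzero number is smaller than the number.\<close>
  have decr: "tl' n \<le> n - 1" for n
    using le_prod_encode_2[of "snd (prod_decode (n - 1))" "fst (prod_decode (n - 1))"]
    unfolding tl'_def by simp
  have zero: "(tl' ^^ i) n \<le> n - i" for i n
  proof (induction i)
    case (Suc i)
    then show ?case using decr[of "(tl' ^^ i) n"] by simp
  qed simp
  define ix where "ix n = (LEAST i. test i n = 0)" for n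
  have ex: "test (l' n) n = 0" for n using zero[of "l' n" "l' n"] by (simp add: test_def)
  have "recn 1 (\<lambda>xs. LEAST i. (\<lambda>xs. test (xs ! 0) (xs ! 1)) (i # xs) = 0)"
    using rtest by (intro recn_LEAST) (auto simp: numeral_2_eq_2 intro: ex)
  then have rix: "rec1 ix" unfolding rec1_def ix_def by simp
  define fnd where "fnd n = (if (tl' ^^ ix n) (l' n) = 0 then 0 else Suc (hd' ((tl' ^^ ix n) (l' n))))" for n
  have "rec1 fnd" unfolding rec1_def fnd_def hd'_def
    by (intro recn_if_zero pow recn_zero recn_Suc recn_fst_decode recn_pred recn_rec1[OF rix] recn_proj) auto
  moreover have "fnd (encd x) = encd (find (P x) (l x))" for x
  proof -
    have test: "test i (encd x) = 0 \<longleftrightarrow> (case drop i (l x) of [] \<Rightarrow> True | y # _ \<Rightarrow> P x y)" for i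
      unfolding test_def l'(2) tl'_pow
      by (cases "drop i (l x)") (auto simp: hd' P'', auto simp: encd_list_def)
    have dr: "drop i (l x) = l x ! i # drop (Suc i) (l x)" if "i < length (l x)" for i
      using that by (simp only: Cons_nth_drop_Suc)
    have testI: "test i (encd x) = 0 \<longleftrightarrow> P x (l x ! i)" if "i < length (l x)" for i
      by (simp only: test dr[OF that] list.case)
    have ixI: "ix (encd x) = i" if "test i (encd x) = 0" "\<And>j. j < i \<Longrightarrow> test j (encd x) \<noteq> 0" for i
      unfolding ix_def by (intro Least_equality that(1)) (metis that(2) not_less)
    show ?thesis
    proof (cases "find (P x) (l x)")
      case None
      then have n: "\<not> P x y" if "y \<in> set (l x)" for y using that by (auto simp: find_None_iff)
      have "ix (encd x) = length (l x)"
      proof (rule ixI)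
        fix j assume "j < length (l x)"
        then show "test j (encd x) \<noteq> 0" using n[of "l x ! j"] testI[of j] by simp
      qed (simp add: test)
      then have "(tl' ^^ ix (encd x)) (l' (encd x)) = 0"
        unfolding l'(2) tl'_pow by (simp add: encd_list_def)
      then show ?thesis using None by (simp add: fnd_def encd_option_def)
    next
      case (Some y)
      then obtain i where i: "i < length (l x)" "P x (l x ! i)" "y = l x ! i"
          "\<And>j. j < i \<Longrightarrow> \<not> P x (l x ! j)"
        by (auto simp: find_Some_iff)
      have "ix (encd x) = i"
      proof (rule ixI)
        show "test i (encd x) = 0" using i testI[of i] by simp
        fix j assume "j < i"
        then show "test j (encd x) \<noteq> 0" using i(1) i(4)[of j] testI[of j] by simp
      qed
      then have "(tl' ^^ ix (encd x)) (l' (encd x)) = encd (y # drop (Suc i) (l x))"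
        unfolding l'(2) tl'_pow i(3) using dr[OF i(1)] by simp
      moreover have "encd (z # zs) \<noteq> 0" for z :: 'b and zs by (simp add: encd_list_def)
      ultimately show ?thesis using Some unfolding fnd_def by (simp only: hd') (simp add: encd_option_def)
    qed
  qed
  ultimately show ?thesis by (rule computI)
qed

text \<open>Certificate checks are built from such quantifiers; each is a \<open>find\<close> of
  which only success or failure matters.\<close>

lemma comput_bex:
  assumes "comput l" "comput (\<lambda>p. P (fst p) (snd p))"
  shows "comput (\<lambda>x. \<exists>y\<in>set (l x). P x y)"
proof -
  have "comput (\<lambda>x. case find (P x) (l x) of None \<Rightarrow> False | Some y \<Rightarrow> True)"
    by (intro comput_case_option comput_find assms comput_const)
  moreover have "(case find (P x) (l x) of None \<Rightarrow> False | Some y \<Rightarrow> True) \<longleftrightarrow> (\<exists>y\<in>set (l x). P x y)" for x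
    by (auto simp: find_None_iff find_Some_iff split: option.split)
  ultimately show ?thesis by simp
qed

lemma comput_ball:
  assumes "comput l" "comput (\<lambda>p. P (fst p) (snd p))"
  shows "comput (\<lambda>x. \<forall>y\<in>set (l x). P x y)"
proof -
  have "comput (\<lambda>x. \<not> (\<exists>y\<in>set (l x). \<not> P x y))" by (intro comput_not comput_bex assms)
  then show ?thesis by simp
qed

lemma comput_mem: assumes "comput f" "comput l" shows "comput (\<lambda>x. f x \<in> set (l x))"
proof -
  have "comput (\<lambda>x. \<exists>y\<in>set (l x). f x = y)"
    by (intro comput_bex comput_eq comput_compose[OF assms(1)] assms(2) comput_fst comput_snd comput_id)
  then show ?thesis by simp
qed

lemma map_of_eq_find: "map_of l k = (case find (\<lambda>p. fst p = k) l of None \<Rightarrow> None | Some p \<Rightarrow> Some (snd p))"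
  by (induction l) auto

lemma comput_Some: "comput f \<Longrightarrow> comput (\<lambda>x. Some (f x))"
  by (rule comput_compose[of Some], rule computI[of Suc])
    (auto simp: rec1_def encd_option_def intro: recn_Suc recn_proj)

lemma comput_map_of: assumes "comput l" "comput k" shows "comput (\<lambda>x. map_of (l x) (k x))"
  unfolding map_of_eq_find
  by (intro comput_case_option comput_find comput_const comput_eq comput_Some
      comput_snd comput_fst comput_id assms(1) comput_compose[OF assms(2)])

lemmas comput_intros = comput_id comput_const comput_fst comput_snd comput_Pair comput_if comput_not
  comput_conj comput_disj comput_imp comput_eq comput_less comput_case_option comput_find comput_bex
  comput_ball comput_mem comput_map_of comput_Some

lemma reval_comput:
  assumes "comput f" obtains r where "\<And>x. reval r [encd x] (encd (f x))"
proof -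
  obtain g where "rec1 g" and g: "\<And>x. g (encd x) = encd (f x)" using assms unfolding comput_def by blast
  then obtain r where r: "\<forall>xs. length xs = 1 \<longrightarrow> reval r xs (g (xs ! 0))" unfolding rec1_def recn_def by blast
  have "reval r [encd x] (encd (f x))" for x using r[THEN spec, of "[encd x]"] by (simp add: g)
  then show ?thesis by (rule that)
qed

lemma recn_2_reval:
  assumes "recn 2 (\<lambda>xs. f (xs ! 0) (xs ! 1))" obtains r where "\<And>a b. reval r [a, b] (f a b)"
proof -
  obtain r where r: "\<forall>xs. length xs = 2 \<longrightarrow> reval r xs (f (xs ! 0) (xs ! 1))"
    using assms unfolding recn_def by blast
  have "reval r [a, b] (f a b)" for a b using r[THEN spec, of "[a, b]"] by simp
  then show ?thesis by (rule that)
qed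

text \<open>Minimisation over codes finds the witness with the least code, and \<open>f\<close> is
  applied to it. The conclusion says nothing about which witness this is, so later uses need
  \<open>f x y\<close> to be right for every witness \<open>y\<close>.\<close>

lemma reval_search:
  fixes R :: "'a::codable \<Rightarrow> 'b::bicodable \<Rightarrow> bool"
  assumes R: "comput (\<lambda>p. R (fst p) (snd p))" and f: "comput (\<lambda>p. f (fst p) (snd p))"
  obtains r where "\<And>x. \<exists>y. R x y \<Longrightarrow> \<exists>y. R x y \<and> reval r [encd x] (encd (f x y))"
proof -
  obtain g where rg: "rec1 g" and g: "\<And>p. g (encd p) = encd (R (fst p) (snd p))"
    using R unfolding comput_def by blast
  have "recn 2 (\<lambda>xs. 1 - g (prod_encode (xs ! 1, xs ! 0)))"
    by (intro recn_diff recn_const recn_rec1[OF rg] recn_prod_encode recn_proj) auto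
  then obtain s where s: "\<And>n x. reval s [n, x] (1 - g (prod_encode (x, n)))"
    by (rule recn_2_reval[where f="\<lambda>n x. 1 - g (prod_encode (x, n))"]) blast
  obtain t where t: "\<And>p. reval t [encd p] (encd (f (fst p) (snd p)))" using reval_comput[OF f] by blast
  have "recn 2 (\<lambda>xs. prod_encode (xs ! 0, xs ! 1))" by (intro recn_prod_encode recn_proj) auto
  then obtain pr where pr: "\<And>a b. reval pr [a, b] (prod_encode (a, b))"
    by (rule recn_2_reval[where f="\<lambda>a b. prod_encode (a, b)"]) blast
  define r where "r = Cn t [Cn pr [Proj 0, Mn s]]"
  have "\<exists>y. R x y \<and> reval r [encd x] (encd (f x y))" if "\<exists>y. R x y" for x
  proof -
    have g0: "1 - g (prod_encode (encd x, encd y)) = of_bool (\<not> R x y)" for y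
      using g[of "(x, y)"] by (simp add: encd_prod_def encd_bool_def)
    define n where "n = (LEAST n. \<exists>y. n = encd y \<and> R x y)"
    have "\<exists>y. n = encd y \<and> R x y" unfolding n_def by (rule LeastI_ex) (use that in blast)
    then obtain y where y: "n = encd y" "R x y" by blast
    have "reval (Mn s) [encd x] n"
    proof (rule reval_reval_list.mu)
      show "reval s [n, encd x] 0" using s[of n "encd x"] g0[of y] y by simp
      show "\<forall>m<n. \<exists>z>0. reval s [m, encd x] z"
      proof (intro allI impI)
        fix m assume "m < n"
        \<comment> \<open>Surjectivity of the coding enters here: \<open>m\<close> codes some
          \<open>z\<close>, which is no witness by minimality, so the checker has a positive value
          at \<open>m\<close>.\<close>
        obtain z :: 'b where z: "encd z = m" using surj_encd by blast
        with \<open>m < n\<close> have "\<not> R x z" unfolding n_def using not_less_Least by blast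
        with s[of m "encd x"] g0[of z] z show "\<exists>z>0. reval s [m, encd x] z" by auto
      qed
    qed
    moreover have "reval (Proj 0) [encd x] (encd x)"
      using reval_reval_list.proj[of 0 "[encd x]"] by simp
    ultimately have "reval r [encd x] (encd (f x y))"
      using t[of "(x, y)"] pr[of "encd x" n] unfolding r_def encd_prod_def y(1) fst_conv snd_conv
      by (meson reval_reval_list.comp reval_reval_list.lcons reval_reval_list.lnil)
    with y(2) show ?thesis by blast
  qed
  with that show ?thesis by blast
qed

section \<open>Rendezvous computations of cyclic protocols\<close>

text \<open>All channels but \<open>\<beta>\<close> are empty between these steps, so the composite
  state and the word on \<open>\<beta>\<close> describe the situation completely. Outputs on
  \<open>\<beta>\<close> are kept apart in \<open>emit\<close>, because \<open>drain\<close> must do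
  without them.\<close>

inductive sync :: "('n, 'e, 'm, 's) protocol \<Rightarrow> 'e
    \<Rightarrow> ('n \<Rightarrow> 's) \<times> 'm list \<Rightarrow> ('n \<Rightarrow> 's) \<times> 'm list \<Rightarrow> bool" for P \<beta> where
  deliver: "\<lbrakk> b \<in> pmsgs P \<beta>; (S (phead P \<beta>), Rcv b, q) \<in> ptrans P (phead P \<beta>) \<rbrakk>
    \<Longrightarrow> sync P \<beta> (S, b # x) (S(phead P \<beta> := q), x)"
| rendezvous: "\<lbrakk> \<xi> \<in> pedges P; \<xi> \<noteq> \<beta>; b \<in> pmsgs P \<xi>;
      (S (ptail P \<xi>), Snd b, p) \<in> ptrans P (ptail P \<xi>);
      (S (phead P \<xi>), Rcv b, q) \<in> ptrans P (phead P \<xi>) \<rbrakk>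
    \<Longrightarrow> sync P \<beta> (S, x) (S(ptail P \<xi> := p, phead P \<xi> := q), x)"

inductive emit :: "('n, 'e, 'm, 's) protocol \<Rightarrow> 'e
    \<Rightarrow> ('n \<Rightarrow> 's) \<times> 'm list \<Rightarrow> ('n \<Rightarrow> 's) \<times> 'm list \<Rightarrow> bool" for P \<beta> where
  "\<lbrakk> b \<in> pmsgs P \<beta>; (S (ptail P \<beta>), Snd b, q) \<in> ptrans P (ptail P \<beta>) \<rbrakk>
    \<Longrightarrow> emit P \<beta> (S, x) (S(ptail P \<beta> := q), x @ [b])"

text \<open>The candidate for the smallest extension. Along \<open>sync\<close> the word on
  \<open>\<beta>\<close> can only lose a prefix, which makes these sets unions of left quotients of
  the given ones.\<close>

definition drain :: "('n, 'e, 'm, 's) protocol \<Rightarrow> 'e \<Rightarrow> ('n \<Rightarrow> 's set)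
    \<Rightarrow> (('n \<Rightarrow> 's) \<Rightarrow> 'm list set) \<Rightarrow> ('n \<Rightarrow> 's) \<Rightarrow> 'm list set" where
  "drain P \<beta> V Q0 S =
     {x. \<exists>S0\<in>Pi\<^sub>E (pnodes P) V. \<exists>x0\<in>Q0 S0. (sync P \<beta>)\<^sup>*\<^sup>* (S0, x0) (S, x)}"

definition chan :: "'e \<Rightarrow> 'm list \<Rightarrow> 'e \<Rightarrow> 'm list" where
  "chan \<beta> x = (\<lambda>\<xi>. [])(\<beta> := x)"

section \<open>Local runs and the words they send and receive\<close>

fun lrun :: "('s \<times> 'm act \<times> 's) set \<Rightarrow> 's \<Rightarrow> 'm act list \<Rightarrow> 's \<Rightarrow> bool" where
  "lrun T p [] q \<longleftrightarrow> p = q"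
| "lrun T p (a # w) q \<longleftrightarrow> (\<exists>r. (p, a, r) \<in> T \<and> lrun T r w q)"

fun sends :: "'m act list \<Rightarrow> 'm list" where
  "sends [] = []"
| "sends (Snd b # w) = b # sends w"
| "sends (Rcv b # w) = sends w"

fun recvs :: "'m act list \<Rightarrow> 'm list" where
  "recvs [] = []"
| "recvs (Snd b # w) = recvs w"
| "recvs (Rcv b # w) = b # recvs w"

lemma lrun_append: "lrun T p (u @ v) q \<longleftrightarrow> (\<exists>r. lrun T p u r \<and> lrun T r v q)"
  by (induction u arbitrary: p) auto

lemma sends_append[simp]: "sends (u @ v) = sends u @ sends v"
  by (induction u rule: sends.induct) auto

lemma recvs_append[simp]: "recvs (u @ v) = recvs u @ recvs v"
  by (induction u rule: recvs.induct) auto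

lemma lrun_closed:
  assumes "lrun T p w q" "p \<in> K" "T \<subseteq> K \<times> A \<times> K" shows "q \<in> K"
  using assms by (induction w arbitrary: p) auto

lemma sync_suffix: "sync P \<beta> s s' \<Longrightarrow> suffix (snd s') (snd s)"
  by (induction rule: sync.induct) (auto simp: suffix_def)

lemma syncs_suffix: "(sync P \<beta>)\<^sup>*\<^sup>* s s' \<Longrightarrow> suffix (snd s') (snd s)"
  by (induction rule: rtranclp_induct) (auto dest: sync_suffix intro: suffix_order.trans)

lemma chan_simps[simp]: "chan \<beta> x \<beta> = x" "\<xi> \<noteq> \<beta> \<Longrightarrow> chan \<beta> x \<xi> = []"
  by (auto simp: chan_def)

lemma eq_chan: "(\<And>\<xi>. \<xi> \<noteq> \<beta> \<Longrightarrow> C \<xi> = []) \<Longrightarrow> C = chan \<beta> (C \<beta>)"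
  by (auto simp: chan_def)

section \<open>The chain obtained by cutting the cycle at \<beta>\<close>

locale cyclic_protocol =
  fixes P :: "('n, 'e, 'm, 's) protocol" and \<beta> :: 'e and V :: "'n \<Rightarrow> 's set"
  assumes wf: "wf_protocol P" and cyc: "cyclic P" and \<beta>: "\<beta> \<in> pedges P" and V: "good_V P V"
begin

lemma edge_nodes: "\<xi> \<in> pedges P \<Longrightarrow> ptail P \<xi> \<in> pnodes P" "\<xi> \<in> pedges P \<Longrightarrow> phead P \<xi> \<in> pnodes P"
  using wf unfolding wf_protocol_def by auto

lemma tail_inj: "\<xi> \<in> pedges P \<Longrightarrow> \<eta> \<in> pedges P \<Longrightarrow> ptail P \<xi> = ptail P \<eta> \<longleftrightarrow> \<xi> = \<eta>"
  using cyc unfolding cyclic_def bij_betw_def inj_on_def by auto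

lemma head_inj: "\<xi> \<in> pedges P \<Longrightarrow> \<eta> \<in> pedges P \<Longrightarrow> phead P \<xi> = phead P \<eta> \<longleftrightarrow> \<xi> = \<eta>"
  using cyc unfolding cyclic_def bij_betw_def inj_on_def by auto

lemma out_edge: assumes "j \<in> pnodes P" obtains \<xi> where "\<xi> \<in> pedges P" "ptail P \<xi> = j"
proof -
  have "j \<in> ptail P ` pedges P" using cyc assms unfolding cyclic_def bij_betw_def by simp
  then show ?thesis using that by blast
qed

lemma in_edge: assumes "j \<in> pnodes P" obtains \<xi> where "\<xi> \<in> pedges P" "phead P \<xi> = j"
proof -
  have "j \<in> phead P ` pedges P" using cyc assms unfolding cyclic_def bij_betw_def by simp
  then show ?thesis using that by blast
qed

lemma trans_wf: "j \<in> pnodes P \<Longrightarrow> ptrans P j \<subseteq> pstates P j \<times> alphabet P j \<times> pstates P j"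
  using wf unfolding wf_protocol_def by auto

text \<open>A node has just one outgoing edge, so a send letter of its alphabet can only come from
  the messages of that edge.\<close>

lemma send_msg:
  assumes "\<xi> \<in> pedges P" "(p, Snd b, q) \<in> ptrans P (ptail P \<xi>)" shows "b \<in> pmsgs P \<xi>"
proof -
  have "Snd b \<in> alphabet P (ptail P \<xi>)" using assms trans_wf[OF edge_nodes(1)] by blast
  then show ?thesis using tail_inj assms(1) unfolding alphabet_def by auto
qed

lemma recv_msg:
  assumes "\<xi> \<in> pedges P" "(p, Rcv b, q) \<in> ptrans P (phead P \<xi>)" shows "b \<in> pmsgs P \<xi>"
proof -
  have "Rcv b \<in> alphabet P (phead P \<xi>)" using assms trans_wf[OF edge_nodes(2)] by blast
  then show ?thesis using head_inj assms(1) unfolding alphabet_def by auto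
qed

lemma send_V: "j \<in> pnodes P \<Longrightarrow> (p, Snd b, q) \<in> ptrans P j \<Longrightarrow> q \<in> V j"
  using V unfolding good_V_def by blast

lemma PiE_V_comp: "Pi\<^sub>E (pnodes P) V \<subseteq> comp_states P"
  unfolding comp_states_def by (rule PiE_mono) (use V in \<open>auto simp: good_V_def\<close>)

lemma comp_upd:
  assumes "S \<in> comp_states P" "j \<in> pnodes P" "(p, a, q) \<in> ptrans P j" shows "S(j := q) \<in> comp_states P"
  using assms trans_wf[of j] unfolding comp_states_def by (auto simp: PiE_def Pi_def extensional_def)

text \<open>Distance from the head of \<open>\<beta>\<close> along the cycle.\<close>
lemma rank_exists:
  obtains d :: "'n \<Rightarrow> nat"
  where "\<And>\<xi>. \<xi> \<in> pedges P \<Longrightarrow> \<xi> \<noteq> \<beta> \<Longrightarrow> d (phead P \<xi>) = Suc (d (ptail P \<xi>))"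
proof -
  define E where "E = {(ptail P \<xi>, phead P \<xi>) | \<xi>. \<xi> \<in> pedges P}"
  define d where "d j = (LEAST n. (phead P \<beta>, j) \<in> E ^^ n)" for j
  have reach: "\<exists>n. (phead P \<beta>, j) \<in> E ^^ n" if "j \<in> pnodes P" for j
    using cyc that edge_nodes(2)[OF \<beta>] unfolding cyclic_def E_def[symmetric]
    by (auto simp: rtrancl_power)
  have d: "(phead P \<beta>, j) \<in> E ^^ d j" if "j \<in> pnodes P" for j
    unfolding d_def using reach[OF that] by (rule LeastI_ex)
  have d_le: "d j \<le> n" if "(phead P \<beta>, j) \<in> E ^^ n" for j n
    unfolding d_def using that by (rule Least_le)
  have "d (phead P \<xi>) = Suc (d (ptail P \<xi>))" if \<xi>: "\<xi> \<in> pedges P" "\<xi> \<noteq> \<beta>" for \<xi>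
  proof (rule antisym)
    show "d (phead P \<xi>) \<le> Suc (d (ptail P \<xi>))"
      using d[OF edge_nodes(1)[OF \<xi>(1)]] \<xi>(1) by (intro d_le) (auto simp: E_def)
    \<comment> \<open>A shortest path to the head of \<open>\<xi>\<close> is nonempty, and its last
      edge is \<open>\<xi>\<close> because heads are distinct; without this edge it leads to the
      tail.\<close>
    have "phead P \<beta> \<noteq> phead P \<xi>" using \<xi> \<beta> head_inj by simp
    with d[OF edge_nodes(2)[OF \<xi>(1)]] obtain m where m: "d (phead P \<xi>) = Suc m"
      by (cases "d (phead P \<xi>)") auto
    with d[OF edge_nodes(2)[OF \<xi>(1)]] obtain k where k: "(phead P \<beta>, k) \<in> E ^^ m" "(k, phead P \<xi>) \<in> E"
      by auto
    from k(2) have "k = ptail P \<xi>" unfolding E_def using head_inj \<xi>(1) by auto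
    with k(1) m show "Suc (d (ptail P \<xi>)) \<le> d (phead P \<xi>)" using d_le by simp
  qed
  then show ?thesis by (rule that)
qed

text \<open>The rank grows along every edge other than \<open>\<beta>\<close>. For
  \<open>\<beta>\<close> itself tail and head coincide when the cycle has a single node.\<close>

lemma tail_neq_head: "\<xi> \<in> pedges P \<Longrightarrow> \<xi> \<noteq> \<beta> \<Longrightarrow> ptail P \<xi> \<noteq> phead P \<xi>"
  using rank_exists by (metis n_not_Suc_n)

text \<open>A rendezvous is a send followed at once by the reception. Since tail and head differ,
  the send leaves the state of the receiver untouched.\<close>

lemma sync_steps:
  assumes "sync P \<beta> (S, x) (S', x')" shows "(step P)\<^sup>*\<^sup>* (S, chan \<beta> x) (S', chan \<beta> x')"
  using assms
proof cases
  case (deliver b q)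
  have "step P (S, chan \<beta> x) (S', (chan \<beta> x)(\<beta> := x'))"
    unfolding deliver using deliver by (intro step.recv[where b=b] \<beta>) auto
  moreover have "(chan \<beta> x)(\<beta> := x') = chan \<beta> x'" by (simp add: chan_def)
  ultimately show ?thesis by simp
next
  case (rendezvous \<xi> b p q)
  have "step P (S, chan \<beta> x) (S(ptail P \<xi> := p), (chan \<beta> x)(\<xi> := chan \<beta> x \<xi> @ [b]))"
    using rendezvous by (intro step.send) auto
  moreover have "step P (S(ptail P \<xi> := p), (chan \<beta> x)(\<xi> := chan \<beta> x \<xi> @ [b]))
      (S', ((chan \<beta> x)(\<xi> := chan \<beta> x \<xi> @ [b]))(\<xi> := []))"
    unfolding rendezvous(1) using rendezvous tail_neq_head[of \<xi>] by (intro step.recv[where b=b]) auto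
  moreover have "((chan \<beta> x)(\<xi> := chan \<beta> x \<xi> @ [b]))(\<xi> := []) = chan \<beta> x'"
    using rendezvous by (auto simp: chan_def)
  ultimately show ?thesis by simp
qed

lemma emit_step:
  assumes "emit P \<beta> (S, x) (S', x')" shows "step P (S, chan \<beta> x) (S', chan \<beta> x')"
  using assms
proof cases
  case (1 b q)
  have "step P (S, chan \<beta> x) (S', (chan \<beta> x)(\<beta> := chan \<beta> x \<beta> @ [b]))"
    unfolding 1 using 1 by (intro step.send \<beta>) auto
  moreover have "(chan \<beta> x)(\<beta> := chan \<beta> x \<beta> @ [b]) = chan \<beta> x'" using 1 by (simp add: chan_def)
  ultimately show ?thesis by simp
qed

lemma sync_emit_steps:
  assumes "(\<lambda>s s'. sync P \<beta> s s' \<or> emit P \<beta> s s')\<^sup>*\<^sup>* (S, x) (S', x')"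
  shows "(step P)\<^sup>*\<^sup>* (S, chan \<beta> x) (S', chan \<beta> x')"
  using assms
proof (induction "(S', x')" arbitrary: S' x' rule: rtranclp_induct)
  case base
  then show ?case by simp
next
  case (step y)
  obtain T z where "y = (T, z)" by fastforce
  with step show ?case
    using sync_steps[of T z S' x'] emit_step[of T z S' x'] by (auto intro: rtranclp_trans rtranclp.rtrancl_into_rtrancl)
qed

lemma syncs_steps:
  assumes "(sync P \<beta>)\<^sup>*\<^sup>* (S, x) (S', x')"
  shows "(step P)\<^sup>*\<^sup>* (S, chan \<beta> x) (S', chan \<beta> x')"
  by (rule sync_emit_steps, rule mono_rtranclp[rule_format, OF _ assms]) simp

lemma step_comp_states: "step P s s' \<Longrightarrow> fst s \<in> comp_states P \<Longrightarrow> fst s' \<in> comp_states P"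
  by (induction rule: step.induct) (auto intro: comp_upd edge_nodes)

lemma steps_comp_states: "(step P)\<^sup>*\<^sup>* s s' \<Longrightarrow> fst s \<in> comp_states P \<Longrightarrow> fst s' \<in> comp_states P"
  by (induction rule: rtranclp_induct) (auto dest: step_comp_states)

section \<open>Lazy execution of protocol computations\<close>

text \<open>From \<open>(S, x)\<close> on, the local runs \<open>\<sigma>\<close> lead to \<open>(S', C)\<close>; they are executed lazily, and
  never contain an output on \<open>\<beta>\<close>.\<close>
definition pending :: "('n \<Rightarrow> 'm act list) \<Rightarrow> ('n \<Rightarrow> 's) \<Rightarrow> ('n \<Rightarrow> 's) \<Rightarrow> ('e \<Rightarrow> 'm list) \<Rightarrow> 'm list \<Rightarrow> bool" where
  "pending \<sigma> S S' C x \<longleftrightarrow>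
     (\<forall>j\<in>pnodes P. lrun (ptrans P j) (S j) (\<sigma> j) (S' j))
   \<and> (\<forall>\<xi>\<in>pedges P. \<xi> \<noteq> \<beta> \<longrightarrow> sends (\<sigma> (ptail P \<xi>)) = recvs (\<sigma> (phead P \<xi>)) @ C \<xi>)
   \<and> x = recvs (\<sigma> (phead P \<beta>)) @ C \<beta> \<and> sends (\<sigma> (ptail P \<beta>)) = []"

text \<open>Among the machines whose next action is a receive, the one nearest to the head of
  \<open>\<beta>\<close> is served. Its predecessor on the chain is nearer still, so it is not
  waiting itself, and by the balance of the channel its next action is to send the demanded
  message.\<close>

lemma flush:
  assumes "pending \<sigma> S S' C x" "\<And>\<xi>. \<xi> \<in> pedges P \<Longrightarrow> \<xi> \<noteq> \<beta> \<Longrightarrow> C \<xi> = []"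
    "S \<in> comp_states P" "S' \<in> comp_states P"
  shows "(sync P \<beta>)\<^sup>*\<^sup>* (S, x) (S', C \<beta>)"
  using assms
proof (induction "\<Sum>j\<in>pnodes P. length (\<sigma> j)" arbitrary: \<sigma> S x rule: less_induct)
  case less
  have run: "\<And>j. j \<in> pnodes P \<Longrightarrow> lrun (ptrans P j) (S j) (\<sigma> j) (S' j)"
    and bal: "\<And>\<xi>. \<xi> \<in> pedges P \<Longrightarrow> \<xi> \<noteq> \<beta> \<Longrightarrow> sends (\<sigma> (ptail P \<xi>)) = recvs (\<sigma> (phead P \<xi>))"
    and x: "x = recvs (\<sigma> (phead P \<beta>)) @ C \<beta>" and out: "sends (\<sigma> (ptail P \<beta>)) = []"
    using less.prems(1,2) unfolding pending_def by auto
  have fin: "finite (pnodes P)" using wf unfolding wf_protocol_def by auto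
  show ?case
  proof (cases "\<forall>j\<in>pnodes P. \<sigma> j = []")
    case True
    then have "S = S'" using run less.prems(3,4) unfolding comp_states_def by (intro PiE_ext) auto
    moreover have "x = C \<beta>" using x True edge_nodes(2)[OF \<beta>] by simp
    ultimately show ?thesis by simp
  next
    case False
    obtain d :: "'n \<Rightarrow> nat" where d: "\<And>\<xi>. \<xi> \<in> pedges P \<Longrightarrow> \<xi> \<noteq> \<beta> \<Longrightarrow> d (phead P \<xi>) = Suc (d (ptail P \<xi>))"
      using rank_exists by blast
    define A where "A = {j \<in> pnodes P. \<sigma> j \<noteq> []}"
    have A: "finite A" "A \<noteq> {}" using fin False by (auto simp: A_def)
    then have "Max (d ` A) \<in> d ` A" by simp
    then obtain m where "m \<in> A" "d m = Max (d ` A)" by auto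
    then have m: "m \<in> A" "\<And>j. j \<in> A \<Longrightarrow> d j \<le> d m" using A(1) by auto
    \<comment> \<open>The farthest machine with work left sends nothing: its successor is idle and
      the channel balances, or it is the tail of \<open>\<beta>\<close>. Its first action is then a
      receive, so some machine is waiting and a nearest one exists.\<close>
    have "sends (\<sigma> m) = []"
    proof (cases "m = ptail P \<beta>")
      case True
      then show ?thesis using out by simp
    next
      case False
      obtain \<xi> where \<xi>: "\<xi> \<in> pedges P" "ptail P \<xi> = m" using out_edge m(1) by (auto simp: A_def)
      with False d[of \<xi>] m(2)[of "phead P \<xi>"] edge_nodes(2)[OF \<xi>(1)] have "\<sigma> (phead P \<xi>) = []"
        unfolding A_def by force
      with bal[of \<xi>] \<xi> False show ?thesis by auto
    qed
    with m(1) have "\<exists>b w. \<sigma> m = Rcv b # w"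
      unfolding A_def by (cases "\<sigma> m" rule: sends.cases) auto
    then have "\<exists>m. m \<in> pnodes P \<and> (\<exists>b w. \<sigma> m = Rcv b # w)" using m(1) unfolding A_def by blast
    then obtain k where k: "k \<in> pnodes P" "\<exists>b w. \<sigma> k = Rcv b # w"
      and kmin: "\<And>j. j \<in> pnodes P \<Longrightarrow> \<exists>b w. \<sigma> j = Rcv b # w \<Longrightarrow> d k \<le> d j"
      using ex_has_least_nat[of "\<lambda>m. m \<in> pnodes P \<and> (\<exists>b w. \<sigma> m = Rcv b # w)" _ d] by blast
    obtain b w where w: "\<sigma> k = Rcv b # w" using k(2) by blast
    obtain r where r: "(S k, Rcv b, r) \<in> ptrans P k" "lrun (ptrans P k) r w (S' k)"
      using run[OF k(1)] w by auto
    obtain \<xi> where \<xi>: "\<xi> \<in> pedges P" "phead P \<xi> = k" using in_edge k(1) by blast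
    have b: "b \<in> pmsgs P \<xi>" using recv_msg[OF \<xi>(1)] r(1) \<xi>(2) by auto
    show ?thesis
    proof (cases "\<xi> = \<beta>")
      case True
      define \<sigma>1 where "\<sigma>1 = \<sigma>(k := w)"
      have "sync P \<beta> (S, b # recvs w @ C \<beta>) (S(phead P \<beta> := r), recvs w @ C \<beta>)"
        using True b r \<xi>(2) by (intro sync.deliver) auto
      then have st: "sync P \<beta> (S, x) (S(k := r), recvs w @ C \<beta>)" using x w True \<xi>(2) by simp
      have sends: "sends (\<sigma>1 j) = sends (\<sigma> j)" for j by (simp add: \<sigma>1_def w)
      have recvs: "j \<noteq> k \<Longrightarrow> recvs (\<sigma>1 j) = recvs (\<sigma> j)" for j by (simp add: \<sigma>1_def)
      have "pending \<sigma>1 (S(k := r)) S' C (recvs w @ C \<beta>)"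
        unfolding pending_def
      proof (intro conjI ballI impI)
        fix \<eta> assume \<eta>: "\<eta> \<in> pedges P" "\<eta> \<noteq> \<beta>"
        then have "phead P \<eta> \<noteq> k" using head_inj \<beta> True \<xi> by metis
        then show "sends (\<sigma>1 (ptail P \<eta>)) = recvs (\<sigma>1 (phead P \<eta>)) @ C \<eta>"
          using bal less.prems(2) \<eta> by (simp add: sends recvs)
      qed (use run r out \<xi> True in \<open>auto simp: sends, auto simp: \<sigma>1_def\<close>)
      moreover have "(\<Sum>j\<in>pnodes P. length (\<sigma>1 j)) < (\<Sum>j\<in>pnodes P. length (\<sigma> j))"
        using k(1) w by (intro sum_strict_mono_ex1 fin) (auto simp: \<sigma>1_def)
      moreover have "S(k := r) \<in> comp_states P" using comp_upd[OF less.prems(3) k(1) r(1)] .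
      ultimately have "(sync P \<beta>)\<^sup>*\<^sup>* (S(k := r), recvs w @ C \<beta>) (S', C \<beta>)"
        using less.hyps less.prems(2,4) by blast
      with st show ?thesis by (rule converse_rtranclp_into_rtranclp)
    next
      case False
      define k' where "k' = ptail P \<xi>"
      have k': "k' \<in> pnodes P" "k' \<noteq> k" using edge_nodes \<xi> tail_neq_head[OF _ False] by (auto simp: k'_def)
      have s: "sends (\<sigma> k') = b # recvs w" using bal[OF \<xi>(1) False] w \<xi>(2) by (simp add: k'_def)
      have "d k' < d k" using d[OF \<xi>(1) False] \<xi>(2) by (simp add: k'_def)
      then have "\<not> (\<exists>b w. \<sigma> k' = Rcv b # w)" using kmin k'(1) by (meson not_less)
      with s obtain w' where w': "\<sigma> k' = Snd b # w'" by (cases "\<sigma> k'" rule: sends.cases) auto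
      obtain r' where r': "(S k', Snd b, r') \<in> ptrans P k'" "lrun (ptrans P k') r' w' (S' k')"
        using run[OF k'(1)] w' by auto
      define \<sigma>1 where "\<sigma>1 = \<sigma>(k' := w', k := w)"
      define S1 where "S1 = S(k' := r', k := r)"
      have st: "sync P \<beta> (S, x) (S1, x)" unfolding S1_def \<xi>(2)[symmetric] k'_def
        using \<xi> False b r r' by (intro sync.rendezvous) (auto simp: k'_def)
      have sends: "j \<noteq> k' \<Longrightarrow> sends (\<sigma>1 j) = sends (\<sigma> j)" for j by (simp add: \<sigma>1_def w)
      have recvs: "j \<noteq> k \<Longrightarrow> recvs (\<sigma>1 j) = recvs (\<sigma> j)" for j by (simp add: \<sigma>1_def w')
      have "pending \<sigma>1 S1 S' C x"
        unfolding pending_def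
      proof (intro conjI ballI impI)
        fix j assume "j \<in> pnodes P"
        then show "lrun (ptrans P j) (S1 j) (\<sigma>1 j) (S' j)" using run r r' k'(2) by (simp add: S1_def \<sigma>1_def)
      next
        fix \<eta> assume \<eta>: "\<eta> \<in> pedges P" "\<eta> \<noteq> \<beta>"
        show "sends (\<sigma>1 (ptail P \<eta>)) = recvs (\<sigma>1 (phead P \<eta>)) @ C \<eta>"
        proof (cases "\<eta> = \<xi>")
          case True
          then show ?thesis using s w' k'(2) less.prems(2)[OF \<eta>]
            by (simp add: \<sigma>1_def \<xi>(2) k'_def[symmetric])
        next
          case False
          then have "ptail P \<eta> \<noteq> k'" "phead P \<eta> \<noteq> k"
            using tail_inj[OF \<eta>(1) \<xi>(1)] head_inj[OF \<eta>(1) \<xi>(1)] \<xi>(2) by (auto simp: k'_def)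
          then show ?thesis using bal[OF \<eta>] less.prems(2)[OF \<eta>] by (simp add: sends recvs)
        qed
      next
        have "phead P \<beta> \<noteq> k" using head_inj[OF \<beta> \<xi>(1)] False \<xi>(2) by auto
        then show "x = recvs (\<sigma>1 (phead P \<beta>)) @ C \<beta>" using x recvs by simp
        have "ptail P \<beta> \<noteq> k'" using tail_inj[OF \<beta> \<xi>(1)] False by (auto simp: k'_def)
        then show "sends (\<sigma>1 (ptail P \<beta>)) = []" using out sends by simp
      qed
      moreover have "(\<Sum>j\<in>pnodes P. length (\<sigma>1 j)) < (\<Sum>j\<in>pnodes P. length (\<sigma> j))"
        using k(1) w w' by (intro sum_strict_mono_ex1 fin) (auto simp: \<sigma>1_def)
      moreover have "S1 \<in> comp_states P"
        unfolding S1_def by (rule comp_upd[OF comp_upd[OF less.prems(3) k'(1) r'(1)] k(1) r(1)])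
      ultimately have "(sync P \<beta>)\<^sup>*\<^sup>* (S1, x) (S', C \<beta>)"
        using less.hyps less.prems(2,4) by blast
      with st show ?thesis by (rule converse_rtranclp_into_rtranclp)
    qed
  qed
qed

text \<open>Among all prefixes of the pending runs that still supply what the tail of \<open>\<beta>\<close> receives, one of
  minimal total length has no superfluous last action, so every nonempty one ends with a send.\<close>
lemma flush_demanded:
  assumes pend: "pending \<sigma> S S' C x" and S: "S \<in> Pi\<^sub>E (pnodes P) V" and S': "S' \<in> comp_states P"
  shows "\<exists>S1 \<rho> x1. (sync P \<beta>)\<^sup>*\<^sup>* (S, x) (S1, x1) \<and> S1 \<in> comp_states P
    \<and> (\<forall>j\<in>pnodes P - {ptail P \<beta>}. S1 j \<in> V j) \<and> \<rho> (ptail P \<beta>) = [] \<and> pending \<rho> S1 S' C x1"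
proof -
  have run: "\<And>j. j \<in> pnodes P \<Longrightarrow> lrun (ptrans P j) (S j) (\<sigma> j) (S' j)"
    and bal: "\<And>\<xi>. \<xi> \<in> pedges P \<Longrightarrow> \<xi> \<noteq> \<beta> \<Longrightarrow> sends (\<sigma> (ptail P \<xi>)) = recvs (\<sigma> (phead P \<xi>)) @ C \<xi>"
    and x: "x = recvs (\<sigma> (phead P \<beta>)) @ C \<beta>" and out: "sends (\<sigma> (ptail P \<beta>)) = []"
    using pend unfolding pending_def by auto
  have fin: "finite (pnodes P)" using wf unfolding wf_protocol_def by auto
  define G where "G \<tau> \<longleftrightarrow> (\<forall>j\<in>pnodes P. prefix (\<tau> j) (\<sigma> j)) \<and> \<tau> (ptail P \<beta>) = \<sigma> (ptail P \<beta>)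
    \<and> (\<forall>\<xi>\<in>pedges P. \<xi> \<noteq> \<beta> \<longrightarrow> prefix (recvs (\<tau> (phead P \<xi>))) (sends (\<tau> (ptail P \<xi>))))" for \<tau>
  have "G \<sigma>" unfolding G_def using bal by auto
  then obtain \<tau> where \<tau>: "G \<tau>"
    and least: "\<And>\<tau>'. G \<tau>' \<Longrightarrow> (\<Sum>j\<in>pnodes P. length (\<tau> j)) \<le> (\<Sum>j\<in>pnodes P. length (\<tau>' j))"
    using ex_has_least_nat[of G \<sigma> "\<lambda>\<tau>. \<Sum>j\<in>pnodes P. length (\<tau> j)"] by blast
  have pre: "\<And>j. j \<in> pnodes P \<Longrightarrow> prefix (\<tau> j) (\<sigma> j)" and tau_tail: "\<tau> (ptail P \<beta>) = \<sigma> (ptail P \<beta>)"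
    and tau_edge: "\<And>\<xi>. \<xi> \<in> pedges P \<Longrightarrow> \<xi> \<noteq> \<beta> \<Longrightarrow> prefix (recvs (\<tau> (phead P \<xi>))) (sends (\<tau> (ptail P \<xi>)))"
    using \<tau> unfolding G_def by auto
  \<comment> \<open>Dropping a final receive lowers demand, and dropping a final send is harmless
    unless its message is consumed. Either would contradict minimality, so the last action is a send
    whose message the successor receives.\<close>
  have last_needed: "\<exists>b. a = Snd b \<and> recvs (\<tau> (phead P \<xi>)) = sends (\<tau> (ptail P \<xi>))"
    if \<xi>: "\<xi> \<in> pedges P" "\<xi> \<noteq> \<beta>" and w: "\<tau> (ptail P \<xi>) = w @ [a]" for \<xi> w a
  proof (rule ccontr)
    assume neg: "\<not> ?thesis"
    define j where "j = ptail P \<xi>"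
    define \<tau>' where "\<tau>' = \<tau>(j := w)"
    have j: "j \<in> pnodes P" "j \<noteq> ptail P \<beta>" "phead P \<xi> \<noteq> j"
      using edge_nodes \<xi> tail_inj[OF \<xi>(1) \<beta>] tail_neq_head[OF \<xi>] by (auto simp: j_def)
    have sw: "prefix (recvs (\<tau> (phead P \<xi>))) (sends w)"
      using tau_edge[OF \<xi>] neg unfolding w by (cases a) (auto simp: prefix_snoc)
    have rw: "prefix (recvs w) (recvs (\<tau> j))" using w by (simp add: j_def)
    have "G \<tau>'"
      unfolding G_def
    proof (intro conjI ballI impI)
      fix i assume "i \<in> pnodes P"
      then show "prefix (\<tau>' i) (\<sigma> i)"
        using pre[of i] w by (auto simp: \<tau>'_def j_def intro: append_prefixD)
    next
      show "\<tau>' (ptail P \<beta>) = \<sigma> (ptail P \<beta>)" using j(2) tau_tail by (simp add: \<tau>'_def)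
    next
      fix \<eta> assume \<eta>: "\<eta> \<in> pedges P" "\<eta> \<noteq> \<beta>"
      show "prefix (recvs (\<tau>' (phead P \<eta>))) (sends (\<tau>' (ptail P \<eta>)))"
      proof (cases "\<eta> = \<xi>")
        case True
        then show ?thesis using sw j(3) by (simp add: \<tau>'_def j_def)
      next
        case False
        then have "ptail P \<eta> \<noteq> j" using tail_inj[OF \<eta>(1) \<xi>(1)] by (simp add: j_def)
        moreover have "prefix (recvs (\<tau>' (phead P \<eta>))) (recvs (\<tau> (phead P \<eta>)))"
          using rw by (simp add: \<tau>'_def)
        ultimately show ?thesis using tau_edge[OF \<eta>] by (auto simp: \<tau>'_def dest: prefix_order.trans)
      qed
    qed
    moreover have "(\<Sum>i\<in>pnodes P. length (\<tau>' i)) < (\<Sum>i\<in>pnodes P. length (\<tau> i))"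
      using j(1) w by (intro sum_strict_mono_ex1 fin) (auto simp: \<tau>'_def j_def)
    ultimately show False using least by (simp add: not_less[symmetric])
  qed
  have tau_bal: "sends (\<tau> (ptail P \<xi>)) = recvs (\<tau> (phead P \<xi>))" if "\<xi> \<in> pedges P" "\<xi> \<noteq> \<beta>" for \<xi>
  proof (cases "\<tau> (ptail P \<xi>)" rule: rev_cases)
    case Nil
    then show ?thesis using tau_edge[OF that] by simp
  next
    case (snoc w a)
    then show ?thesis using last_needed[OF that snoc] by auto
  qed
  define \<rho> where "\<rho> j = drop (length (\<tau> j)) (\<sigma> j)" for j
  have split: "\<sigma> j = \<tau> j @ \<rho> j" if "j \<in> pnodes P" for j
    using pre[OF that] by (auto simp: \<rho>_def prefix_def)
  have "\<exists>r. lrun (ptrans P j) (S j) (\<tau> j) r \<and> lrun (ptrans P j) r (\<rho> j) (S' j)" if "j \<in> pnodes P" for j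
    using run[OF that] unfolding split[OF that] lrun_append .
  then obtain R where R: "\<And>j. j \<in> pnodes P \<Longrightarrow> lrun (ptrans P j) (S j) (\<tau> j) (R j)"
    "\<And>j. j \<in> pnodes P \<Longrightarrow> lrun (ptrans P j) (R j) (\<rho> j) (S' j)"
    by metis
  define S1 where "S1 = restrict R (pnodes P)"
  have Sc: "S \<in> comp_states P" using S PiE_V_comp by blast
  have S1c: "S1 \<in> comp_states P"
    unfolding S1_def comp_states_def
  proof (rule restrict_PiE_iff[THEN iffD2], intro ballI)
    fix j assume j: "j \<in> pnodes P"
    then show "R j \<in> pstates P j"
      using lrun_closed[OF R(1)[OF j] _ trans_wf[OF j]] Sc by (auto simp: comp_states_def)
  qed
  define x1 where "x1 = recvs (\<rho> (phead P \<beta>)) @ C \<beta>"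
  have "pending \<tau> S S1 (chan \<beta> x1) x"
    unfolding pending_def
    using R(1) tau_bal x split[OF edge_nodes(2)[OF \<beta>]] out tau_tail by (auto simp: S1_def x1_def)
  from flush[OF this _ Sc S1c] have "(sync P \<beta>)\<^sup>*\<^sup>* (S, x) (S1, x1)" by simp
  moreover have "S1 j \<in> V j" if j: "j \<in> pnodes P" "j \<noteq> ptail P \<beta>" for j
  proof -
    obtain \<xi> where \<xi>: "\<xi> \<in> pedges P" "ptail P \<xi> = j" using out_edge j(1) by blast
    then have "\<xi> \<noteq> \<beta>" using j(2) by auto
    show ?thesis
    proof (cases "\<tau> j" rule: rev_cases)
      case Nil
      then show ?thesis using R(1)[OF j(1)] PiE_mem[OF S j(1)] j(1) by (simp add: S1_def)
    next
      case (snoc w a)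
      then obtain b where "a = Snd b" using last_needed[OF \<xi>(1) \<open>\<xi> \<noteq> \<beta>\<close>, of w a] \<xi>(2) by auto
      with R(1)[OF j(1)] snoc obtain r where "(r, Snd b, R j) \<in> ptrans P j" by (auto simp: lrun_append)
      then show ?thesis using send_V[OF j(1)] j(1) by (simp add: S1_def)
    qed
  qed
  moreover have "\<rho> (ptail P \<beta>) = []" using tau_tail by (simp add: \<rho>_def)
  moreover have "pending \<rho> S1 S' C x1"
    unfolding pending_def
  proof (intro conjI ballI impI)
    fix \<xi> assume \<xi>: "\<xi> \<in> pedges P" "\<xi> \<noteq> \<beta>"
    then show "sends (\<rho> (ptail P \<xi>)) = recvs (\<rho> (phead P \<xi>)) @ C \<xi>"
      using bal[OF \<xi>] tau_bal[OF \<xi>] split[OF edge_nodes(1)[OF \<xi>(1)]] split[OF edge_nodes(2)[OF \<xi>(1)]]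
      by simp
  qed (use R(2) \<open>\<rho> (ptail P \<beta>) = []\<close> in \<open>auto simp: S1_def x1_def\<close>)
  ultimately show ?thesis using S1c by blast
qed

text \<open>The shadow computation waits at a state of the product of the \<open>V j\<close>, while
  actions other than outputs on \<open>\<beta>\<close> are merely appended to the pending runs. An
  output forces the demanded part of these runs, and the state right after it lies in the product
  again, which renews the invariant.\<close>

lemma simulate:
  assumes "(step P)\<^sup>*\<^sup>* (S, chan \<beta> x) (S', C')" "S \<in> Pi\<^sub>E (pnodes P) V"
  shows "S' \<in> comp_states P \<and> (\<exists>S2 x2 \<sigma>. S2 \<in> Pi\<^sub>E (pnodes P) V
    \<and> (\<lambda>s s'. sync P \<beta> s s' \<or> emit P \<beta> s s')\<^sup>*\<^sup>* (S, x) (S2, x2) \<and> pending \<sigma> S2 S' C' x2)"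
  using assms(1)
proof (induction "(S', C')" arbitrary: S' C' rule: rtranclp_induct)
  case base
  have "pending (\<lambda>j. []) S S (chan \<beta> x) x" unfolding pending_def by auto
  then show ?case using assms(2) PiE_V_comp by blast
next
  case (step y)
  obtain T D where y: "y = (T, D)" by fastforce
  from step.hyps(3)[OF y] obtain S2 x2 \<sigma> where Tc: "T \<in> comp_states P"
    and S2: "S2 \<in> Pi\<^sub>E (pnodes P) V"
    and reach: "(\<lambda>s s'. sync P \<beta> s s' \<or> emit P \<beta> s s')\<^sup>*\<^sup>* (S, x) (S2, x2)"
    and pend: "pending \<sigma> S2 T D x2" by blast
  have S'c: "S' \<in> comp_states P" using step_comp_states[OF step.hyps(2)] Tc y by simp
  have run: "\<And>j. j \<in> pnodes P \<Longrightarrow> lrun (ptrans P j) (S2 j) (\<sigma> j) (T j)"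
    and bal: "\<And>\<xi>. \<xi> \<in> pedges P \<Longrightarrow> \<xi> \<noteq> \<beta> \<Longrightarrow> sends (\<sigma> (ptail P \<xi>)) = recvs (\<sigma> (phead P \<xi>)) @ D \<xi>"
    and x2: "x2 = recvs (\<sigma> (phead P \<beta>)) @ D \<beta>" and out: "sends (\<sigma> (ptail P \<beta>)) = []"
    using pend unfolding pending_def by auto
  from step.hyps(2)[unfolded y] show ?case
  proof cases
    case (send \<xi> i b q)
    show ?thesis
    proof (cases "\<xi> = \<beta>")
      case True
      obtain S3 \<rho> x3 where S3: "(sync P \<beta>)\<^sup>*\<^sup>* (S2, x2) (S3, x3)" "S3 \<in> comp_states P"
        "\<forall>j\<in>pnodes P - {ptail P \<beta>}. S3 j \<in> V j"
        and \<rho>: "\<rho> (ptail P \<beta>) = []" and pend3: "pending \<rho> S3 T D x3"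
        using flush_demanded[OF pend S2 Tc] by blast
      have i: "i = ptail P \<beta>" "i \<in> pnodes P" using send True edge_nodes by auto
      \<comment> \<open>Nothing is pending at the tail of \<open>\<beta>\<close> any more, so its
        shadow state is its actual state and the output can be imitated.\<close>
      have "S3 i = T i" using pend3 \<rho> i unfolding pending_def by (metis lrun.simps(1))
      then have em: "emit P \<beta> (S3, x3) (S3(i := q), x3 @ [b])"
        unfolding i(1) using send True i by (intro emit.intros) auto
      have "(\<lambda>s s'. sync P \<beta> s s' \<or> emit P \<beta> s s')\<^sup>*\<^sup>* (S2, x2) (S3, x3)"
        by (rule mono_rtranclp[rule_format, OF _ S3(1)]) simp
      then have "(\<lambda>s s'. sync P \<beta> s s' \<or> emit P \<beta> s s')\<^sup>*\<^sup>* (S, x) (S3(i := q), x3 @ [b])"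
        by (rule rtranclp.rtrancl_into_rtrancl[OF rtranclp_trans[OF reach]]) (use em in simp)
      moreover have "q \<in> V i" using send_V i(2) send by blast
      then have "S3(i := q) \<in> Pi\<^sub>E (pnodes P) V"
        using S3(2,3) i unfolding comp_states_def by (auto simp: PiE_iff extensional_def)
      moreover have "pending \<rho> (S3(i := q)) S' C' (x3 @ [b])"
        using pend3 \<rho> i send True unfolding pending_def by auto
      ultimately show ?thesis using S'c by blast
    next
      case False
      define \<sigma>' where "\<sigma>' = \<sigma>(i := \<sigma> i @ [Snd b])"
      have "i \<noteq> ptail P \<beta>" using send False tail_inj \<beta> by metis
      have recvs: "recvs (\<sigma>' j) = recvs (\<sigma> j)" for j by (simp add: \<sigma>'_def)
      have sends: "j \<noteq> i \<Longrightarrow> sends (\<sigma>' j) = sends (\<sigma> j)" for j by (simp add: \<sigma>'_def)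
      have "pending \<sigma>' S2 S' C' x2"
        unfolding pending_def
      proof (intro conjI ballI impI)
        fix j assume "j \<in> pnodes P"
        then show "lrun (ptrans P j) (S2 j) (\<sigma>' j) (S' j)"
          using run send by (auto simp: \<sigma>'_def lrun_append)
      next
        fix \<eta> assume \<eta>: "\<eta> \<in> pedges P" "\<eta> \<noteq> \<beta>"
        show "sends (\<sigma>' (ptail P \<eta>)) = recvs (\<sigma>' (phead P \<eta>)) @ C' \<eta>"
        proof (cases "\<eta> = \<xi>")
          case True
          then show ?thesis using bal[OF \<eta>] send by (simp add: recvs) (simp add: \<sigma>'_def)
        next
          case False
          then have "ptail P \<eta> \<noteq> i" using tail_inj \<eta>(1) send by metis
          then show ?thesis using bal[OF \<eta>] send False by (simp add: recvs sends)
        qed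
      qed (use x2 out send False \<open>i \<noteq> ptail P \<beta>\<close> in \<open>auto simp: recvs sends\<close>)
      then show ?thesis using S'c S2 reach by blast
    qed
  next
    case (recv \<xi> i b q w)
    define \<sigma>' where "\<sigma>' = \<sigma>(i := \<sigma> i @ [Rcv b])"
    have recvs: "j \<noteq> i \<Longrightarrow> recvs (\<sigma>' j) = recvs (\<sigma> j)" for j by (simp add: \<sigma>'_def)
    have sends: "sends (\<sigma>' j) = sends (\<sigma> j)" for j by (simp add: \<sigma>'_def)
    have bal': "recvs (\<sigma>' (phead P \<eta>)) @ C' \<eta> = recvs (\<sigma> (phead P \<eta>)) @ D \<eta>" if "\<eta> \<in> pedges P" for \<eta>
    proof (cases "\<eta> = \<xi>")
      case True
      then show ?thesis using recv by (simp add: \<sigma>'_def)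
    next
      case False
      then have "phead P \<eta> \<noteq> i" using head_inj that recv by metis
      then show ?thesis using recv False by (simp add: recvs)
    qed
    have "pending \<sigma>' S2 S' C' x2"
      unfolding pending_def
    proof (intro conjI ballI impI)
      fix j assume "j \<in> pnodes P"
      then show "lrun (ptrans P j) (S2 j) (\<sigma>' j) (S' j)"
        using run recv by (auto simp: \<sigma>'_def lrun_append)
    qed (use x2 out bal bal' \<beta> in \<open>auto simp: sends\<close>)
    then show ?thesis using S'c S2 reach by blast
  qed
qed

text \<open>With the other channels empty in the end, \<open>flush\<close> executes whatever is
  still pending. Outputs thus occur only before the last product state \<open>S2\<close>, and
  \<open>sync\<close> alone does the rest.\<close>

lemma simulate_empty:
  assumes "(step P)\<^sup>*\<^sup>* (S, chan \<beta> x) (S', chan \<beta> x')" "S \<in> Pi\<^sub>E (pnodes P) V"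
  obtains S2 x2 where "S2 \<in> Pi\<^sub>E (pnodes P) V"
    "(\<lambda>s s'. sync P \<beta> s s' \<or> emit P \<beta> s s')\<^sup>*\<^sup>* (S, x) (S2, x2)" "(sync P \<beta>)\<^sup>*\<^sup>* (S2, x2) (S', x')"
proof -
  obtain S2 x2 \<sigma> where "S' \<in> comp_states P" "S2 \<in> Pi\<^sub>E (pnodes P) V"
    "(\<lambda>s s'. sync P \<beta> s s' \<or> emit P \<beta> s s')\<^sup>*\<^sup>* (S, x) (S2, x2)" "pending \<sigma> S2 S' (chan \<beta> x') x2"
    using simulate[OF assms] by blast
  then show ?thesis using that flush[of \<sigma> S2 S' "chan \<beta> x'" x2] PiE_V_comp by auto
qed

section \<open>Extensions and the drained family\<close>

lemma consistentD:
  assumes "consistent P \<beta> Q" "S \<in> comp_states P" "x \<in> Q S"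
    "(step P)\<^sup>*\<^sup>* (S, chan \<beta> x) (S', chan \<beta> x')"
  shows "x' \<in> Q S'"
  using assms(1)[unfolded consistent_def, rule_format, of S "chan \<beta> x" S' "chan \<beta> x'"] assms(2-4)
  by simp

lemma drain_base: "S \<in> Pi\<^sub>E (pnodes P) V \<Longrightarrow> Q0 S \<subseteq> drain P \<beta> V Q0 S"
  unfolding drain_def by auto

lemma drain_sync:
  "x \<in> drain P \<beta> V Q0 S \<Longrightarrow> sync P \<beta> (S, x) (S', x') \<Longrightarrow> x' \<in> drain P \<beta> V Q0 S'"
  unfolding drain_def by (auto intro: rtranclp.rtrancl_into_rtrancl)

context
  fixes Q0 :: "('n \<Rightarrow> 's) \<Rightarrow> 'm list set"
  assumes Q0: "\<And>S. S \<in> Pi\<^sub>E (pnodes P) V \<Longrightarrow> Q0 S \<subseteq> lists (pmsgs P \<beta>)"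
begin

lemma drain_lists: "drain P \<beta> V Q0 S \<subseteq> lists (pmsgs P \<beta>)"
proof
  fix x assume "x \<in> drain P \<beta> V Q0 S"
  then obtain S0 x0 where S0: "S0 \<in> Pi\<^sub>E (pnodes P) V" "x0 \<in> Q0 S0" "(sync P \<beta>)\<^sup>*\<^sup>* (S0, x0) (S, x)"
    unfolding drain_def by blast
  then have "x0 \<in> lists (pmsgs P \<beta>)" using Q0 by blast
  moreover obtain u where "x0 = u @ x" using syncs_suffix[OF S0(3)] by (auto simp: suffix_def)
  ultimately show "x \<in> lists (pmsgs P \<beta>)" by simp
qed

text \<open>All outputs lie before \<open>S2\<close>. Consistency puts the word reached there into
  \<open>Q S2\<close>, which is \<open>Q0 S2\<close>, so the remaining steps start from a given word
  and the outputs can be forgotten.\<close>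

lemma extension_imp_drain:
  assumes Q: "is_extension P \<beta> V Q0 Q"
    and S: "S \<in> Pi\<^sub>E (pnodes P) V" "x \<in> Q0 S" and st: "(step P)\<^sup>*\<^sup>* (S, chan \<beta> x) (S', chan \<beta> x')"
  shows "x' \<in> drain P \<beta> V Q0 S'"
proof -
  obtain S2 x2 where S2: "S2 \<in> Pi\<^sub>E (pnodes P) V"
    "(\<lambda>s s'. sync P \<beta> s s' \<or> emit P \<beta> s s')\<^sup>*\<^sup>* (S, x) (S2, x2)" "(sync P \<beta>)\<^sup>*\<^sup>* (S2, x2) (S', x')"
    by (rule simulate_empty[OF st S(1)])
  have "x \<in> Q S" using Q S unfolding is_extension_def by simp
  then have "x2 \<in> Q S2"
    using Q S(1) PiE_V_comp consistentD[OF _ _ _ sync_emit_steps[OF S2(2)]]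
    unfolding is_extension_def by blast
  then have "x2 \<in> Q0 S2" using Q S2(1) unfolding is_extension_def by simp
  with S2 show ?thesis unfolding drain_def by blast
qed

lemma drain_subset_extension:
  assumes Q: "is_extension P \<beta> V Q0 Q" shows "drain P \<beta> V Q0 S \<subseteq> Q S"
proof
  fix x assume "x \<in> drain P \<beta> V Q0 S"
  then obtain S0 x0 where S0: "S0 \<in> Pi\<^sub>E (pnodes P) V" "x0 \<in> Q0 S0" "(sync P \<beta>)\<^sup>*\<^sup>* (S0, x0) (S, x)"
    unfolding drain_def by blast
  then have "x0 \<in> Q S0" using Q unfolding is_extension_def by simp
  then show "x \<in> Q S"
    using Q S0(1) PiE_V_comp consistentD[OF _ _ _ syncs_steps[OF S0(3)]]
    unfolding is_extension_def by blast
qed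

text \<open>For necessity, every extension contains the drained family, and all words reachable from
  given ones are drained. For sufficiency, both kinds of steps of the rearranged computation keep
  the word drained up to the last product state; there the first condition returns it to
  \<open>Q0\<close>, and what follows is a drain by definition.\<close>

theorem extension_iff:
  "(\<exists>Q. is_extension P \<beta> V Q0 Q) \<longleftrightarrow>
     (\<forall>S\<in>Pi\<^sub>E (pnodes P) V. drain P \<beta> V Q0 S \<subseteq> Q0 S)
   \<and> (\<forall>S\<in>comp_states P. \<forall>x\<in>drain P \<beta> V Q0 S. \<forall>S' x'. emit P \<beta> (S, x) (S', x') \<longrightarrow> x' \<in> drain P \<beta> V Q0 S')"
  (is "?L \<longleftrightarrow> ?A \<and> ?B")
  and smallest_extension_drain:
  "(\<exists>Q. is_extension P \<beta> V Q0 Q) \<Longrightarrow> smallest_extension P \<beta> V Q0 (drain P \<beta> V Q0)"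
proof -
  have AB: "?A \<and> ?B" if Q: "is_extension P \<beta> V Q0 Q" for Q
  proof (intro conjI ballI allI impI)
    fix S assume "S \<in> Pi\<^sub>E (pnodes P) V"
    then show "drain P \<beta> V Q0 S \<subseteq> Q0 S"
      using drain_subset_extension[OF Q, of S] Q unfolding is_extension_def by simp
  next
    fix S x S' x' assume x: "x \<in> drain P \<beta> V Q0 S" and em: "emit P \<beta> (S, x) (S', x')"
    then obtain S0 x0 where S0: "S0 \<in> Pi\<^sub>E (pnodes P) V" "x0 \<in> Q0 S0" "(sync P \<beta>)\<^sup>*\<^sup>* (S0, x0) (S, x)"
      unfolding drain_def by blast
    then show "x' \<in> drain P \<beta> V Q0 S'"
      using extension_imp_drain[OF Q S0(1,2)] syncs_steps[OF S0(3)] emit_step[OF em]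
      by (meson rtranclp.rtrancl_into_rtrancl)
  qed
  have ext: "is_extension P \<beta> V Q0 (drain P \<beta> V Q0)" if A: ?A and B: ?B
    unfolding is_extension_def
  proof (intro conjI ballI)
    show "consistent P \<beta> (drain P \<beta> V Q0)"
      unfolding consistent_def
    proof (intro allI impI)
      fix S C S' C'
      assume S: "S \<in> comp_states P" and C: "\<forall>\<xi>. \<xi> \<noteq> \<beta> \<longrightarrow> C \<xi> = []" and x: "C \<beta> \<in> drain P \<beta> V Q0 S"
        and st: "(step P)\<^sup>*\<^sup>* (S, C) (S', C')" and C': "\<forall>\<xi>. \<xi> \<noteq> \<beta> \<longrightarrow> C' \<xi> = []"
      have CC: "C = chan \<beta> (C \<beta>)" "C' = chan \<beta> (C' \<beta>)" using C C' eq_chan by metis+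
      obtain S0 x0 where S0: "S0 \<in> Pi\<^sub>E (pnodes P) V" "x0 \<in> Q0 S0" "(sync P \<beta>)\<^sup>*\<^sup>* (S0, x0) (S, C \<beta>)"
        using x unfolding drain_def by blast
      have st0: "(step P)\<^sup>*\<^sup>* (S0, chan \<beta> x0) (S', chan \<beta> (C' \<beta>))"
        using syncs_steps[OF S0(3)] st CC by (metis rtranclp_trans)
      obtain S2 x2 where S2: "S2 \<in> Pi\<^sub>E (pnodes P) V"
        "(\<lambda>s s'. sync P \<beta> s s' \<or> emit P \<beta> s s')\<^sup>*\<^sup>* (S0, x0) (S2, x2)" "(sync P \<beta>)\<^sup>*\<^sup>* (S2, x2) (S', C' \<beta>)"
        by (rule simulate_empty[OF st0 S0(1)])
      have "x2 \<in> drain P \<beta> V Q0 S2"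
        using S2(2)
      proof (induction "(S2, x2)" arbitrary: S2 x2 rule: rtranclp_induct)
        case base
        then show ?case using drain_base[OF S0(1), of Q0] S0(2) by blast
      next
        case (step y)
        obtain T z where y: "y = (T, z)" by fastforce
        then have "T \<in> comp_states P"
          using steps_comp_states[OF sync_emit_steps[of S0 x0 T z]] step.hyps(1) S0(1) PiE_V_comp by auto
        then show ?case using step.hyps(2) step.hyps(3)[OF y] drain_sync[of z Q0 T] B unfolding y by blast
      qed
      with A S2(1) have "x2 \<in> Q0 S2" by blast
      with S2 show "C' \<beta> \<in> drain P \<beta> V Q0 S'" unfolding drain_def by blast
    qed
  next
    fix S assume "S \<in> Pi\<^sub>E (pnodes P) V"
    then show "drain P \<beta> V Q0 S = Q0 S" using A drain_base[of S Q0] by blast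
  qed (rule drain_lists)
  show "?L \<longleftrightarrow> ?A \<and> ?B"
  proof
    assume ?L
    then obtain Q where "is_extension P \<beta> V Q0 Q" ..
    then show "?A \<and> ?B" by (rule AB)
  next
    assume "?A \<and> ?B"
    then have "is_extension P \<beta> V Q0 (drain P \<beta> V Q0)" using ext by simp
    then show ?L by (rule exI[where x="drain P \<beta> V Q0"])
  qed
  assume ?L
  then obtain Q where "is_extension P \<beta> V Q0 Q" ..
  then have "is_extension P \<beta> V Q0 (drain P \<beta> V Q0)" using ext AB by blast
  then show "smallest_extension P \<beta> V Q0 (drain P \<beta> V Q0)"
    unfolding smallest_extension_def using drain_subset_extension by simp
qed

end
end

section \<open>Certificates\<close>

lemma comput_compose2:
  assumes "comput (\<lambda>p. F (fst p) (snd p))" "comput f" "comput g"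
  shows "comput (\<lambda>x. F (f x) (g x))"
  using comput_compose[OF assms(1) comput_Pair[OF assms(2,3)]] by simp

lemma comput_compose3:
  assumes "comput (\<lambda>p. F (fst p) (fst (snd p)) (snd (snd p)))" "comput f" "comput g" "comput h"
  shows "comput (\<lambda>x. F (f x) (g x) (h x))"
  using comput_compose[OF assms(1) comput_Pair[OF assms(2) comput_Pair[OF assms(3,4)]]] by simp

section \<open>Reading protocols and families off their codes\<close>

definition tail_of :: "proto_code \<Rightarrow> nat \<Rightarrow> nat" where
  "tail_of pc \<xi> = (case map_of (fst (snd pc)) \<xi> of None \<Rightarrow> 0 | Some y \<Rightarrow> fst y)"

definition head_of :: "proto_code \<Rightarrow> nat \<Rightarrow> nat" where
  "head_of pc \<xi> = (case map_of (fst (snd pc)) \<xi> of None \<Rightarrow> 0 | Some y \<Rightarrow> fst (snd y))"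

definition msgs_of :: "proto_code \<Rightarrow> nat \<Rightarrow> nat list" where
  "msgs_of pc \<xi> = (case map_of (fst (snd pc)) \<xi> of None \<Rightarrow> [] | Some y \<Rightarrow> snd (snd y))"

definition states_of :: "proto_code \<Rightarrow> nat \<Rightarrow> nat list" where
  "states_of pc j = (case map_of (snd (snd pc)) j of None \<Rightarrow> [] | Some y \<Rightarrow> fst y)"

definition trans_of :: "proto_code \<Rightarrow> nat \<Rightarrow> (nat \<times> bool \<times> nat \<times> nat) list" where
  "trans_of pc j = (case map_of (snd (snd pc)) j of None \<Rightarrow> [] | Some y \<Rightarrow> snd (snd y))"

definition subset_of :: "(nat \<times> nat list) list \<Rightarrow> nat \<Rightarrow> nat list" where
  "subset_of vs j = (case map_of vs j of None \<Rightarrow> [] | Some l \<Rightarrow> l)"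

text \<open>The value \<open>undefined\<close> for missing nodes agrees with \<open>decode_state\<close>; being a fixed number,
  it does not affect computability.\<close>

definition lookup :: "(nat \<times> nat) list \<Rightarrow> nat \<Rightarrow> nat" where
  "lookup k j = (case map_of k j of None \<Rightarrow> undefined | Some s \<Rightarrow> s)"

text \<open>Decoded states are functions, so they are compared through \<open>lookup\<close> on the
  node list. The first matching entry counts, as in \<open>decode_family\<close>, and a missing
  entry becomes an automaton for the empty set.\<close>

definition nfa_of :: "nat list \<Rightarrow> family_code \<Rightarrow> (nat \<times> nat) list \<Rightarrow> nat nfa" where
  "nfa_of ns fc k = (case find (\<lambda>d. \<forall>j\<in>set ns. lookup (fst d) j = lookup k j) fc of
     None \<Rightarrow> (0, [], []) | Some d \<Rightarrow> snd d)"

lemma comput_codes: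
  "comput f \<Longrightarrow> comput g \<Longrightarrow> comput (\<lambda>x. tail_of (f x) (g x))"
  "comput f \<Longrightarrow> comput g \<Longrightarrow> comput (\<lambda>x. head_of (f x) (g x))"
  "comput f \<Longrightarrow> comput g \<Longrightarrow> comput (\<lambda>x. msgs_of (f x) (g x))"
  "comput f \<Longrightarrow> comput g \<Longrightarrow> comput (\<lambda>x. states_of (f x) (g x))"
  "comput f \<Longrightarrow> comput g \<Longrightarrow> comput (\<lambda>x. trans_of (f x) (g x))"
  "comput h \<Longrightarrow> comput g \<Longrightarrow> comput (\<lambda>x. subset_of (h x) (g x))"
  "comput k \<Longrightarrow> comput g \<Longrightarrow> comput (\<lambda>x. lookup (k x) (g x))"
  by (rule comput_compose2; (assumption | simp only: tail_of_def head_of_def msgs_of_def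
        states_of_def trans_of_def subset_of_def lookup_def, intro comput_intros))+

lemma comput_nfa_of:
  "comput f \<Longrightarrow> comput g \<Longrightarrow> comput k \<Longrightarrow> comput (\<lambda>x. nfa_of (f x) (g x) (k x))"
  by (rule comput_compose3; (assumption | simp only: nfa_of_def, intro comput_intros comput_codes))

section \<open>Format and checks of certificates\<close>

type_synonym input = "proto_code \<times> nat \<times> (nat \<times> nat list) list \<times> family_code"

text \<open>A certificate \<open>(out, SS, Ts, e, \<delta>, lam, Y, F)\<close> consists of the output family, the composite
  states, the monoid elements with ranks witnessing that they are generated by letters, the unit,
  right multiplication \<open>(t, b, t b)\<close>, left multiplication \<open>(b, t, b t)\<close>, triples \<open>(k, t, p)\<close>
  saying that words of value \<open>t\<close> lead the automaton given for \<open>k\<close> to state \<open>p\<close>, and the accepting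
  pairs \<open>(k, t)\<close>, whose ranks ensure that only the least solution is accepted.\<close>

type_synonym cert = "family_code \<times> (nat \<times> nat) list list \<times> (nat \<times> nat) list \<times> nat
  \<times> (nat \<times> nat \<times> nat) list \<times> (nat \<times> nat \<times> nat) list \<times> ((nat \<times> nat) list \<times> nat \<times> nat) list
  \<times> (((nat \<times> nat) list \<times> nat) \<times> nat) list"

text \<open>Closure under changing one coordinate, starting from any state, reaches the whole
  product; the checker need not enumerate it.\<close>

definition cert_states :: "input \<Rightarrow> cert \<Rightarrow> bool" where
  "cert_states inp c = (case inp of (pc, \<beta>, vs, fc) \<Rightarrow> case c of (out, SS, Ts, e, \<delta>, lam, Y, F) \<Rightarrow>
     SS \<noteq> []
   \<and> (\<forall>k\<in>set SS. \<forall>j\<in>set (fst pc). lookup k j \<in> set (states_of pc j)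
        \<and> (\<forall>q\<in>set (states_of pc j). \<exists>k'\<in>set SS. \<forall>i\<in>set (fst pc). lookup k' i = (if i = j then q else lookup k i))))"

text \<open>The ranks exclude elements that are the value of no word. An accepting pair for such an
  element could make \<open>cert_ok\<close> fail although no word violates anything.\<close>

definition cert_right :: "input \<Rightarrow> cert \<Rightarrow> bool" where
  "cert_right inp c = (case inp of (pc, \<beta>, vs, fc) \<Rightarrow> case c of (out, SS, Ts, e, \<delta>, lam, Y, F) \<Rightarrow>
     (\<exists>(t, n)\<in>set Ts. t = e)
   \<and> (\<forall>(t, n)\<in>set Ts. \<forall>b\<in>set (msgs_of pc \<beta>). \<exists>(t1, b1, t2)\<in>set \<delta>. t1 = t \<and> b1 = b)
   \<and> (\<forall>(t, b, t')\<in>set \<delta>. b \<in> set (msgs_of pc \<beta>) \<and> (\<exists>(u, n)\<in>set Ts. u = t')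
        \<and> (\<forall>(t1, b1, t2)\<in>set \<delta>. t1 = t \<and> b1 = b \<longrightarrow> t2 = t'))
   \<and> (\<forall>(t, n)\<in>set Ts. t = e \<or> (\<exists>(t1, b, t2)\<in>set \<delta>. \<exists>(u, m)\<in>set Ts. t2 = t \<and> u = t1 \<and> m < n)))"

text \<open>The laws \<open>b e = e b\<close> and \<open>b (t a) = (b t) a\<close> carry left
  multiplication from the unit along \<open>\<delta>\<close>, so no further products are tabulated.
  By the last clause the value of \<open>b # x\<close> depends on that of \<open>x\<close>
  alone.\<close>

definition cert_left :: "input \<Rightarrow> cert \<Rightarrow> bool" where
  "cert_left inp c = (case inp of (pc, \<beta>, vs, fc) \<Rightarrow> case c of (out, SS, Ts, e, \<delta>, lam, Y, F) \<Rightarrow>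
     (\<forall>(t, b, t')\<in>set \<delta>. t = e \<longrightarrow> (b, e, t') \<in> set lam)
   \<and> (\<forall>(b, t, s)\<in>set lam. b \<in> set (msgs_of pc \<beta>)
        \<and> (\<forall>(t1, a, t2)\<in>set \<delta>. \<forall>(s1, a', s2)\<in>set \<delta>. t1 = t \<and> s1 = s \<and> a = a' \<longrightarrow> (b, t2, s2) \<in> set lam)
        \<and> (\<forall>(b', t', s')\<in>set lam. b' = b \<and> t' = t \<longrightarrow> s' = s)))"

definition in_V :: "nat list \<Rightarrow> (nat \<times> nat list) list \<Rightarrow> (nat \<times> nat) list \<Rightarrow> bool" where
  "in_V ns vs k \<longleftrightarrow> (\<forall>j\<in>set ns. lookup k j \<in> set (subset_of vs j))"

text \<open>\<open>Y\<close> has to list the states reached by a word of value \<open>t\<close>,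
  whichever word that is. The forward clause puts in every reached state; the backward clause,
  imposed along each edge of \<open>\<delta>\<close> into \<open>t\<close>, admits none that some
  word of this value misses.\<close>

definition cert_nfas :: "input \<Rightarrow> cert \<Rightarrow> bool" where
  "cert_nfas inp c = (case inp of (pc, \<beta>, vs, fc) \<Rightarrow> case c of (out, SS, Ts, e, \<delta>, lam, Y, F) \<Rightarrow>
     \<forall>k\<in>set SS. in_V (fst pc) vs k \<longrightarrow>
       (k, e, fst (nfa_of (fst pc) fc k)) \<in> set Y
     \<and> (\<forall>(k1, t, p)\<in>set Y. k1 = k \<longrightarrow>
          (t = e \<longrightarrow> p = fst (nfa_of (fst pc) fc k))
        \<and> (\<forall>(t1, b, t2)\<in>set \<delta>.
             (t1 = t \<longrightarrow> (\<forall>(p1, a, q)\<in>set (snd (snd (nfa_of (fst pc) fc k))). p1 = p \<and> a = b \<longrightarrow> (k, t2, q) \<in> set Y))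
           \<and> (t2 = t \<longrightarrow> (\<exists>(q, a, p1)\<in>set (snd (snd (nfa_of (fst pc) fc k))). p1 = p \<and> a = b \<and> (k, t1, q) \<in> set Y)))))"

definition cert_base :: "input \<Rightarrow> cert \<Rightarrow> (nat \<times> nat) list \<times> nat \<Rightarrow> bool" where
  "cert_base inp c u = (case inp of (pc, \<beta>, vs, fc) \<Rightarrow> case c of (out, SS, Ts, e, \<delta>, lam, Y, F) \<Rightarrow>
     in_V (fst pc) vs (fst u)
   \<and> (\<exists>(k, t, p)\<in>set Y. (k, t) = u \<and> p \<in> set (fst (snd (nfa_of (fst pc) fc k)))))"

text \<open>A reception runs against left multiplication: the word loses \<open>b\<close>, so the
  old element is \<open>b\<close> times the new one. Testing the head before the tail mirrors the
  order of the two updates in \<open>sync\<close>.\<close>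

definition cert_step :: "input \<Rightarrow> cert \<Rightarrow> (nat \<times> nat) list \<times> nat \<Rightarrow> (nat \<times> nat) list \<times> nat \<Rightarrow> bool" where
  "cert_step inp c u u' = (case inp of (pc, \<beta>, vs, fc) \<Rightarrow> case c of (out, SS, Ts, e, \<delta>, lam, Y, F) \<Rightarrow>
     (\<exists>(p, snt, b, q)\<in>set (trans_of pc (head_of pc \<beta>)).
        \<not> snt \<and> p = lookup (fst u) (head_of pc \<beta>) \<and> (b, snd u', snd u) \<in> set lam
      \<and> (\<forall>i\<in>set (fst pc). lookup (fst u') i = (if i = head_of pc \<beta> then q else lookup (fst u) i)))
   \<or> (snd u = snd u' \<and> (\<exists>(\<xi>, _)\<in>set (fst (snd pc)). \<xi> \<noteq> \<beta>
      \<and> (\<exists>(p, snt, b, q)\<in>set (trans_of pc (tail_of pc \<xi>)).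
         \<exists>(p', snt', b', q')\<in>set (trans_of pc (head_of pc \<xi>)).
           snt \<and> \<not> snt' \<and> b = b' \<and> p = lookup (fst u) (tail_of pc \<xi>) \<and> p' = lookup (fst u) (head_of pc \<xi>)
         \<and> (\<forall>i\<in>set (fst pc). lookup (fst u') i =
              (if i = head_of pc \<xi> then q' else if i = tail_of pc \<xi> then q else lookup (fst u) i))))))"

definition cert_drain :: "input \<Rightarrow> cert \<Rightarrow> bool" where
  "cert_drain inp c = (case inp of (pc, \<beta>, vs, fc) \<Rightarrow> case c of (out, SS, Ts, e, \<delta>, lam, Y, F) \<Rightarrow>
     (\<forall>k\<in>set SS. \<forall>(t, n)\<in>set Ts.
        (cert_base inp c (k, t) \<longrightarrow> (\<exists>(v, m)\<in>set F. v = (k, t)))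
      \<and> (\<forall>(u, n)\<in>set F. cert_step inp c u (k, t) \<longrightarrow> (\<exists>(v, m)\<in>set F. v = (k, t))))
   \<and> (\<forall>(u, n)\<in>set F. fst u \<in> set SS \<and> (\<exists>(t, m)\<in>set Ts. t = snd u)
      \<and> (cert_base inp c u \<or> (\<exists>(v, m)\<in>set F. m < n \<and> cert_step inp c v u))))"

text \<open>Words are recognised by their value, so one transition table serves every composite
  state and only the final elements vary.\<close>

definition cert_out :: "input \<Rightarrow> cert \<Rightarrow> bool" where
  "cert_out inp c = (case c of (out, SS, Ts, e, \<delta>, lam, Y, F) \<Rightarrow>
     (\<forall>k\<in>set SS. \<exists>(k', A)\<in>set out. k' = k)
   \<and> (\<forall>(k, e', Fs, \<delta>')\<in>set out. k \<in> set SS \<and> e' = e \<and> \<delta>' = \<delta>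
      \<and> (\<forall>t\<in>set Fs. \<exists>(u, n)\<in>set F. u = (k, t))
      \<and> (\<forall>(u, n)\<in>set F. fst u = k \<longrightarrow> snd u \<in> set Fs)))"

text \<open>These are the two conditions of \<open>extension_iff\<close> in terms of accepting
  pairs. They stay outside \<open>cert\<close>, so that certificates exist also for families that
  cannot be extended.\<close>

definition cert_ok :: "input \<Rightarrow> cert \<Rightarrow> bool" where
  "cert_ok inp c = (case inp of (pc, \<beta>, vs, fc) \<Rightarrow> case c of (out, SS, Ts, e, \<delta>, lam, Y, F) \<Rightarrow>
     \<forall>(u, n)\<in>set F. (in_V (fst pc) vs (fst u) \<longrightarrow> cert_base inp c u)
     \<and> (\<forall>(p, snt, b, q)\<in>set (trans_of pc (tail_of pc \<beta>)). snt \<and> p = lookup (fst u) (tail_of pc \<beta>) \<longrightarrow>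
         (\<forall>k\<in>set SS. (\<forall>i\<in>set (fst pc). lookup k i = (if i = tail_of pc \<beta> then q else lookup (fst u) i)) \<longrightarrow>
           (\<forall>(t, b', t')\<in>set \<delta>. t = snd u \<and> b' = b \<longrightarrow> (\<exists>(v, m)\<in>set F. v = (k, t'))))))"

definition cert :: "input \<Rightarrow> cert \<Rightarrow> bool" where
  "cert inp c \<longleftrightarrow> cert_states inp c \<and> cert_right inp c \<and> cert_left inp c \<and> cert_nfas inp c
     \<and> cert_drain inp c \<and> cert_out inp c"

section \<open>Computability of the checks\<close>

lemma comput_in_V:
  "comput f \<Longrightarrow> comput g \<Longrightarrow> comput k \<Longrightarrow> comput (\<lambda>x. in_V (f x) (g x) (k x))"
  by (rule comput_compose3; (assumption | simp only: in_V_def, intro comput_intros comput_codes))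

lemma comput_cert_base:
  "comput f \<Longrightarrow> comput g \<Longrightarrow> comput k \<Longrightarrow> comput (\<lambda>x. cert_base (f x) (g x) (k x))"
  by (rule comput_compose3; (assumption | simp only: cert_base_def case_prod_unfold,
        intro comput_intros comput_codes comput_nfa_of comput_in_V))

lemma comput_cert_step:
  assumes "comput f" "comput g" "comput h" "comput k"
  shows "comput (\<lambda>x. cert_step (f x) (g x) (h x) (k x))"
proof -
  have "comput (\<lambda>p. cert_step (fst p) (fst (snd p)) (fst (snd (snd p))) (snd (snd (snd p))))"
    unfolding cert_step_def case_prod_unfold
    by (intro comput_intros comput_codes)
  from comput_compose[OF this comput_Pair[OF assms(1) comput_Pair[OF assms(2) comput_Pair[OF assms(3,4)]]]]
  show ?thesis by simp
qed

lemma comput_cert: "comput (\<lambda>p. cert (fst p) (snd p))"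
  unfolding cert_def cert_states_def cert_right_def cert_left_def cert_nfas_def cert_drain_def
    cert_out_def case_prod_unfold
  by (intro comput_intros comput_codes comput_nfa_of comput_in_V comput_cert_base comput_cert_step)

lemma comput_cert_ok: "comput (\<lambda>p. cert_ok (fst p) (snd p))"
  unfolding cert_ok_def case_prod_unfold
  by (intro comput_intros comput_codes comput_in_V comput_cert_base)

text \<open>The class instances follow the prescribed codes constructor by constructor, so facts
  about \<open>comput\<close> apply to the numbers in the final statement.\<close>

lemma enc_family_encd: "enc_family out = encd out"
  unfolding enc_family_def enc_nfa_def encd_list_def encd_prod_def encd_nat_def
  by (auto simp: encd_list_def encd_prod_def encd_nat_def case_prod_unfold comp_def
      intro!: arg_cong[of _ _ list_encode] map_cong)

lemma map_encd_nat: "map encd (l :: nat list) = l"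
  by (simp add: encd_nat_def map_idI)

lemma enc_input_encd: "enc_input pc \<beta> vs fc = encd (pc, \<beta>, vs, fc)"
  unfolding enc_input_def enc_family_encd enc_protocol_def enc_V_def
  by (auto simp: encd_list_def encd_prod_def encd_nat_def encd_bool_def map_encd_nat case_prod_unfold comp_def
      intro!: arg_cong[of _ _ list_encode] arg_cong[of _ _ prod_encode] map_cong)

section \<open>Correctness of certificates\<close>

lemma send_image_iff:
  "(p, Snd b, q) \<in> (\<lambda>(p, s, b, q). (p, if s then Snd b else Rcv b, q)) ` A \<longleftrightarrow> (p, True, b, q) \<in> A"
proof
  assume "(p, True, b, q) \<in> A"
  then show "(p, Snd b, q) \<in> (\<lambda>(p, s, b, q). (p, if s then Snd b else Rcv b, q)) ` A"
    by (rule rev_image_eqI) simp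
qed (auto split: if_splits)

lemma recv_image_iff:
  "(p, Rcv b, q) \<in> (\<lambda>(p, s, b, q). (p, if s then Snd b else Rcv b, q)) ` A \<longleftrightarrow> (p, False, b, q) \<in> A"
proof
  assume "(p, False, b, q) \<in> A"
  then show "(p, Rcv b, q) \<in> (\<lambda>(p, s, b, q). (p, if s then Snd b else Rcv b, q)) ` A"
    by (rule rev_image_eqI) simp
qed (auto split: if_splits)

lemma decode_protocol_simps:
  "pnodes (decode_protocol pc) = set (fst pc)"
  "pedges (decode_protocol pc) = fst ` set (fst (snd pc))"
  "ptail (decode_protocol pc) = tail_of pc"
  "phead (decode_protocol pc) = head_of pc"
  "pmsgs (decode_protocol pc) \<xi> = set (msgs_of pc \<xi>)"
  "pstates (decode_protocol pc) j = set (states_of pc j)"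
  "(p, Snd b, q) \<in> ptrans (decode_protocol pc) j \<longleftrightarrow> (p, True, b, q) \<in> set (trans_of pc j)"
  "(p, Rcv b, q) \<in> ptrans (decode_protocol pc) j \<longleftrightarrow> (p, False, b, q) \<in> set (trans_of pc j)"
  by (cases pc; simp add: decode_protocol_def tail_of_def head_of_def msgs_of_def states_of_def
      trans_of_def fun_eq_iff send_image_iff recv_image_iff split: option.split)+

lemma decode_V_subset_of: "decode_V vs j = set (subset_of vs j)"
  by (simp add: decode_V_def subset_of_def split: option.split)

lemma decode_state_lookup: "decode_state N k j = (if j \<in> N then lookup k j else undefined)"
  by (simp add: decode_state_def lookup_def split: option.split)

lemma nfa_path_append: "nfa_path \<delta> p (x @ y) q \<longleftrightarrow> (\<exists>r. nfa_path \<delta> p x r \<and> nfa_path \<delta> r y q)"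
proof (induction x arbitrary: p)
  case Nil
  then show ?case by (auto intro: nfa_path.nil elim: nfa_path.cases)
next
  case (Cons a x)
  have c: "nfa_path \<delta> p (a # z) q \<longleftrightarrow> (\<exists>s. (p, a, s) \<in> set \<delta> \<and> nfa_path \<delta> s z q)" for p z q
    by (auto intro: nfa_path.cons elim: nfa_path.cases)
  show ?case by (auto simp: c Cons)
qed

lemma nfa_path_Nil[simp]: "nfa_path \<delta> p [] q \<longleftrightarrow> p = q"
  by (auto intro: nfa_path.nil elim: nfa_path.cases)

lemma nfa_path_single[simp]: "nfa_path \<delta> p [a] q \<longleftrightarrow> (p, a, q) \<in> set \<delta>"
  by (auto intro: nfa_path.intros elim: nfa_path.cases)

lemma bex_recv: "(\<exists>(p, s, b, q)\<in>A. \<not> s \<and> p = a \<and> R b q) \<longleftrightarrow> (\<exists>b q. (a, False, b, q) \<in> A \<and> R b q)"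
  by force

lemma bex_send_recv:
  "(\<exists>(p, s, b, q)\<in>A. \<exists>(p', s', b', q')\<in>B. s \<and> \<not> s' \<and> b = b' \<and> p = a \<and> p' = a' \<and> R q q')
    \<longleftrightarrow> (\<exists>b p q. (a, True, b, p) \<in> A \<and> (a', False, b, q) \<in> B \<and> R p q)" (is "?L \<longleftrightarrow> ?R")
proof
  assume ?L
  then show ?R by (clarsimp simp del: split_paired_Ex) blast
next
  assume ?R
  then obtain b p q where "(a, True, b, p) \<in> A" "(a', False, b, q) \<in> B" "R p q" by blast
  then show ?L
    by (intro bexI[of _ "(a, True, b, p)"]) (simp_all, intro bexI[of _ "(a', False, b, q)"], simp_all)
qed

lemma bex_fst: "(\<exists>(x, _)\<in>A. R x) \<longleftrightarrow> (\<exists>x. x \<in> fst ` A \<and> R x)"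
  by force

section \<open>Valid coded instances\<close>

locale valid_input =
  fixes pc :: proto_code and \<beta> vs fc
  assumes valid: "valid_instance pc \<beta> vs fc"
begin

abbreviation "P \<equiv> decode_protocol pc"
abbreviation "N \<equiv> set (fst pc)"
abbreviation "V \<equiv> decode_V vs"
abbreviation "M \<equiv> set (msgs_of pc \<beta>)"
abbreviation "Q0 \<equiv> decode_family N fc"
abbreviation "st \<equiv> decode_state N"

lemma cyclic_protocol: "cyclic_protocol P \<beta> V"
  using valid unfolding valid_instance_def by unfold_locales (auto simp: Let_def)

sublocale cyclic_protocol P \<beta> V by (rule cyclic_protocol)

lemma Q0_lists: "S \<in> Pi\<^sub>E (pnodes P) V \<Longrightarrow> Q0 S \<subseteq> lists (pmsgs P \<beta>)"
  using valid unfolding valid_instance_def by (auto simp: Let_def decode_protocol_simps)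

lemma in_V_iff: "in_V (fst pc) vs k \<longleftrightarrow> st k \<in> Pi\<^sub>E (pnodes P) V"
  by (auto simp: in_V_def decode_V_subset_of decode_protocol_simps decode_state_lookup PiE_iff extensional_def)

lemma Q0_nfa_of: "Q0 (st k) = nfa_lang (nfa_of (fst pc) fc k)"
proof -
  have eq: "(\<lambda>d. \<forall>j\<in>N. lookup (fst d) j = lookup k j) = (\<lambda>d. st (fst d) = st k)"
    by (rule ext) (auto simp: fun_eq_iff decode_state_lookup)
  show ?thesis
    unfolding decode_family_def nfa_of_def eq by (auto simp: nfa_lang_def split: option.split)
qed

lemma update_iff:
  assumes "j \<in> N"
  shows "(\<forall>i\<in>N. lookup k' i = (if i = j then q else lookup k i)) \<longleftrightarrow> st k' = (st k)(j := q)" (is "?L \<longleftrightarrow> ?R")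
proof
  assume L: ?L
  show ?R
  proof
    fix i show "st k' i = ((st k)(j := q)) i" using L assms by (cases "i \<in> N") (auto simp: decode_state_lookup)
  qed
next
  assume R: ?R
  show ?L
  proof
    fix i assume "i \<in> N"
    with fun_cong[OF R, of i] show "lookup k' i = (if i = j then q else lookup k i)" by (simp add: decode_state_lookup)
  qed
qed

lemma update2_iff:
  assumes "i \<in> N" "j \<in> N"
  shows "(\<forall>l\<in>N. lookup k' l = (if l = j then q else if l = i then p else lookup k l))
    \<longleftrightarrow> st k' = (st k)(i := p, j := q)" (is "?L \<longleftrightarrow> ?R")
proof
  assume L: ?L
  show ?R
  proof
    fix l show "st k' l = ((st k)(i := p, j := q)) l" using L assms by (cases "l \<in> N") (auto simp: decode_state_lookup)
  qed
next
  assume R: ?R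
  show ?L
  proof
    fix l assume "l \<in> N"
    with fun_cong[OF R, of l] show "lookup k' l = (if l = j then q else if l = i then p else lookup k l)" by (simp add: decode_state_lookup)
  qed
qed

lemma cert_step_iff:
  "cert_step (pc, \<beta>, vs, fc) (out, SS, Ts, e, \<delta>, lam, Y, F) (k, t) (k', t') \<longleftrightarrow>
     (\<exists>b q. (st k (phead P \<beta>), Rcv b, q) \<in> ptrans P (phead P \<beta>) \<and> (b, t', t) \<in> set lam
        \<and> st k' = (st k)(phead P \<beta> := q))
   \<or> (t = t' \<and> (\<exists>\<xi> b p q. \<xi> \<in> pedges P \<and> \<xi> \<noteq> \<beta> \<and> (st k (ptail P \<xi>), Snd b, p) \<in> ptrans P (ptail P \<xi>)
        \<and> (st k (phead P \<xi>), Rcv b, q) \<in> ptrans P (phead P \<xi>) \<and> st k' = (st k)(ptail P \<xi> := p, phead P \<xi> := q)))"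
  (is "?L \<longleftrightarrow> ?A \<or> ?B")
proof -
  have h: "phead P \<beta> \<in> N" using edge_nodes(2)[OF \<beta>] by (simp add: decode_protocol_simps)
  have lk: "st k j = lookup k j" if "j \<in> N" for j using that by (simp add: decode_state_lookup)
  have hd: "phead P \<xi> \<in> N" "ptail P \<xi> \<in> N" if "\<xi> \<in> pedges P" for \<xi>
    using edge_nodes that by (simp_all add: decode_protocol_simps(1))
  have "?A \<longleftrightarrow> (\<exists>b q. (lookup k (phead P \<beta>), False, b, q) \<in> set (trans_of pc (phead P \<beta>)) \<and> (b, t', t) \<in> set lam
        \<and> (\<forall>i\<in>N. lookup k' i = (if i = phead P \<beta> then q else lookup k i)))"
    unfolding update_iff[OF h] lk[OF h] decode_protocol_simps(8) ..
  moreover have "?B \<longleftrightarrow> t = t' \<and> (\<exists>\<xi> b p q. \<xi> \<in> pedges P \<and> \<xi> \<noteq> \<beta>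
      \<and> (lookup k (ptail P \<xi>), True, b, p) \<in> set (trans_of pc (ptail P \<xi>))
      \<and> (lookup k (phead P \<xi>), False, b, q) \<in> set (trans_of pc (phead P \<xi>))
      \<and> (\<forall>i\<in>N. lookup k' i = (if i = phead P \<xi> then q else if i = ptail P \<xi> then p else lookup k i)))"
    using hd lk by (simp add: update2_iff decode_protocol_simps(7,8) cong: conj_cong)
  ultimately show ?thesis
    unfolding cert_step_def prod.case fst_conv snd_conv bex_recv bex_send_recv bex_fst decode_protocol_simps(2-4)
    by (simp only: ex_simps)
qed

end

section \<open>A certificate read as a finite monoid\<close>

lemmas paired_quants = prod.case Ball_def Bex_def split_paired_All split_paired_Ex

locale certified = valid_input +
  fixes out :: family_code and SS Ts e \<delta> lam Y F
  assumes cert: "cert (pc, \<beta>, vs, fc) (out, SS, Ts, e, \<delta>, lam, Y, F)"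
begin

abbreviation "inp \<equiv> (pc, \<beta>, vs, fc)"
abbreviation "c \<equiv> (out, SS, Ts, e, \<delta>, lam, Y, F)"

lemma states_wf: "k \<in> set SS \<Longrightarrow> st k \<in> comp_states P"
  using cert unfolding cert_def cert_states_def comp_states_def
  by (auto simp: PiE_iff decode_protocol_simps decode_state_lookup extensional_def)

lemma states_cover:
  assumes S: "S \<in> comp_states P" obtains k where "k \<in> set SS" "st k = S"
proof -
  \<comment> \<open>An arbitrary listed state is made to agree with \<open>S\<close> on one more
    node at a time.\<close>
  have "\<exists>k\<in>set SS. \<forall>j\<in>A. st k j = S j" if "finite A" "A \<subseteq> N" for A
    using that
  proof (induction A)
    case empty
    have "SS \<noteq> []" using cert unfolding cert_def cert_states_def by simp
    then show ?case using hd_in_set by blast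
  next
    case (insert j A)
    then obtain k where k: "k \<in> set SS" "\<forall>j\<in>A. st k j = S j" by auto
    have j: "j \<in> N" using insert.prems by simp
    then have "S j \<in> set (states_of pc j)"
      using S by (auto simp: comp_states_def decode_protocol_simps)
    with k(1) j obtain k' where k': "k' \<in> set SS"
        "\<forall>i\<in>N. lookup k' i = (if i = j then S j else lookup k i)"
      using cert unfolding cert_def cert_states_def by fastforce
    from k'(2) have "st k' = (st k)(j := S j)" unfolding update_iff[OF j] .
    with k k'(1) show ?case by (intro bexI[of _ k']) auto
  qed
  from this[of N] obtain k where k: "k \<in> set SS" "\<forall>j\<in>N. st k j = S j" by auto
  have "st k = S"
    using states_wf[OF k(1)] S k(2) unfolding comp_states_def
    by (intro PiE_ext) (auto simp: decode_protocol_simps)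
  with k(1) that show ?thesis by blast
qed

abbreviation "T \<equiv> fst ` set Ts"

lemma in_T_iff: "t \<in> T \<longleftrightarrow> (\<exists>n. (t, n) \<in> set Ts)"
  by force

lemma certD: "cert_right inp c" "cert_left inp c" "cert_nfas inp c" "cert_drain inp c" "cert_out inp c"
  using cert unfolding cert_def by blast+

lemmas right = certD(1)[unfolded cert_right_def paired_quants]
lemmas left = certD(2)[unfolded cert_left_def paired_quants]

lemma init_T: "e \<in> T"
  unfolding in_T_iff using right by blast

lemma right_total: "t \<in> T \<Longrightarrow> b \<in> M \<Longrightarrow> \<exists>t'. (t, b, t') \<in> set \<delta>"
  unfolding in_T_iff using right by blast

lemma right_wf: "(t, b, t') \<in> set \<delta> \<Longrightarrow> b \<in> M \<and> t' \<in> T"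
  unfolding in_T_iff using right by blast

lemma right_det: "(t, b, t') \<in> set \<delta> \<Longrightarrow> (t, b, t'') \<in> set \<delta> \<Longrightarrow> t' = t''"
  using right by blast

lemma rank_T: "(t, n) \<in> set Ts \<Longrightarrow> t = e \<or> (\<exists>t1 b m. (t1, b, t) \<in> set \<delta> \<and> (t1, m) \<in> set Ts \<and> m < n)"
  using right by blast

lemma left_init: "(e, b, t) \<in> set \<delta> \<Longrightarrow> (b, e, t) \<in> set lam"
  using left by blast

lemma left_msg: "(b, t, s) \<in> set lam \<Longrightarrow> b \<in> M"
  using left by blast

lemma left_step: "(b, t, s) \<in> set lam \<Longrightarrow> (t, a, t') \<in> set \<delta> \<Longrightarrow> (s, a, s') \<in> set \<delta> \<Longrightarrow> (b, t', s') \<in> set lam"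
  using left by blast

lemma left_det: "(b, t, s) \<in> set lam \<Longrightarrow> (b, t, s') \<in> set lam \<Longrightarrow> s = s'"
  using left by blast

text \<open>\<open>reads x t\<close> says that \<open>t\<close> is the value of the word
  \<open>x\<close> in the monoid.\<close>

abbreviation "reads \<equiv> nfa_path \<delta> e"

lemma reads_snoc: "reads (x @ [b]) t \<longleftrightarrow> (\<exists>s. reads x s \<and> (s, b, t) \<in> set \<delta>)"
  by (simp add: nfa_path_append)

lemma reads_wf: "reads x t \<Longrightarrow> x \<in> lists M \<and> t \<in> T"
proof (induction x arbitrary: t rule: rev_induct)
  case Nil
  then show ?case using init_T by simp
next
  case (snoc b x)
  then obtain s where "reads x s" "(s, b, t) \<in> set \<delta>" by (auto simp: reads_snoc)
  then show ?case using snoc.IH[of s] right_wf[of s b t] by simp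
qed

lemma reads_total: "x \<in> lists M \<Longrightarrow> \<exists>t. reads x t"
proof (induction x rule: rev_induct)
  case Nil
  then show ?case by auto
next
  case (snoc b x)
  then obtain s where "reads x s" "b \<in> M" by auto
  then show ?case using right_total[of s b] reads_wf[of x s] by (auto simp: reads_snoc)
qed

lemma reads_det: "reads x t \<Longrightarrow> reads x t' \<Longrightarrow> t = t'"
proof (induction x arbitrary: t t' rule: rev_induct)
  case (snoc b x)
  then show ?case using right_det by (metis reads_snoc)
qed simp

lemma reads_onto: "t \<in> T \<Longrightarrow> \<exists>x. reads x t"
proof -
  have "(t, n) \<in> set Ts \<Longrightarrow> \<exists>x. reads x t" for t n
  proof (induction n arbitrary: t rule: less_induct)
    case (less n)
    from rank_T[OF less.prems] show ?case
    proof
      assume "t = e"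
      then show ?thesis using nfa_path_Nil by metis
    next
      assume "\<exists>t1 b m. (t1, b, t) \<in> set \<delta> \<and> (t1, m) \<in> set Ts \<and> m < n"
      then obtain t1 b m x where "(t1, b, t) \<in> set \<delta>" "reads x t1" using less.IH by blast
      then have "reads (x @ [b]) t" by (auto simp: reads_snoc)
      then show ?thesis ..
    qed
  qed
  then show "t \<in> T \<Longrightarrow> \<exists>x. reads x t" by auto
qed

text \<open>Appending letters to \<open>x\<close> commutes with multiplying by \<open>b\<close> on
  the left, which gives \<open>fwd\<close>. Conversely, \<open>b # x\<close> has some value, and
  functionality of \<open>lam\<close> forces it to be \<open>s\<close>.\<close>

lemma left_reads: "reads x t \<Longrightarrow> b \<in> M \<Longrightarrow> reads (b # x) s \<longleftrightarrow> (b, t, s) \<in> set lam"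
proof -
  have fwd: "(b, t, s) \<in> set lam" if "reads (b # x) s" "reads x t" for x t s
    using that
  proof (induction x arbitrary: t s rule: rev_induct)
    case Nil
    then show ?case using left_init by simp
  next
    case (snoc a x)
    from snoc.prems(1) have "reads ((b # x) @ [a]) s" by simp
    then obtain s1 where "reads (b # x) s1" "(s1, a, s) \<in> set \<delta>" unfolding reads_snoc by blast
    moreover obtain t1 where "reads x t1" "(t1, a, t) \<in> set \<delta>" using snoc.prems(2) unfolding reads_snoc by blast
    ultimately show ?case using snoc.IH left_step by blast
  qed
  assume x: "reads x t" and b: "b \<in> M"
  show ?thesis
  proof
    assume l: "(b, t, s) \<in> set lam"
    obtain s' where s': "reads (b # x) s'" using reads_total[of "b # x"] reads_wf[OF x] b by auto
    from fwd[OF this x] left_det l have "s' = s" by blast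
    with s' show "reads (b # x) s" by simp
  qed (use fwd x in blast)
qed

lemma nfas:
  assumes "k \<in> set SS" "st k \<in> Pi\<^sub>E (pnodes P) V" and A: "nfa_of (fst pc) fc k = (q0, Fin, d)"
  shows "(k, e, q0) \<in> set Y" "(k, e, p) \<in> set Y \<Longrightarrow> p = q0"
    "(k, t, p) \<in> set Y \<Longrightarrow> (t, b, t') \<in> set \<delta> \<Longrightarrow> (p, b, q) \<in> set d \<Longrightarrow> (k, t', q) \<in> set Y"
    "(k, t', q) \<in> set Y \<Longrightarrow> (t, b, t') \<in> set \<delta> \<Longrightarrow> \<exists>p. (p, b, q) \<in> set d \<and> (k, t, p) \<in> set Y"
proof -
  note * = certD(3)[unfolded cert_nfas_def paired_quants, rule_format, OF assms(1) assms(2)[folded in_V_iff],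
      unfolded A fst_conv snd_conv]
  show "(k, e, q0) \<in> set Y" using * by blast
  show "(k, e, p) \<in> set Y \<Longrightarrow> p = q0" using * by blast
  show "(k, t, p) \<in> set Y \<Longrightarrow> (t, b, t') \<in> set \<delta> \<Longrightarrow> (p, b, q) \<in> set d \<Longrightarrow> (k, t', q) \<in> set Y"
    using * by blast
  show "(k, t', q) \<in> set Y \<Longrightarrow> (t, b, t') \<in> set \<delta> \<Longrightarrow> \<exists>p. (p, b, q) \<in> set d \<and> (k, t, p) \<in> set Y"
    using * by blast
qed

text \<open>The last letter is an edge of \<open>\<delta>\<close>: the forward clause gives one
  direction, the backward clause along this very edge the other.\<close>

lemma nfa_reads:
  assumes k: "k \<in> set SS" "st k \<in> Pi\<^sub>E (pnodes P) V" "nfa_of (fst pc) fc k = (q0, Fin, d)" and "reads x t"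
  shows "(k, t, p) \<in> set Y \<longleftrightarrow> nfa_path d q0 x p"
  using assms(4)
proof (induction x arbitrary: t p rule: rev_induct)
  case Nil
  then have "t = e" by simp
  moreover have "(k, e, p) \<in> set Y \<longleftrightarrow> p = q0" using nfas(1,2)[OF k] by blast
  ultimately show ?case by auto
next
  case (snoc b x)
  then obtain s where s: "reads x s" "(s, b, t) \<in> set \<delta>" by (auto simp: reads_snoc)
  show ?case using nfas(3,4)[OF k] s(2) snoc.IH[OF s(1)] unfolding nfa_path_append nfa_path_single by blast
qed

lemma base_iff:
  assumes "k \<in> set SS" "reads x t"
  shows "cert_base inp c (k, t) \<longleftrightarrow> st k \<in> Pi\<^sub>E (pnodes P) V \<and> x \<in> Q0 (st k)"
proof (cases "st k \<in> Pi\<^sub>E (pnodes P) V")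
  case True
  obtain q0 Fin d where A: "nfa_of (fst pc) fc k = (q0, Fin, d)" by (metis prod_cases3)
  have "cert_base inp c (k, t) \<longleftrightarrow> (\<exists>f\<in>set Fin. (k, t, f) \<in> set Y)"
    using True unfolding cert_base_def by (auto simp: in_V_iff A)
  also have "\<dots> \<longleftrightarrow> x \<in> Q0 (st k)"
    using nfa_reads[OF assms(1) True A assms(2)] by (simp add: Q0_nfa_of A nfa_lang_def)
  finally show ?thesis using True by simp
next
  case False
  then show ?thesis unfolding cert_base_def by (simp add: in_V_iff)
qed

section \<open>Accepting pairs and the drained family\<close>

abbreviation "G \<equiv> fst ` set F"

lemma in_G_iff: "u \<in> G \<longleftrightarrow> (\<exists>n. (u, n) \<in> set F)"
  by force

lemmas drained = certD(4)[unfolded cert_drain_def paired_quants fst_conv snd_conv]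

lemma drain_base_G: "k \<in> set SS \<Longrightarrow> t \<in> T \<Longrightarrow> cert_base inp c (k, t) \<Longrightarrow> (k, t) \<in> G"
  unfolding in_T_iff in_G_iff using drained by blast

lemma drain_step_G:
  "(k', t') \<in> G \<Longrightarrow> k \<in> set SS \<Longrightarrow> t \<in> T \<Longrightarrow> cert_step inp c (k', t') (k, t) \<Longrightarrow> (k, t) \<in> G"
  unfolding in_T_iff in_G_iff using drained by blast

lemma drain_rank:
  assumes "((k, t), n) \<in> set F"
  shows "k \<in> set SS \<and> t \<in> T \<and> (cert_base inp c (k, t) \<or> (\<exists>k' t' m. ((k', t'), m) \<in> set F \<and> m < n \<and> cert_step inp c (k', t') (k, t)))"
  unfolding in_T_iff using drained assms by blast

abbreviation "D \<equiv> drain P \<beta> V Q0"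

lemma D_lists: "D S \<subseteq> lists M"
  using drain_lists[of Q0 S] Q0_lists unfolding decode_protocol_simps(5) by blast

text \<open>Induction on the rank leads back to a given set. A reception is undone by putting
  \<open>b\<close> back in front of the word, whose value \<open>lam\<close> supplies.\<close>

lemma G_sound: "((k, t), n) \<in> set F \<Longrightarrow> reads x t \<Longrightarrow> x \<in> D (st k)"
proof (induction n arbitrary: k t x rule: less_induct)
  case (less n)
  have k: "k \<in> set SS" using drain_rank[OF less.prems(1)] by blast
  from drain_rank[OF less.prems(1)] consider "cert_base inp c (k, t)"
    | k' t' m where "((k', t'), m) \<in> set F" "m < n" "cert_step inp c (k', t') (k, t)" by blast
  then show ?case
  proof cases
    case 1
    then show ?thesis using base_iff[OF k less.prems(2)] drain_base by blast
  next
    case 2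
    from 2(3) show ?thesis unfolding cert_step_iff
    proof (elim disjE conjE exE)
      fix b q assume b: "(st k' (phead P \<beta>), Rcv b, q) \<in> ptrans P (phead P \<beta>)" "(b, t, t') \<in> set lam"
        "st k = (st k')(phead P \<beta> := q)"
      then have "reads (b # x) t'" using left_reads[OF less.prems(2) left_msg] by blast
      then have "b # x \<in> D (st k')" using less.IH 2 by blast
      moreover have "sync P \<beta> (st k', b # x) (st k, x)"
        unfolding b(3) by (intro sync.deliver recv_msg[OF \<beta> b(1)] b(1))
      ultimately show ?thesis by (rule drain_sync)
    next
      fix \<xi> b p q assume t: "t' = t" and s: "\<xi> \<in> pedges P" "\<xi> \<noteq> \<beta>"
        "(st k' (ptail P \<xi>), Snd b, p) \<in> ptrans P (ptail P \<xi>)"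
        "(st k' (phead P \<xi>), Rcv b, q) \<in> ptrans P (phead P \<xi>)"
        "st k = (st k')(ptail P \<xi> := p, phead P \<xi> := q)"
      have "x \<in> D (st k')" using less.IH 2 less.prems(2) t by blast
      moreover have "sync P \<beta> (st k', x) (st k, x)"
        unfolding s(5) by (intro sync.rendezvous[where b=b] s(1-4) recv_msg[OF s(1,4)])
      ultimately show ?thesis by (rule drain_sync)
    qed
  qed
qed

lemma G_complete:
  assumes "x \<in> D (st k)" "k \<in> set SS" "reads x t" shows "(k, t) \<in> G"
proof -
  obtain S0 x0 where S0: "S0 \<in> Pi\<^sub>E (pnodes P) V" "x0 \<in> Q0 S0" "(sync P \<beta>)\<^sup>*\<^sup>* (S0, x0) (st k, x)"
    using assms(1) unfolding drain_def by blast
  \<comment> \<open>Several codes may stand for one composite state, so the claim covers all of them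
    at each state on the way.\<close>
  have "\<forall>k t. k \<in> set SS \<longrightarrow> st k = S \<longrightarrow> reads x t \<longrightarrow> (k, t) \<in> G"
    if "(sync P \<beta>)\<^sup>*\<^sup>* (S0, x0) (S, x)" for S x
    using that
  proof (induction "(S, x)" arbitrary: S x rule: rtranclp_induct)
    case base
    show ?case
    proof (intro allI impI)
      fix k t assume k: "k \<in> set SS" "st k = S0" and t: "reads x0 t"
      then have "cert_base inp c (k, t)" using S0(1,2) base_iff[OF k(1) t] by simp
      then show "(k, t) \<in> G" using drain_base_G[OF k(1)] reads_wf[OF t] by blast
    qed
  next
    case (step y)
    obtain S1 x1 where y: "y = (S1, x1)" by fastforce
    have reach1: "(sync P \<beta>)\<^sup>*\<^sup>* (S0, x0) (S1, x1)" using step.hyps(1) y by simp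
    have S1: "S1 \<in> comp_states P"
      using steps_comp_states[OF syncs_steps[OF reach1]] S0(1) PiE_V_comp by auto
    have x1: "x1 \<in> lists M"
      using D_lists[of S1] S0(1,2) reach1 unfolding drain_def by blast
    obtain k1 where k1: "k1 \<in> set SS" "st k1 = S1" using states_cover[OF S1] .
    obtain t1 where t1: "reads x1 t1" using reads_total[OF x1] by blast
    have G1: "(k1, t1) \<in> G" using step.hyps(3)[OF y] k1 t1 by blast
    show ?case
    proof (intro allI impI)
      fix k t assume k: "k \<in> set SS" "st k = S" and t: "reads x t"
      from step.hyps(2)[unfolded y] have "cert_step inp c (k1, t1) (k, t)"
      proof cases
        case (deliver b q)
        then have "(b, t, t1) \<in> set lam" using left_reads[OF t] t1 x1 by auto
        with deliver show ?thesis unfolding cert_step_iff k k1 by blast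
      next
        case (rendezvous \<xi> b p q)
        then have "t1 = t" using t t1 reads_det by blast
        with rendezvous show ?thesis unfolding cert_step_iff k k1 by blast
      qed
      with G1 k(1) reads_wf[OF t] show "(k, t) \<in> G" using drain_step_G by blast
    qed
  qed
  with S0(3) assms(2,3) show ?thesis by blast
qed

lemma G_iff:
  assumes "k \<in> set SS" "reads x t" shows "(k, t) \<in> G \<longleftrightarrow> x \<in> D (st k)"
  using G_sound[of k t _ x] G_complete[of x k t] assms by auto

text \<open>Each element is the value of some word, and each word over \<open>M\<close> has a value.
  Conditions on words in the drained family and conditions on accepting pairs therefore translate
  into each other.\<close>

lemma extension_iff_ok: "(\<exists>Q. is_extension P \<beta> V Q0 Q) \<longleftrightarrow> cert_ok inp c"
proof -
  have "(\<forall>S\<in>Pi\<^sub>E (pnodes P) V. D S \<subseteq> Q0 S) \<longleftrightarrow> (\<forall>(u, n)\<in>set F. in_V (fst pc) vs (fst u) \<longrightarrow> cert_base inp c u)"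
    (is "?A \<longleftrightarrow> ?A'")
  proof
    assume A: ?A
    have "cert_base inp c (k, t)" if F: "((k, t), n) \<in> set F" and "in_V (fst pc) vs k" for k t n
    proof -
      have k: "k \<in> set SS" and "t \<in> T" using drain_rank[OF F] by auto
      then obtain x where x: "reads x t" using reads_onto by blast
      with F have "x \<in> D (st k)" by (rule G_sound)
      with A that(2) show ?thesis unfolding in_V_iff base_iff[OF k x] by blast
    qed
    then show ?A' by auto
  next
    assume A': ?A'
    show ?A
    proof (intro ballI subsetI)
      fix S x assume S: "S \<in> Pi\<^sub>E (pnodes P) V" and x: "x \<in> D S"
      obtain k where k: "k \<in> set SS" "st k = S" using states_cover S PiE_V_comp by blast
      obtain t where t: "reads x t"
        using reads_total[of x] x D_lists[of S] by blast
      then have "(k, t) \<in> G" using G_iff[OF k(1) t] x k(2) by simp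
      then have "cert_base inp c (k, t)" using A' S k(2) in_V_iff[of k] by force
      then show "x \<in> Q0 S" using base_iff[OF k(1) t] k(2) by simp
    qed
  qed
  moreover have "(\<forall>S\<in>comp_states P. \<forall>x\<in>D S. \<forall>S' x'. emit P \<beta> (S, x) (S', x') \<longrightarrow> x' \<in> D S') \<longleftrightarrow>
    (\<forall>(u, n)\<in>set F. (\<forall>(p, snt, b, q)\<in>set (trans_of pc (tail_of pc \<beta>)). snt \<and> p = lookup (fst u) (tail_of pc \<beta>) \<longrightarrow>
         (\<forall>k\<in>set SS. (\<forall>i\<in>N. lookup k i = (if i = tail_of pc \<beta> then q else lookup (fst u) i)) \<longrightarrow>
           (\<forall>(t, b', t')\<in>set \<delta>. t = snd u \<and> b' = b \<longrightarrow> (\<exists>(v, m)\<in>set F. v = (k, t'))))))"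
    (is "?B \<longleftrightarrow> ?B'")
  proof -
    let ?tl = "ptail P \<beta>"
    have tl: "?tl \<in> N" using edge_nodes(1)[OF \<beta>] by (simp add: decode_protocol_simps(1))
    \<comment> \<open>\<open>?B''\<close> speaks of decoded states and accepting pairs. It separates
      the two translations: list codes are resolved here, words are brought in by the second
      equivalence.\<close>
    have "?B' \<longleftrightarrow> (\<forall>k t b q k' t'. (k, t) \<in> G \<longrightarrow> (st k ?tl, Snd b, q) \<in> ptrans P ?tl \<longrightarrow> k' \<in> set SS \<longrightarrow>
        st k' = (st k)(?tl := q) \<longrightarrow> (t, b, t') \<in> set \<delta> \<longrightarrow> (k', t') \<in> G)" (is "_ \<longleftrightarrow> ?B''")
    proof
      assume B': ?B'
      show ?B''
      proof (intro allI impI)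
        fix k t b q k' t'
        assume h: "(k, t) \<in> G" "(st k ?tl, Snd b, q) \<in> ptrans P ?tl" "k' \<in> set SS"
          "st k' = (st k)(?tl := q)" "(t, b, t') \<in> set \<delta>"
        obtain n where n: "((k, t), n) \<in> set F" using h(1) by auto
        have tr: "(lookup k ?tl, True, b, q) \<in> set (trans_of pc ?tl)"
          using h(2) tl by (simp add: decode_protocol_simps(7) decode_state_lookup)
        from bspec[OF B' n, unfolded prod.case fst_conv snd_conv] have "\<forall>(p, snt, b, q)\<in>set (trans_of pc ?tl). snt \<and> p = lookup k ?tl \<longrightarrow>
         (\<forall>k'\<in>set SS. (\<forall>i\<in>N. lookup k' i = (if i = ?tl then q else lookup k i)) \<longrightarrow>
           (\<forall>(t1, b', t')\<in>set \<delta>. t1 = t \<and> b' = b \<longrightarrow> (\<exists>(v, m)\<in>set F. v = (k', t'))))"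
          unfolding decode_protocol_simps(3) .
        from bspec[OF this tr, unfolded prod.case] have "\<forall>k'\<in>set SS. st k' = (st k)(?tl := q) \<longrightarrow>
           (\<forall>(t1, b', t')\<in>set \<delta>. t1 = t \<and> b' = b \<longrightarrow> (\<exists>(v, m)\<in>set F. v = (k', t')))"
          unfolding update_iff[OF tl] by simp
        with h(3,4) have "\<forall>(t1, b', t')\<in>set \<delta>. t1 = t \<and> b' = b \<longrightarrow> (\<exists>(v, m)\<in>set F. v = (k', t'))" by blast
        from bspec[OF this h(5)] show "(k', t') \<in> G" by force
      qed
    next
      assume B'': ?B''
      have key: "\<exists>m. ((k', t'), m) \<in> set F" if "((k, t), n) \<in> set F" "(lookup k ?tl, True, b, q) \<in> set (trans_of pc ?tl)"
        "k' \<in> set SS" "\<forall>i\<in>N. lookup k' i = (if i = ?tl then q else lookup k i)" "(t, b, t') \<in> set \<delta>" for k t n b q k' t'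
      proof -
        have "(k, t) \<in> G" using that(1) by force
        moreover have "(st k ?tl, Snd b, q) \<in> ptrans P ?tl"
          using that(2) tl by (simp add: decode_protocol_simps(7) decode_state_lookup)
        ultimately have "(k', t') \<in> G" using B'' that(3,4,5) unfolding update_iff[OF tl] by blast
        then show ?thesis by auto
      qed
      show ?B' unfolding paired_quants fst_conv snd_conv
      proof (intro allI impI, elim conjE)
        fix k t n p snt b q k' t1 b' t'
        assume h: "((k, t), n) \<in> set F" "(p, snt, b, q) \<in> set (trans_of pc (tail_of pc \<beta>))" "k' \<in> set SS"
          "\<forall>i. i \<in> N \<longrightarrow> lookup k' i = (if i = tail_of pc \<beta> then q else lookup k i)"
          "(t1, b', t') \<in> set \<delta>" "snt" "p = lookup k (tail_of pc \<beta>)" "t1 = t" "b' = b"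
        then show "\<exists>k1 t1 m. ((k1, t1), m) \<in> set F \<and> (k1, t1) = (k', t')"
          using key[of k t n b q k' t'] by (simp add: decode_protocol_simps(3))
      qed
    qed
    also have "\<dots> \<longleftrightarrow> ?B"
    proof
      assume B'': ?B''
      show ?B
      proof (intro ballI allI impI)
        fix S x S' x' assume S: "S \<in> comp_states P" and x: "x \<in> D S" and em: "emit P \<beta> (S, x) (S', x')"
        from em show "x' \<in> D S'"
        proof cases
          case (1 b q)
          obtain k where k: "k \<in> set SS" "st k = S" using states_cover[OF S] .
          have "S' \<in> comp_states P" unfolding 1 using comp_upd[OF S edge_nodes(1)[OF \<beta>]] 1 by blast
          then obtain k' where k': "k' \<in> set SS" "st k' = S'" by (rule states_cover)
          obtain t where t: "reads x t"
            using reads_total[of x] x D_lists[of S] by blast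
          have "b \<in> M" using 1 by (simp add: decode_protocol_simps)
          then obtain t' where t': "(t, b, t') \<in> set \<delta>" using right_total reads_wf[OF t] by blast
          have "(k, t) \<in> G" using G_iff[OF k(1) t] x k(2) by simp
          then have "(k', t') \<in> G" using B'' 1 k k' t' by blast
          moreover have "reads x' t'" using t t' 1 by (auto simp: reads_snoc)
          ultimately show ?thesis using G_iff[OF k'(1)] k'(2) by blast
        qed
      qed
    next
      assume B: ?B
      show ?B''
      proof (intro allI impI)
        fix k t b q k' t'
        assume h: "(k, t) \<in> G" "(st k ?tl, Snd b, q) \<in> ptrans P ?tl" "k' \<in> set SS"
          "st k' = (st k)(?tl := q)" "(t, b, t') \<in> set \<delta>"
        obtain n where "((k, t), n) \<in> set F" using h(1) by auto
        from drain_rank[OF this] have k: "k \<in> set SS" "t \<in> T" by auto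
        obtain x where x: "reads x t" using reads_onto[OF k(2)] by blast
        have "x \<in> D (st k)" using G_iff[OF k(1) x] h(1) by simp
        moreover have "emit P \<beta> (st k, x) (st k', x @ [b])"
          unfolding h(4) using h(2) send_msg[OF \<beta> h(2)] by (rule emit.intros[rotated])
        ultimately have "x @ [b] \<in> D (st k')" using B states_wf[OF k(1)] by blast
        moreover have "reads (x @ [b]) t'" using x h(5) by (auto simp: reads_snoc)
        ultimately show "(k', t') \<in> G" using G_iff[OF h(3)] by blast
      qed
    qed
    finally show ?thesis by (rule sym)
  qed
  moreover have ok: "cert_ok inp c \<longleftrightarrow> ?A' \<and> ?B'"
    unfolding cert_ok_def case_prod_unfold fst_conv snd_conv ball_conj_distrib ..
  moreover have "(\<exists>Q. is_extension P \<beta> V Q0 Q) \<longleftrightarrow> ?A \<and> ?B"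
    by (rule extension_iff) (rule Q0_lists)
  ultimately show ?thesis by (simp only:)
qed

lemma out_correct:
  shows "covers N out (comp_states P)" "S \<in> comp_states P \<Longrightarrow> decode_family N out S = D S"
proof -
  have ex: "\<exists>A. (k, A) \<in> set out" if "k \<in> set SS" for k
    using certD(5)[unfolded cert_out_def paired_quants] that by blast
  have o: "k \<in> set SS \<and> e' = e \<and> \<delta>' = \<delta> \<and> (\<forall>t. t \<in> set Fs \<longleftrightarrow> (k, t) \<in> G)"
    if "(k, e', Fs, \<delta>') \<in> set out" for k e' Fs \<delta>'
    using certD(5)[unfolded cert_out_def paired_quants fst_conv snd_conv] that unfolding in_G_iff by blast
  show "covers N out (comp_states P)"
    unfolding covers_def using states_cover ex by (metis fst_conv)
  assume S: "S \<in> comp_states P"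
  obtain k where k: "k \<in> set SS" "st k = S" using states_cover[OF S] .
  \<comment> \<open>\<open>find\<close> may stop at an entry with another code \<open>k'\<close> of
    the same state; the final elements are evaluated for \<open>k'\<close>, and \<open>G_iff\<close>
    yields the same set.\<close>
  have "find (\<lambda>d. st (fst d) = S) out \<noteq> None"
    using ex[OF k(1)] k(2) unfolding find_None_iff by force
  then obtain k' e' Fs \<delta>' where fd: "find (\<lambda>d. st (fst d) = S) out = Some (k', e', Fs, \<delta>')" by auto
  then obtain i where "i < length out" "st (fst (out ! i)) = S" "out ! i = (k', e', Fs, \<delta>')"
    unfolding find_Some_iff by metis
  then have "(k', e', Fs, \<delta>') \<in> set out" "st k' = S" by (metis nth_mem, simp)
  with o[of k' e' Fs \<delta>'] have k': "k' \<in> set SS" "e' = e" "\<delta>' = \<delta>" "\<And>t. t \<in> set Fs \<longleftrightarrow> (k', t) \<in> G" by auto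
  have "x \<in> nfa_lang (e', Fs, \<delta>') \<longleftrightarrow> x \<in> D S" for x
  proof (cases "x \<in> lists M")
    case True
    then obtain t where t: "reads x t" using reads_total by blast
    have "x \<in> nfa_lang (e', Fs, \<delta>') \<longleftrightarrow> (\<exists>f\<in>set Fs. reads x f)" by (simp add: nfa_lang_def k'(2,3))
    also have "\<dots> \<longleftrightarrow> (k', t) \<in> G" unfolding k'(4)[symmetric] using t reads_det by blast
    finally show ?thesis using G_iff[OF k'(1) t] \<open>st k' = S\<close> by simp
  next
    case False
    then show ?thesis using reads_wf D_lists[of S] k'
      by (auto simp: nfa_lang_def)
  qed
  then show "decode_family N out S = D S" unfolding decode_family_def fd by auto
qed

end

section \<open>Existence of certificates\<close>

text \<open>The rank of an element is the first round in which it is reached from \<open>B\<close>.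
  A predecessor taken from the round before has a smaller rank. Monoid elements and accepting pairs
  both get their ranks from here.\<close>

lemma ranked_closure:
  assumes "finite U" "B \<subseteq> U"
  obtains F :: "('u \<times> nat) list" where "B \<subseteq> fst ` set F" "fst ` set F \<subseteq> U"
    "\<forall>u\<in>fst ` set F. \<forall>u'\<in>U. R u u' \<longrightarrow> u' \<in> fst ` set F"
    "\<forall>u n. (u, n) \<in> set F \<longrightarrow> u \<in> B \<or> (\<exists>v m. (v, m) \<in> set F \<and> m < n \<and> R v u)"
proof -
  define L where "L n = ((\<lambda>A. {u'\<in>U. \<exists>u\<in>A. R u u'}) ^^ n) B" for n
  have L0: "L 0 = B" and LS: "L (Suc n) = {u'\<in>U. \<exists>u\<in>L n. R u u'}" for n
    by (simp_all add: L_def)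
  define rank where "rank u = (LEAST n. u \<in> L n)" for u
  have LU: "L n \<subseteq> U" for n using assms(2) by (cases n) (auto simp: L0 LS)
  then have "(\<Union>n. L n) \<subseteq> U" by blast
  then have "finite (\<Union>n. L n)" using assms(1) by (rule finite_subset)
  then have "finite ((\<lambda>u. (u, rank u)) ` (\<Union>n. L n))" by (rule finite_imageI)
  from finite_list[OF this] obtain F where F: "set F = (\<lambda>u. (u, rank u)) ` (\<Union>n. L n)" by blast
  have fF: "fst ` set F = (\<Union>n. L n)" unfolding F by (simp add: image_image)
  have "u' \<in> fst ` set F" if h: "u \<in> fst ` set F" "u' \<in> U" "R u u'" for u u'
  proof -
    obtain n where "u \<in> L n" using h(1) unfolding fF by blast
    then have "u' \<in> L (Suc n)" unfolding LS using h(2,3) by blast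
    then show ?thesis unfolding fF by blast
  qed
  moreover have "u \<in> B \<or> (\<exists>v m. (v, m) \<in> set F \<and> m < n \<and> R v u)" if un: "(u, n) \<in> set F" for u n
  proof -
    have n: "n = rank u" and ex: "\<exists>n. u \<in> L n" using un unfolding F by auto
    have u: "u \<in> L n" unfolding n rank_def using ex by (rule LeastI_ex)
    show ?thesis
    proof (cases n)
      case 0
      then show ?thesis using u L0 by simp
    next
      case (Suc m)
      then obtain v where v: "v \<in> L m" "R v u" using u LS by auto
      have "rank v \<le> m" unfolding rank_def using v(1) by (rule Least_le)
      then have "rank v < n" using Suc by simp
      moreover have "(v, rank v) \<in> set F" unfolding F using v(1) by blast
      ultimately show ?thesis using v(2) by blast
    qed
  qed
  moreover have "B \<subseteq> fst ` set F" "fst ` set F \<subseteq> U" unfolding fF using LU L0 by blast+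
  ultimately show ?thesis by (intro that[of F]) simp_all
qed

section \<open>The transition monoid of the given automata\<close>

definition nfa_states :: "nat nfa \<Rightarrow> nat set" where
  "nfa_states A = insert (fst A) ((\<lambda>(p, a, q). q) ` set (snd (snd A)))"

text \<open>The action of \<open>x\<close> on the disjoint union of the automata in
  \<open>As\<close>, an element of its transition monoid. Confining \<open>p\<close> to
  \<open>nfa_states\<close> keeps the monoid finite.\<close>

definition nfa_relation :: "nat nfa set \<Rightarrow> nat list \<Rightarrow> (nat nfa \<times> nat \<times> nat) set" where
  "nfa_relation As x = {(A, p, q). A \<in> As \<and> p \<in> nfa_states A \<and> nfa_path (snd (snd A)) p x q}"

lemma nfa_path_states: "nfa_path (snd (snd A)) p x q \<Longrightarrow> p \<in> nfa_states A \<Longrightarrow> q \<in> nfa_states A"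
proof (induction x arbitrary: q rule: rev_induct)
  case (snoc a x)
  then obtain r where "(r, a, q) \<in> set (snd (snd A))" by (auto simp: nfa_path_append)
  then show ?case by (force simp: nfa_states_def)
qed simp

lemma nfa_relation_append:
  "(A, p, q) \<in> nfa_relation As (x @ y) \<longleftrightarrow>
     (\<exists>r. (A, p, r) \<in> nfa_relation As x \<and> (A, r, q) \<in> nfa_relation As y)"
  by (auto simp: nfa_relation_def nfa_path_append dest: nfa_path_states)

text \<open>Equality of relations is a two-sided congruence on words, so both multiplications are
  well defined on classes.\<close>

lemma nfa_relation_cong:
  assumes "nfa_relation As x = nfa_relation As x'" "nfa_relation As y = nfa_relation As y'"
  shows "nfa_relation As (x @ y) = nfa_relation As (x' @ y')"
  by (rule set_eqI) (clarsimp simp: nfa_relation_append assms)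

lemma finite_nfa_relations:
  assumes "finite As" shows "finite (range (nfa_relation As))"
proof -
  have "nfa_relation As x \<subseteq> (SIGMA A:As. nfa_states A \<times> nfa_states A)" for x
    by (auto simp: nfa_relation_def dest: nfa_path_states)
  moreover have "finite (SIGMA A:As. nfa_states A \<times> nfa_states A)"
    using assms by (auto simp: nfa_states_def)
  ultimately show ?thesis 
    by (intro finite_subset[of "range (nfa_relation As)" "Pow (SIGMA A:As. nfa_states A \<times> nfa_states A)"]) auto
qed

section \<open>Construction of a certificate\<close>

context valid_input
begin

definition code_state :: "(nat \<Rightarrow> nat) \<Rightarrow> (nat \<times> nat) list" where
  "code_state S = map (\<lambda>j. (j, S j)) (fst pc)"

lemma lookup_code_state: "j \<in> N \<Longrightarrow> lookup (code_state S) j = S j"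
  by (simp add: lookup_def code_state_def map_of_map_restrict)

lemma finite_comp_states: "finite (comp_states P)"
  using wf unfolding comp_states_def wf_protocol_def by (intro finite_PiE) auto

theorem cert_exists: "\<exists>c. cert (pc, \<beta>, vs, fc) c"
proof -
  obtain SS where SS: "set SS = code_state ` comp_states P"
    using finite_list[OF finite_imageI[OF finite_comp_states, of code_state]] by blast
  have states: "cert_states (pc, \<beta>, vs, fc) (out, SS, Ts, e, \<delta>, lam, Y, F)" for out Ts e \<delta> lam Y F
    unfolding cert_states_def prod.case
  proof (intro conjI ballI impI)
    have "restrict (pinit P) (pnodes P) \<in> comp_states P"
      using wf unfolding wf_protocol_def comp_states_def by auto
    then have "set SS \<noteq> {}" unfolding SS by blast
    then show "SS \<noteq> []" by auto
  next
    fix k j assume "k \<in> set SS" and j: "j \<in> N"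
    then obtain S where S: "S \<in> comp_states P" "k = code_state S" unfolding SS by blast
    show "lookup k j \<in> set (states_of pc j)"
      using S j by (auto simp: lookup_code_state comp_states_def decode_protocol_simps)
    fix q assume q: "q \<in> set (states_of pc j)"
    have "S(j := q) \<in> comp_states P"
      using S(1) q j unfolding comp_states_def
      by (auto simp: PiE_iff extensional_def decode_protocol_simps)
    then show "\<exists>k'\<in>set SS. \<forall>i\<in>N. lookup k' i = (if i = j then q else lookup k i)"
      unfolding SS S(2) by (intro bexI[of _ "code_state (S(j := q))"]) (auto simp: lookup_code_state)
  qed

  \<comment> \<open>The default automaton of \<open>nfa_of\<close> is included, so that every
    \<open>A k\<close> lies in \<open>As\<close>, also where no entry is found.\<close>
  define As where "As = insert (0, [], []) (snd ` set fc)"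
  define A where "A k = nfa_of (fst pc) fc k" for k
  have "snd d \<in> As" if "find p fc = Some d" for p d
  proof -
    have "d \<in> set fc" using that unfolding find_Some_iff by (metis nth_mem)
    then show ?thesis by (simp add: As_def)
  qed
  then have A: "A k \<in> As" for k
    unfolding A_def nfa_of_def by (auto simp: As_def split: option.split)
  have "finite As" by (simp add: As_def)
  then have fin: "finite (nfa_relation As ` lists M)"
    by (rule finite_subset[OF image_mono[OF subset_UNIV] finite_nfa_relations])
  \<comment> \<open>Certificates contain only numbers, so the finitely many relations are
    numbered.\<close>
  then obtain g :: "_ \<Rightarrow> nat" where g: "inj_on g (nfa_relation As ` lists M)"
    using finite_imp_inj_to_nat_seg[OF fin] by blast
  define \<rho> where "\<rho> x = g (nfa_relation As x)" for x
  have rho_iff: "\<rho> x = \<rho> y \<longleftrightarrow> nfa_relation As x = nfa_relation As y" if "x \<in> lists M" "y \<in> lists M" for x y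
    using g that unfolding \<rho>_def by (auto dest: inj_onD)
  have rho_app: "\<rho> (x @ z) = \<rho> (y @ z)" if "\<rho> x = \<rho> y" "x \<in> lists M" "y \<in> lists M" "z \<in> lists M" for x y z
    using that nfa_relation_cong[of As x y z z] by (simp add: rho_iff)
  have rho_Cons: "\<rho> (b # x) = \<rho> (b # y)" if "\<rho> x = \<rho> y" "x \<in> lists M" "y \<in> lists M" "b \<in> M" for b x y
    using that nfa_relation_cong[of As "[b]" "[b]" x y] by (simp add: rho_iff)
  have rho_path: "nfa_path (snd (snd (A k))) (fst (A k)) x p \<longleftrightarrow> nfa_path (snd (snd (A k))) (fst (A k)) y p"
    if "\<rho> x = \<rho> y" "x \<in> lists M" "y \<in> lists M" for x y p k
  proof -
    have "(A k, fst (A k), p) \<in> nfa_relation As x \<longleftrightarrow> (A k, fst (A k), p) \<in> nfa_relation As y"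
      using that by (simp add: rho_iff)
    then show ?thesis using A by (simp add: nfa_relation_def nfa_states_def)
  qed
  define T where "T = \<rho> ` lists M"
  have finT: "finite T" using fin by (simp add: T_def \<rho>_def image_image[symmetric])
  have TI: "\<rho> x \<in> T" if "x \<in> lists M" for x using that unfolding T_def by (rule imageI)
  have "finite {(\<rho> x, b, \<rho> (x @ [b])) | x b. x \<in> lists M \<and> b \<in> M}"
    by (rule finite_subset[of _ "T \<times> M \<times> T"]) (auto simp: finT intro!: TI)
  from finite_list[OF this] obtain \<delta> where \<delta>: "set \<delta> = {(\<rho> x, b, \<rho> (x @ [b])) | x b. x \<in> lists M \<and> b \<in> M}"
    by blast
  have "finite {(b, \<rho> x, \<rho> (b # x)) | x b. x \<in> lists M \<and> b \<in> M}"
    by (rule finite_subset[of _ "M \<times> T \<times> T"]) (auto simp: finT intro!: TI)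
  from finite_list[OF this] obtain lam where lam: "set lam = {(b, \<rho> x, \<rho> (b # x)) | x b. x \<in> lists M \<and> b \<in> M}"
    by blast
  have "finite {(k, \<rho> x, p) | k x p. k \<in> set SS \<and> x \<in> lists M \<and> nfa_path (snd (snd (A k))) (fst (A k)) x p}"
  proof (rule finite_subset)
    show "{(k, \<rho> x, p) | k x p. k \<in> set SS \<and> x \<in> lists M \<and> nfa_path (snd (snd (A k))) (fst (A k)) x p}
        \<subseteq> (SIGMA k:set SS. T \<times> nfa_states (A k))"
      using nfa_path_states[of "A _" "fst (A _)"] by (auto intro!: TI) (simp add: nfa_states_def)
    show "finite (SIGMA k:set SS. T \<times> nfa_states (A k))" using finT by (auto simp: nfa_states_def)
  qed
  from finite_list[OF this] obtain Y where Y: "set Y =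
      {(k, \<rho> x, p) | k x p. k \<in> set SS \<and> x \<in> lists M \<and> nfa_path (snd (snd (A k))) (fst (A k)) x p}"
    by blast
  have Y_iff: "(k, \<rho> x, p) \<in> set Y \<longleftrightarrow> nfa_path (snd (snd (A k))) (fst (A k)) x p"
    if "k \<in> set SS" "x \<in> lists M" for k x p
    unfolding Y using that rho_path[of x _ k p] by blast
  define e where "e = \<rho> []"
  have \<delta>I: "(\<rho> x, b, \<rho> (x @ [b])) \<in> set \<delta>" if "x \<in> lists M" "b \<in> M" for x b
    unfolding \<delta> using that by blast
  have \<delta>E: "b \<in> M \<and> (\<exists>x\<in>lists M. t = \<rho> x \<and> t' = \<rho> (x @ [b]))" if "(t, b, t') \<in> set \<delta>" for t b t'
    using that unfolding \<delta> by blast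
  have \<delta>D: "t' = \<rho> (x @ [b])" if h: "(\<rho> x, b, t') \<in> set \<delta>" "x \<in> lists M" for x b t'
  proof -
    obtain y where y: "y \<in> lists M" "\<rho> x = \<rho> y" "t' = \<rho> (y @ [b])" "b \<in> M" using \<delta>E[OF h(1)] by blast
    then show ?thesis using rho_app[OF y(2) h(2) y(1), of "[b]"] by simp
  qed
  have lamI: "(b, \<rho> x, \<rho> (b # x)) \<in> set lam" if "x \<in> lists M" "b \<in> M" for x b
    unfolding lam using that by blast
  have lamE: "b \<in> M \<and> (\<exists>x\<in>lists M. t = \<rho> x \<and> s = \<rho> (b # x))" if "(b, t, s) \<in> set lam" for b t s
    using that unfolding lam by blast
  have "{e} \<subseteq> T" using TI[of "[]"] by (simp add: e_def)
  then obtain Ts :: "(nat \<times> nat) list" where Ts: "{e} \<subseteq> fst ` set Ts" "fst ` set Ts \<subseteq> T"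
    "\<forall>t\<in>fst ` set Ts. \<forall>t'\<in>T. (\<exists>b. (t, b, t') \<in> set \<delta>) \<longrightarrow> t' \<in> fst ` set Ts"
    "\<forall>t n. (t, n) \<in> set Ts \<longrightarrow> t \<in> {e} \<or> (\<exists>u m. (u, m) \<in> set Ts \<and> m < n \<and> (\<exists>b. (u, b, t) \<in> set \<delta>))"
    by (rule ranked_closure[OF finT, where R="\<lambda>t t'. \<exists>b. (t, b, t') \<in> set \<delta>"])
  \<comment> \<open>Every word arises from the empty one letter by letter along
    \<open>\<delta>\<close>, so the closure of \<open>e\<close> exhausts all values.\<close>
  have rho_Ts: "\<rho> x \<in> fst ` set Ts" if "x \<in> lists M" for x
    using that
  proof (induction x rule: rev_induct)
    case Nil
    then show ?case using Ts(1) by (simp add: e_def)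
  next
    case (snoc b x)
    then have "\<rho> (x @ [b]) \<in> T" using TI by blast
    moreover have "(\<rho> x, b, \<rho> (x @ [b])) \<in> set \<delta>" using \<delta>I[of x b] snoc.prems by simp
    moreover have "\<rho> x \<in> fst ` set Ts" using snoc by simp
    ultimately show ?case using Ts(3) by blast
  qed
  have Ts_E: "\<exists>x\<in>lists M. t = \<rho> x" if "(t, n) \<in> set Ts" for t n
  proof -
    have "t \<in> T" using Ts(2) imageI[OF that, of fst] by auto
    then show ?thesis unfolding T_def by blast
  qed
  have right: "cert_right (pc, \<beta>, vs, fc) (out, SS, Ts, e, \<delta>, lam, Y, F)" for out F
    unfolding cert_right_def paired_quants
  proof (intro conjI allI impI)
    show "\<exists>t n. (t, n) \<in> set Ts \<and> t = e" using Ts(1) by force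
  next
    fix t n b assume "(t, n) \<in> set Ts" "b \<in> M"
    then show "\<exists>t1 b1 t2. (t1, b1, t2) \<in> set \<delta> \<and> t1 = t \<and> b1 = b" using Ts_E \<delta>I by blast
  next
    fix t b t' assume h: "(t, b, t') \<in> set \<delta>"
    show "b \<in> M" using \<delta>E[OF h] by blast
    obtain x where x: "x \<in> lists M" "t = \<rho> x" "t' = \<rho> (x @ [b])" "b \<in> M" using \<delta>E[OF h] by blast
    then have "t' \<in> fst ` set Ts" using rho_Ts[of "x @ [b]"] by simp
    then show "\<exists>u n. (u, n) \<in> set Ts \<and> u = t'" by force
    fix t1 b1 t2 assume "(t1, b1, t2) \<in> set \<delta>" "t1 = t \<and> b1 = b"
    then show "t2 = t'" using \<delta>D[of x b t2] x by simp
  next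
    fix t n assume "(t, n) \<in> set Ts"
    then have "t = e \<or> (\<exists>u m b. (u, m) \<in> set Ts \<and> m < n \<and> (u, b, t) \<in> set \<delta>)"
      using Ts(4)[rule_format, of t n] by simp
    then show "t = e \<or> (\<exists>t1 b t2. (t1, b, t2) \<in> set \<delta> \<and> (\<exists>u m. (u, m) \<in> set Ts \<and> t2 = t \<and> u = t1 \<and> m < n))"
      by (elim disjE exE conjE) auto
  qed
  have left: "cert_left (pc, \<beta>, vs, fc) (out, SS, Ts, e, \<delta>, lam, Y, F)" for out F
    unfolding cert_left_def paired_quants
  proof (intro conjI allI impI)
    fix t b t' assume h: "(t, b, t') \<in> set \<delta>" "t = e"
    then have "t' = \<rho> ([] @ [b])" by (intro \<delta>D) (auto simp: e_def)
    then show "(b, e, t') \<in> set lam" using lamI[of "[]" b] \<delta>E[OF h(1)] by (simp add: e_def)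
  next
    fix b t s assume h: "(b, t, s) \<in> set lam"
    then obtain x where x: "b \<in> M" "x \<in> lists M" "t = \<rho> x" "s = \<rho> (b # x)" using lamE by blast
    show "b \<in> M" by (rule x(1))
    show "(b, t2, s2) \<in> set lam"
      if "(t1, a, t2) \<in> set \<delta>" "(s1, a', s2) \<in> set \<delta>" "t1 = t \<and> s1 = s \<and> a = a'" for t1 a t2 s1 a' s2
    proof -
      have "a \<in> M" using \<delta>E[OF that(1)] by blast
      moreover have "t2 = \<rho> (x @ [a])" using \<delta>D[of x a t2] that x by simp
      moreover have "s2 = \<rho> ((b # x) @ [a])" using \<delta>D[of "b # x" a s2] that x by simp
      ultimately show ?thesis using lamI[of "x @ [a]" b] x by simp
    qed
    show "s' = s" if h': "(b', t', s') \<in> set lam" "b' = b \<and> t' = t" for b' t' s'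
    proof -
      obtain y where y: "y \<in> lists M" "t' = \<rho> y" "s' = \<rho> (b' # y)" using lamE[OF h'(1)] by blast
      then have "\<rho> y = \<rho> x" using h'(2) x(3) by simp
      then show ?thesis using rho_Cons[of y x b] x y h'(2) by simp
    qed
  qed
  have nfas: "cert_nfas (pc, \<beta>, vs, fc) (out, SS, Ts, e, \<delta>, lam, Y, F)" for out F
    unfolding cert_nfas_def paired_quants A_def[symmetric]
  proof (intro allI impI conjI)
    fix k assume k: "k \<in> set SS"
    show "(k, e, fst (A k)) \<in> set Y" unfolding e_def using Y_iff[OF k, of "[]"] by simp
    fix k1 t p assume k1: "(k1, t, p) \<in> set Y" "k1 = k"
    show "p = fst (A k)" if "t = e" using Y_iff[OF k, of "[]"] k1 that unfolding e_def by simp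
    fix t1 b t2 assume d: "(t1, b, t2) \<in> set \<delta>"
    obtain x where x: "x \<in> lists M" "b \<in> M" "t1 = \<rho> x" "t2 = \<rho> (x @ [b])" using \<delta>E[OF d] by blast
    show "(k, t2, q) \<in> set Y" if "t1 = t" "(p1, a, q) \<in> set (snd (snd (A k)))" "p1 = p \<and> a = b" for p1 a q
      using k1 that x Y_iff[OF k, of x p] Y_iff[OF k, of "x @ [b]" q] by (auto simp: nfa_path_append)
    show "\<exists>q a p1. (q, a, p1) \<in> set (snd (snd (A k))) \<and> p1 = p \<and> a = b \<and> (k, t1, q) \<in> set Y" if "t2 = t"
      using k1 that x Y_iff[OF k, of x] Y_iff[OF k, of "x @ [b]" p] by (auto simp: nfa_path_append)
  qed
  \<comment> \<open>\<open>F\<close> is to be closed under rules that take a whole certificate as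
    argument. \<open>c0\<close> stands in with empty components until \<open>F\<close> and
    \<open>out\<close> exist; \<open>base0\<close> and \<open>step0\<close> justify this.\<close>
  define c0 where "c0 = ([] :: family_code, SS, Ts, e, \<delta>, lam, Y, [] :: (((nat \<times> nat) list \<times> nat) \<times> nat) list)"
  have base0: "cert_base (pc, \<beta>, vs, fc) (out, SS, Ts, e, \<delta>, lam, Y, F) = cert_base (pc, \<beta>, vs, fc) c0" for out F
    by (simp add: cert_base_def c0_def fun_eq_iff)
  have step0: "cert_step (pc, \<beta>, vs, fc) (out, SS, Ts, e, \<delta>, lam, Y, F) = cert_step (pc, \<beta>, vs, fc) c0" for out F
    by (simp add: cert_step_def c0_def fun_eq_iff)
  define U where "U = set SS \<times> fst ` set Ts"
  define B where "B = {u \<in> U. cert_base (pc, \<beta>, vs, fc) c0 u}"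
  have "finite U" "B \<subseteq> U" by (auto simp: U_def B_def)
  then obtain F :: "(((nat \<times> nat) list \<times> nat) \<times> nat) list" where F: "B \<subseteq> fst ` set F" "fst ` set F \<subseteq> U"
    "\<forall>u\<in>fst ` set F. \<forall>u'\<in>U. cert_step (pc, \<beta>, vs, fc) c0 u u' \<longrightarrow> u' \<in> fst ` set F"
    "\<forall>u n. (u, n) \<in> set F \<longrightarrow> u \<in> B \<or> (\<exists>v m. (v, m) \<in> set F \<and> m < n \<and> cert_step (pc, \<beta>, vs, fc) c0 v u)"
    by (rule ranked_closure[where R="cert_step (pc, \<beta>, vs, fc) c0"])
  have F_iff: "(\<exists>(v, m)\<in>set F. v = u) \<longleftrightarrow> u \<in> fst ` set F" for u by force
  have drained: "cert_drain (pc, \<beta>, vs, fc) (out, SS, Ts, e, \<delta>, lam, Y, F)" for out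
    unfolding cert_drain_def prod.case base0 step0 F_iff
  proof (intro conjI ballI)
    fix k tn assume "k \<in> set SS" "tn \<in> set Ts"
    then have u: "(k, fst tn) \<in> U" by (simp add: U_def)
    have "(k, fst tn) \<in> fst ` set F" if "un \<in> set F" "cert_step (pc, \<beta>, vs, fc) c0 (fst un) (k, fst tn)" for un
      using F(3) u that by (meson imageI)
    moreover have "(k, fst tn) \<in> fst ` set F" if "cert_base (pc, \<beta>, vs, fc) c0 (k, fst tn)"
      using F(1) u that unfolding B_def by blast
    ultimately show "case tn of (t, n) \<Rightarrow>
        (cert_base (pc, \<beta>, vs, fc) c0 (k, t) \<longrightarrow> (k, t) \<in> fst ` set F)
      \<and> (\<forall>(u, n)\<in>set F. cert_step (pc, \<beta>, vs, fc) c0 u (k, t) \<longrightarrow> (k, t) \<in> fst ` set F)"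
      unfolding case_prod_unfold by blast
  next
    fix un assume un: "un \<in> set F"
    obtain u n where un': "un = (u, n)" by fastforce
    have "u \<in> U" using F(2) un un' by force
    then have "fst u \<in> set SS" "\<exists>(t, m)\<in>set Ts. t = snd u" by (auto simp: U_def)
    moreover have "cert_base (pc, \<beta>, vs, fc) c0 u \<or> (\<exists>(v, m)\<in>set F. m < n \<and> cert_step (pc, \<beta>, vs, fc) c0 v u)"
      using F(4) un un' unfolding B_def by blast
    ultimately show "case un of (u, n) \<Rightarrow> fst u \<in> set SS \<and> (\<exists>(t, m)\<in>set Ts. t = snd u)
      \<and> (cert_base (pc, \<beta>, vs, fc) c0 u \<or> (\<exists>(v, m)\<in>set F. m < n \<and> cert_step (pc, \<beta>, vs, fc) c0 v u))"
      unfolding un' by simp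
  qed
  define out where "out = map (\<lambda>k. (k, e, map (snd \<circ> fst) (filter (\<lambda>(u, n). fst u = k) F), \<delta>)) SS"
  have "cert_out (pc, \<beta>, vs, fc) (out, SS, Ts, e, \<delta>, lam, Y, F)"
    unfolding cert_out_def out_def by (auto simp: image_iff)
  then have "cert (pc, \<beta>, vs, fc) (out, SS, Ts, e, \<delta>, lam, Y, F)"
    unfolding cert_def using states right left nfas drained by blast
  then show ?thesis ..
qed

end

theorem theorem8p8:
  shows
  "(\<exists>decider :: recf. \<forall>pc \<beta> vs fc. valid_instance pc \<beta> vs fc \<longrightarrow>
      reval decider [enc_input pc \<beta> vs fc]
        (if (\<exists>Q. is_extension (decode_protocol pc) \<beta> (decode_V vs)
                   (decode_family (pnodes (decode_protocol pc)) fc) Q) then 1 else 0))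
 \<and> (\<exists>constructor :: recf. \<forall>pc \<beta> vs fc.
      valid_instance pc \<beta> vs fc
      \<longrightarrow> (\<exists>Q. is_extension (decode_protocol pc) \<beta> (decode_V vs)
                 (decode_family (pnodes (decode_protocol pc)) fc) Q)
      \<longrightarrow> (\<exists>Qmin. smallest_extension (decode_protocol pc) \<beta> (decode_V vs)
                    (decode_family (pnodes (decode_protocol pc)) fc) Qmin
              \<and> (\<forall>S\<in>comp_states (decode_protocol pc). regular (Qmin S))
              \<and> (\<exists>out. reval constructor [enc_input pc \<beta> vs fc] (enc_family out)
                    \<and> covers (pnodes (decode_protocol pc)) out (comp_states (decode_protocol pc))
                    \<and> (\<forall>S\<in>comp_states (decode_protocol pc).
                          decode_family (pnodes (decode_protocol pc)) out S = Qmin S))))"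
proof (intro conjI)
  \<comment> \<open>The search delivers some certificate; \<open>extension_iff_ok\<close> holds for
    each, so \<open>cert_ok\<close> gives the same answer on all of them.\<close>
  obtain r where r: "\<And>x. \<exists>c. cert x c \<Longrightarrow> \<exists>c. cert x c \<and> reval r [encd x] (encd (cert_ok x c))"
    using reval_search[OF comput_cert comput_cert_ok] by blast
  have "reval r [enc_input pc \<beta> vs fc]
        (if (\<exists>Q. is_extension (decode_protocol pc) \<beta> (decode_V vs)
                   (decode_family (pnodes (decode_protocol pc)) fc) Q) then 1 else 0)"
    if v: "valid_instance pc \<beta> vs fc" for pc \<beta> vs fc
  proof -
    interpret valid_input pc \<beta> vs fc by unfold_locales (rule v)
    obtain w where "cert (pc, \<beta>, vs, fc) w" "reval r [encd (pc, \<beta>, vs, fc)] (encd (cert_ok (pc, \<beta>, vs, fc) w))"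
      using r[OF cert_exists] by blast
    moreover obtain out SS Ts e \<delta> lam Y F where "w = (out, SS, Ts, e, \<delta>, lam, Y, F)"
      using surjective_pairing by metis
    ultimately have c: "cert (pc, \<beta>, vs, fc) (out, SS, Ts, e, \<delta>, lam, Y, F)"
      and re: "reval r [encd (pc, \<beta>, vs, fc)] (encd (cert_ok (pc, \<beta>, vs, fc) (out, SS, Ts, e, \<delta>, lam, Y, F)))"
      by simp_all
    interpret certified pc \<beta> vs fc out SS Ts e \<delta> lam Y F by unfold_locales (rule c)
    have "encd (cert_ok inp c) = (if \<exists>Q. is_extension P \<beta> V Q0 Q then 1 else 0)"
      unfolding extension_iff_ok encd_bool_def by simp
    with re show ?thesis by (simp only: enc_input_encd decode_protocol_simps(1))
  qed
  then show "\<exists>decider :: recf. \<forall>pc \<beta> vs fc. valid_instance pc \<beta> vs fc \<longrightarrow>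
      reval decider [enc_input pc \<beta> vs fc]
        (if (\<exists>Q. is_extension (decode_protocol pc) \<beta> (decode_V vs)
                   (decode_family (pnodes (decode_protocol pc)) fc) Q) then 1 else 0)"
    by blast
next
  \<comment> \<open>The same search, now read out by the first component of the certificate.\<close>
  have "comput (\<lambda>p :: input \<times> cert. fst (snd p))" by (intro comput_intros)
  then obtain r where r: "\<And>x. \<exists>c. cert x c \<Longrightarrow> \<exists>c. cert x c \<and> reval r [encd x] (encd (fst c))"
    using reval_search[OF comput_cert, of "\<lambda>x c. fst c"] by blast
  have "\<exists>Qmin. smallest_extension (decode_protocol pc) \<beta> (decode_V vs)
                    (decode_family (pnodes (decode_protocol pc)) fc) Qmin
              \<and> (\<forall>S\<in>comp_states (decode_protocol pc). regular (Qmin S))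
              \<and> (\<exists>out. reval r [enc_input pc \<beta> vs fc] (enc_family out)
                    \<and> covers (pnodes (decode_protocol pc)) out (comp_states (decode_protocol pc))
                    \<and> (\<forall>S\<in>comp_states (decode_protocol pc).
                          decode_family (pnodes (decode_protocol pc)) out S = Qmin S))"
    if v: "valid_instance pc \<beta> vs fc" and
      ext: "\<exists>Q. is_extension (decode_protocol pc) \<beta> (decode_V vs) (decode_family (pnodes (decode_protocol pc)) fc) Q"
    for pc \<beta> vs fc
  proof -
    interpret valid_input pc \<beta> vs fc by unfold_locales (rule v)
    obtain w where "cert (pc, \<beta>, vs, fc) w" "reval r [encd (pc, \<beta>, vs, fc)] (encd (fst w))"
      using r[OF cert_exists] by blast
    moreover obtain out SS Ts e \<delta> lam Y F where "w = (out, SS, Ts, e, \<delta>, lam, Y, F)"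
      using surjective_pairing by metis
    ultimately have c: "cert (pc, \<beta>, vs, fc) (out, SS, Ts, e, \<delta>, lam, Y, F)"
      and re: "reval r [encd (pc, \<beta>, vs, fc)] (encd out)"
      by simp_all
    interpret certified pc \<beta> vs fc out SS Ts e \<delta> lam Y F by unfold_locales (rule c)
    have "smallest_extension P \<beta> V Q0 D"
      using ext unfolding decode_protocol_simps(1) by (intro smallest_extension_drain Q0_lists)
    moreover have "regular (D S)" if "S \<in> comp_states P" for S
    proof -
      \<comment> \<open>If the lookup fails the value is the empty set by default; an automaton
        without final states accounts for this case.\<close>
      have "decode_family N out S \<noteq> {} \<Longrightarrow> \<exists>A. decode_family N out S = nfa_lang A"
        by (auto simp: decode_family_def split: option.splits)
      moreover have "nfa_lang (0, [], []) = {}" by (simp add: nfa_lang_def)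
      ultimately show ?thesis unfolding regular_def using out_correct(2)[OF that] by metis
    qed
    ultimately show ?thesis
      unfolding enc_input_encd enc_family_encd decode_protocol_simps(1)
      using re out_correct by (intro exI[of _ D] conjI exI[of _ out]) auto
  qed
  then show "\<exists>constructor :: recf. \<forall>pc \<beta> vs fc.
      valid_instance pc \<beta> vs fc
      \<longrightarrow> (\<exists>Q. is_extension (decode_protocol pc) \<beta> (decode_V vs)
                 (decode_family (pnodes (decode_protocol pc)) fc) Q)
      \<longrightarrow> (\<exists>Qmin. smallest_extension (decode_protocol pc) \<beta> (decode_V vs)
                    (decode_family (pnodes (decode_protocol pc)) fc) Qmin
              \<and> (\<forall>S\<in>comp_states (decode_protocol pc). regular (Qmin S))
              \<and> (\<exists>out. reval constructor [enc_input pc \<beta> vs fc] (enc_family out)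
                    \<and> covers (pnodes (decode_protocol pc)) out (comp_states (decode_protocol pc))
                    \<and> (\<forall>S\<in>comp_states (decode_protocol pc).
                          decode_family (pnodes (decode_protocol pc)) out S = Qmin S)))"
    by blast
qed

end
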